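(* Let $Y \colon \mathbf{cBr} \rightarrow \mathbf{Vect}$ be a symmetric strict monoidal functor from the chromatic Brauer category into the category of real vector spaces and linear maps (equipped with the Schauenburg tensor product). Then, for each $k\in\mathbb{N}$, the vector space $Y((k))$ is of finite dimension, say $d_k$. Suppose that $d_k > 0$ for all $k\in \mathbb{N}$. Then the functor $Y$ is faithful if and only if the sequence $d_{0}, d_{1}, \dots$ satisfies, for all $(l_k)_{k \in \mathbb{N}} \in \bigoplus_{k=0}^{\infty}\mathbb{Z}$, the implication $$\prod_{k=0}^\infty d_k^{l_k} = 1 \quad \Rightarrow \quad l_k= 0 \text{ for all } k\in \mathbb{N}.$$
   Context: $\mathbb{N}=\{0,1,2,\dots\}$. $\bigoplus_{k=0}^\infty\mathbb{Z}$ is the set of integer sequences with only finitely many nonzero entries. **Chromatic Brauer category.** The strict monoidal category $\mathbf{cBr}$ is defined as follows. Its objects are the finite formal tensor products $(k_1)\otimes\dots\otimes(k_m)$, $m\ge 0$, $k_i\in\mathbb{N}$ (words in the letters $(k)$, $k\in\mathbb{N}$); the tensor product is concatenation and the unit $I$ is the empty word. The object $(k_1)\otimes\dots\otimes(k_m)$ is also written $([m],c)$, where $[m]=\{1,\dots,m\}$ and $c\colon[m]\to\mathbb{N}$, $c(i)=k_i$; in particular $(k)=([1],\underline{k})$. The dual of $X=(k_1)\otimes\dots\otimes(k_m)$ is $X^\star=(k_m)\otimes\dots\otimes(k_1)$; thus $(k)^\star=(k)$, $I^\star=I$, $X^{\star\star}=X$, $(X\otimes Y)^\star=Y^\star\otimes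 X^\star$. As a strict monoidal category, $\mathbf{cBr}$ is generated by morphisms $b_{X,Y}\colon X\otimes Y\to Y\otimes X$ (symmetric braiding), $i_X\colon I\to X\otimes X^\star$ (unit), $e_X\colon X^\star\otimes X\to I$ (counit), for all objects $X,Y$, subject exactly to the relations: (C1) $b_{Y,Z}\circ(f\otimes 1_Z)=(1_Z\otimes f)\circ b_{X,Z}$ and $b_{Z,Y}\circ(1_Z\otimes f)=(f\otimes 1_Z)\circ b_{Z,X}$ for all morphisms $f\colon X\to Y$ and objects $Z$; (C2) $b_{X,Y\otimes Z}=(1_Y\otimes b_{X,Z})\circ(b_{X,Y}\otimes 1_Z)$, $b_{X,I}=1_X$, $b_{Y,X}\circ b_{X,Y}=1_{X\otimes Y}$; (C3) $(e_X\otimes 1_{X^\star})\circ(1_{X^\star}\otimes i_X)=1_{X^\star}$, $(1_X\otimes e_X)\circ(i_X\otimes 1_X)=1_X$; (C4) $i_{X\otimes Y}=(1_X\otimes i_Y\otimes 1_{X^\star})\circ i_X$, $i_I=1_I$, $b_{X,X^\star}\circ i_X=i_{X^\star}$. Intuitively, morphisms are ambient isotopy classes of 1-dimensional unoriented tangles in a high-dimensional Euclidean space whose components are labeled by elements of $\mathbb{N}$, compatibly with the labels of endpoints. **Target category.** $\mathbf{Vect}$ is the category of real vector spaces and linear maps, with the strict monoidal structure given by the Schauenburg tensor product (again denoted $\otimes$), with unit object $\mathbb{R}$. It is related to the usual tensor product $\otimes^{\mathrm{usual}}$ by a monoidal equivalence whose underlying functor is the identity of $\mathbf{Vect}$ and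 whose unit comparison is the identity of $\mathbb{R}$, i.e. there is a coherent natural isomorphism $\xi_{V,W}\colon V\otimes^{\mathrm{usual}}W\to V\otimes W$; one writes $v\otimes w$ for the image of the usual pure tensor. The symmetric braiding is $b_{V,W}(v\otimes w)=w\otimes v$. A symmetric strict monoidal functor $Y$ is a functor with $Y(I)=\mathbb{R}$, $Y(X\otimes X')=Y(X)\otimes Y(X')$ on objects and on morphisms, and $Y(b_{X,X'})=b_{Y(X),Y(X')}$. Faithful means injective on each Hom-set. *)

theory Defs
  imports Complex_Main "HOL-Library.FuncSet" "Jordan_Normal_Form.VS_Connect"
begin

section \<open>Symmetric strict monoidal structures, functors and faithfulness\<close>

record ('o, 'm) monoidal_data =
  Ob    :: "'o set"
  Mor   :: "'o \<Rightarrow> 'o \<Rightarrow> 'm set"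
  Idm   :: "'o \<Rightarrow> 'm"
  Cmp   :: "'m \<Rightarrow> 'm \<Rightarrow> 'm"    \<comment> \<open>\<open>Cmp g f\<close> is \<open>g \<circ> f\<close>\<close>
  UnitO :: "'o"
  TenO  :: "'o \<Rightarrow> 'o \<Rightarrow> 'o"
  TenM  :: "'m \<Rightarrow> 'm \<Rightarrow> 'm"
  Brd   :: "'o \<Rightarrow> 'o \<Rightarrow> 'm"

locale symmetric_strict_monoidal_functor =
  fixes C :: "('o, 'm) monoidal_data"
    and D :: "('p, 'n) monoidal_data"
    and FO :: "'o \<Rightarrow> 'p"
    and FM :: "'m \<Rightarrow> 'n"
  assumes obj: "X \<in> Ob C \<Longrightarrow> FO X \<in> Ob D"
    and mor: "\<lbrakk>X \<in> Ob C; Y \<in> Ob C; f \<in> Mor C X Y\<rbrakk> \<Longrightarrow> FM f \<in> Mor D (FO X) (FO Y)"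
    and ident: "X \<in> Ob C \<Longrightarrow> FM (Idm C X) = Idm D (FO X)"
    and comp: "\<lbrakk>X \<in> Ob C; Y \<in> Ob C; Z \<in> Ob C; f \<in> Mor C X Y; g \<in> Mor C Y Z\<rbrakk>
          \<Longrightarrow> FM (Cmp C g f) = Cmp D (FM g) (FM f)"
    and unit: "FO (UnitO C) = UnitO D"
    and tensor_obj: "\<lbrakk>X \<in> Ob C; Y \<in> Ob C\<rbrakk> \<Longrightarrow> FO (TenO C X Y) = TenO D (FO X) (FO Y)"
    and tensor_mor: "\<lbrakk>X \<in> Ob C; Y \<in> Ob C; X' \<in> Ob C; Y' \<in> Ob C;
            f \<in> Mor C X Y; g \<in> Mor C X' Y'\<rbrakk>
          \<Longrightarrow> FM (TenM C f g) = TenM D (FM f) (FM g)"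
    and braid: "\<lbrakk>X \<in> Ob C; Y \<in> Ob C\<rbrakk> \<Longrightarrow> FM (Brd C X Y) = Brd D (FO X) (FO Y)"

definition faithful :: "('o, 'm) monoidal_data \<Rightarrow> ('m \<Rightarrow> 'n) \<Rightarrow> bool" where
  "faithful C FM \<longleftrightarrow> (\<forall>X\<in>Ob C. \<forall>Y\<in>Ob C. inj_on FM (Mor C X Y))"


section \<open>The chromatic Brauer category\<close>

text \<open>The object \<open>(k1) \<otimes> \<dots> \<otimes> (km)\<close> is the list \<open>[k1, \<dots>, km]\<close>; the tensor product is
  \<^term>\<open>(@)\<close>, the unit is \<^term>\<open>[]\<close> and the dual is \<^term>\<open>rev\<close>.
  Morphisms are well-typed formal expressions in the generators, modulo the least congruence
  containing the axioms of a strict monoidal category and the defining relations of the braiding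
  and of the duality.\<close>

type_synonym cbr_obj = "nat list"

datatype cbr_expr =
    Ident cbr_obj
  | Compose cbr_expr cbr_expr  (infixr "\<cdot>" 60)
  | Tensor cbr_expr cbr_expr   (infixr "\<boxtimes>" 70)
  | Braid cbr_obj cbr_obj
  | Coev cbr_obj  \<comment> \<open>the unit \<open>i\<close> of the duality\<close>
  | Ev cbr_obj    \<comment> \<open>the counit \<open>e\<close> of the duality\<close>

inductive cbr_arr :: "cbr_expr \<Rightarrow> cbr_obj \<Rightarrow> cbr_obj \<Rightarrow> bool" where
  "cbr_arr (Ident X) X X"
| "cbr_arr f X Y \<Longrightarrow> cbr_arr g Y Z \<Longrightarrow> cbr_arr (g \<cdot> f) X Z"
| "cbr_arr f X Y \<Longrightarrow> cbr_arr g X' Y' \<Longrightarrow> cbr_arr (f \<boxtimes> g) (X @ X') (Y @ Y')"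
| "cbr_arr (Braid X Y) (X @ Y) (Y @ X)"
| "cbr_arr (Coev X) [] (X @ rev X)"
| "cbr_arr (Ev X) (rev X @ X) []"

inductive cbr_eq :: "cbr_expr \<Rightarrow> cbr_expr \<Rightarrow> bool"  (infix "\<approx>" 50) where
  refl: "cbr_arr f X Y \<Longrightarrow> f \<approx> f"
| sym: "f \<approx> g \<Longrightarrow> g \<approx> f"
| trans: "f \<approx> g \<Longrightarrow> g \<approx> h \<Longrightarrow> f \<approx> h"
| comp_cong: "cbr_arr f X Y \<Longrightarrow> cbr_arr g Y Z \<Longrightarrow> f \<approx> f' \<Longrightarrow> g \<approx> g' \<Longrightarrow> g \<cdot> f \<approx> g' \<cdot> f'"
| tensor_cong: "f \<approx> f' \<Longrightarrow> g \<approx> g' \<Longrightarrow> f \<boxtimes> g \<approx> f' \<boxtimes> g'"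
  \<comment> \<open>category\<close>
| id_left: "cbr_arr f X Y \<Longrightarrow> Ident Y \<cdot> f \<approx> f"
| id_right: "cbr_arr f X Y \<Longrightarrow> f \<cdot> Ident X \<approx> f"
| comp_assoc: "cbr_arr f W X \<Longrightarrow> cbr_arr g X Y \<Longrightarrow> cbr_arr h Y Z \<Longrightarrow>
    (h \<cdot> g) \<cdot> f \<approx> h \<cdot> (g \<cdot> f)"
  \<comment> \<open>strict monoidal structure\<close>
| tensor_id: "Ident X \<boxtimes> Ident Y \<approx> Ident (X @ Y)"
| interchange: "cbr_arr f X Y \<Longrightarrow> cbr_arr g Y Z \<Longrightarrow> cbr_arr f' X' Y' \<Longrightarrow> cbr_arr g' Y' Z' \<Longrightarrow>
    (g \<cdot> f) \<boxtimes> (g' \<cdot> f') \<approx> (g \<boxtimes> g') \<cdot> (f \<boxtimes> f')"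
| tensor_assoc: "cbr_arr f X Y \<Longrightarrow> cbr_arr g X' Y' \<Longrightarrow> cbr_arr h X'' Y'' \<Longrightarrow>
    (f \<boxtimes> g) \<boxtimes> h \<approx> f \<boxtimes> (g \<boxtimes> h)"
| tensor_unit_left: "cbr_arr f X Y \<Longrightarrow> Ident [] \<boxtimes> f \<approx> f"
| tensor_unit_right: "cbr_arr f X Y \<Longrightarrow> f \<boxtimes> Ident [] \<approx> f"
| braid_nat_left: "cbr_arr f X Y \<Longrightarrow>
    Braid Y Z \<cdot> (f \<boxtimes> Ident Z) \<approx> (Ident Z \<boxtimes> f) \<cdot> Braid X Z"
| braid_nat_right: "cbr_arr f X Y \<Longrightarrow>
    Braid Z Y \<cdot> (Ident Z \<boxtimes> f) \<approx> (f \<boxtimes> Ident Z) \<cdot> Braid Z X"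
| braid_hexagon: "Braid X (Y @ Z) \<approx> (Ident Y \<boxtimes> Braid X Z) \<cdot> (Braid X Y \<boxtimes> Ident Z)"
| braid_unit: "Braid X [] \<approx> Ident X"
| braid_symmetry: "Braid Y X \<cdot> Braid X Y \<approx> Ident (X @ Y)"
| zigzag_left: "(Ev X \<boxtimes> Ident (rev X)) \<cdot> (Ident (rev X) \<boxtimes> Coev X) \<approx> Ident (rev X)"
| zigzag_right: "(Ident X \<boxtimes> Ev X) \<cdot> (Coev X \<boxtimes> Ident X) \<approx> Ident X"
| coev_tensor: "Coev (X @ Y) \<approx> (Ident X \<boxtimes> Coev Y \<boxtimes> Ident (rev X)) \<cdot> Coev X"
| coev_unit: "Coev [] \<approx> Ident []"
| coev_braid: "Braid X (rev X) \<cdot> Coev X \<approx> Coev (rev X)"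

definition cbr_class :: "cbr_expr \<Rightarrow> cbr_expr set" where
  "cbr_class f = {g. f \<approx> g}"

definition cBr :: "(cbr_obj, cbr_expr set) monoidal_data" where
  "cBr = \<lparr> Ob = UNIV,
     Mor = (\<lambda>X Y. cbr_class ` {f. cbr_arr f X Y}),
     Idm = (\<lambda>X. cbr_class (Ident X)),
     Cmp = (\<lambda>G F. \<Union>g\<in>G. \<Union>f\<in>F. cbr_class (g \<cdot> f)),
     UnitO = [],
     TenO = (@),
     TenM = (\<lambda>F G. \<Union>f\<in>F. \<Union>g\<in>G. cbr_class (f \<boxtimes> g)),
     Brd = (\<lambda>X Y. cbr_class (Braid X Y)) \<rparr>"

text \<open>Related expressions are parallel, and the operations on classes are computed on arbitrary
  representatives.\<close>

lemma cbr_arr_simps: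
  "cbr_arr (Ident X) A B \<longleftrightarrow> A = X \<and> B = X"
  "cbr_arr (g \<cdot> f) A B \<longleftrightarrow> (\<exists>C. cbr_arr f A C \<and> cbr_arr g C B)"
  "cbr_arr (f \<boxtimes> g) A B \<longleftrightarrow> (\<exists>X X' Y Y'. A = X @ X' \<and> B = Y @ Y' \<and> cbr_arr f X Y \<and> cbr_arr g X' Y')"
  "cbr_arr (Braid X Y) A B \<longleftrightarrow> A = X @ Y \<and> B = Y @ X"
  "cbr_arr (Coev X) A B \<longleftrightarrow> A = [] \<and> B = X @ rev X"
  "cbr_arr (Ev X) A B \<longleftrightarrow> A = rev X @ X \<and> B = []"
proof -
  show "cbr_arr (Ident X) A B \<longleftrightarrow> A = X \<and> B = X"
    by (auto elim: cbr_arr.cases intro: cbr_arr.intros)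
  show "cbr_arr (g \<cdot> f) A B \<longleftrightarrow> (\<exists>C. cbr_arr f A C \<and> cbr_arr g C B)"
    by (rule iffI, erule cbr_arr.cases, simp_all, blast, blast intro: cbr_arr.intros)
  show "cbr_arr (f \<boxtimes> g) A B \<longleftrightarrow>
    (\<exists>X X' Y Y'. A = X @ X' \<and> B = Y @ Y' \<and> cbr_arr f X Y \<and> cbr_arr g X' Y')"
    by (rule iffI, erule cbr_arr.cases, simp_all, blast, blast intro: cbr_arr.intros)
  show "cbr_arr (Braid X Y) A B \<longleftrightarrow> A = X @ Y \<and> B = Y @ X"
    by (rule iffI, erule cbr_arr.cases, simp_all add: cbr_arr.intros)
  show "cbr_arr (Coev X) A B \<longleftrightarrow> A = [] \<and> B = X @ rev X"
    by (rule iffI, erule cbr_arr.cases, simp_all add: cbr_arr.intros)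
  show "cbr_arr (Ev X) A B \<longleftrightarrow> A = rev X @ X \<and> B = []"
    by (rule iffI, erule cbr_arr.cases, simp_all add: cbr_arr.intros)
qed

lemma cbr_arr_unique: "cbr_arr f X Y \<Longrightarrow> cbr_arr f X' Y' \<Longrightarrow> X' = X \<and> Y' = Y"
proof (induction arbitrary: X' Y' rule: cbr_arr.induct)
  case (2 f X Y g Z)
  from 2(5) obtain C where "cbr_arr f X' C" "cbr_arr g C Y'" unfolding cbr_arr_simps by blast
  with 2(3)[of X' C] 2(4)[of C Y'] show ?case by blast
next
  case (3 f X Y g A B)
  from 3(5) obtain P P' Q Q' where "X' = P @ P'" "Y' = Q @ Q'" "cbr_arr f P Q" "cbr_arr g P' Q'"
    unfolding cbr_arr_simps by blast
  with 3(3)[of P Q] 3(4)[of P' Q'] show ?case by blast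
qed (unfold cbr_arr_simps, simp_all)

lemma cbr_arr_TensorI:
  "cbr_arr f X Y \<Longrightarrow> cbr_arr g X' Y' \<Longrightarrow> A = X @ X' \<Longrightarrow> B = Y @ Y' \<Longrightarrow> cbr_arr (f \<boxtimes> g) A B"
  using cbr_arr.intros(3) by simp

lemma cbr_eq_arr: "f \<approx> g \<Longrightarrow> \<exists>X Y. cbr_arr f X Y \<and> cbr_arr g X Y"
proof (induction rule: cbr_eq.induct)
  case (trans f g h)
  then show ?case by (metis cbr_arr_unique)
next
  case (comp_cong f X Y g Z f' g')
  then show ?case by (metis cbr_arr_unique cbr_arr.intros(2))
next
  case (tensor_cong f f' g g')
  then show ?case by (metis cbr_arr.intros(3))
next
  case (comp_assoc f W X g Y h Z)
  then show ?case by (blast intro: cbr_arr.intros(2))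
next
  case (tensor_assoc f X Y g X' Y' h X'' Y'')
  show ?case
    using cbr_arr.intros(3)[OF cbr_arr.intros(3)[OF tensor_assoc(1,2)] tensor_assoc(3)]
      cbr_arr.intros(3)[OF tensor_assoc(1) cbr_arr.intros(3)[OF tensor_assoc(2,3)]]
    by auto
next
  case (tensor_id X Y)
  show ?case using cbr_arr.intros(3)[OF cbr_arr.intros(1) cbr_arr.intros(1)] cbr_arr.intros(1)
    by blast
next
  case (braid_nat_left f X Y Z)
  show ?case
    using cbr_arr.intros(2)[OF cbr_arr.intros(3)[OF braid_nat_left cbr_arr.intros(1)] cbr_arr.intros(4)]
      cbr_arr.intros(2)[OF cbr_arr.intros(4) cbr_arr.intros(3)[OF cbr_arr.intros(1) braid_nat_left]]
    by blast
next
  case (braid_nat_right f X Y Z)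
  show ?case
    using cbr_arr.intros(2)[OF cbr_arr.intros(3)[OF cbr_arr.intros(1) braid_nat_right] cbr_arr.intros(4)]
      cbr_arr.intros(2)[OF cbr_arr.intros(4) cbr_arr.intros(3)[OF braid_nat_right cbr_arr.intros(1)]]
    by blast
next
  case (braid_hexagon X Y Z)
  have "cbr_arr (Ident Y \<boxtimes> Braid X Z) (Y @ X @ Z) (Y @ Z @ X)"
    "cbr_arr (Braid X Y \<boxtimes> Ident Z) (X @ Y @ Z) (Y @ X @ Z)"
    by (rule cbr_arr_TensorI, rule cbr_arr.intros, rule cbr_arr.intros, simp, simp)+
  moreover have "cbr_arr (Braid X (Y @ Z)) (X @ Y @ Z) (Y @ Z @ X)"
    using cbr_arr.intros(4)[of X "Y @ Z"] by simp
  ultimately show ?case by (blast intro: cbr_arr.intros(2))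
next
  case (zigzag_left X)
  have "cbr_arr (Ev X \<boxtimes> Ident (rev X)) (rev X @ X @ rev X) (rev X)"
    "cbr_arr (Ident (rev X) \<boxtimes> Coev X) (rev X) (rev X @ X @ rev X)"
    by (rule cbr_arr_TensorI, rule cbr_arr.intros, rule cbr_arr.intros, simp, simp)+
  then show ?case by (blast intro: cbr_arr.intros(1,2))
next
  case (zigzag_right X)
  have "cbr_arr (Ident X \<boxtimes> Ev X) (X @ rev X @ X) X"
    "cbr_arr (Coev X \<boxtimes> Ident X) X (X @ rev X @ X)"
    by (rule cbr_arr_TensorI, rule cbr_arr.intros, rule cbr_arr.intros, simp, simp)+
  then show ?case by (blast intro: cbr_arr.intros(1,2))
next
  case (coev_tensor X Y)
  have "cbr_arr (Coev Y \<boxtimes> Ident (rev X)) (rev X) (Y @ rev Y @ rev X)"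
    by (rule cbr_arr_TensorI, rule cbr_arr.intros, rule cbr_arr.intros, simp, simp)
  then have "cbr_arr (Ident X \<boxtimes> Coev Y \<boxtimes> Ident (rev X)) (X @ rev X) (X @ Y @ rev Y @ rev X)"
    by (rule cbr_arr_TensorI[OF cbr_arr.intros(1)]) simp_all
  moreover have "cbr_arr (Coev (X @ Y)) [] (X @ Y @ rev Y @ rev X)"
    using cbr_arr.intros(5)[of "X @ Y"] by simp
  ultimately show ?case using cbr_arr.intros(2)[OF cbr_arr.intros(5)] by blast
next
  case coev_unit
  show ?case using cbr_arr.intros(5)[of "[]"] by (auto intro: cbr_arr.intros(1))
next
  case (coev_braid X)
  have "cbr_arr (Coev (rev X)) [] (rev X @ X)"
    using cbr_arr.intros(5)[of "rev X"] by simp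
  then show ?case using cbr_arr.intros(2)[OF cbr_arr.intros(5) cbr_arr.intros(4)] by blast
next
  case (interchange f X Y g Z f' X' Y' g' Z')
  show ?case
    using cbr_arr.intros(3)[OF cbr_arr.intros(2)[OF interchange(1,2)]
        cbr_arr.intros(2)[OF interchange(3,4)]]
      cbr_arr.intros(2)[OF cbr_arr.intros(3)[OF interchange(1,3)]
        cbr_arr.intros(3)[OF interchange(2,4)]]
    by blast
next
  case (tensor_unit_left f X Y)
  then show ?case using cbr_arr.intros(3)[OF cbr_arr.intros(1)[of "[]"]] by fastforce
next
  case (tensor_unit_right f X Y)
  then show ?case using cbr_arr.intros(3)[OF _ cbr_arr.intros(1)[of "[]"]] by fastforce
next
  case (braid_unit X)
  show ?case using cbr_arr.intros(1)[of X] cbr_arr.intros(4)[of X "[]"] by auto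
next
  case (id_left f X Y)
  then show ?case using cbr_arr.intros(2)[OF id_left cbr_arr.intros(1)] by blast
next
  case (id_right f X Y)
  then show ?case using cbr_arr.intros(2)[OF cbr_arr.intros(1) id_right] by blast
next
  case (braid_symmetry Y X)
  show ?case using cbr_arr.intros(2)[OF cbr_arr.intros(4)[of X Y] cbr_arr.intros(4)] cbr_arr.intros(1)
    by blast
qed blast+

lemma cbr_class_eq: "f \<approx> g \<Longrightarrow> cbr_class f = cbr_class g"
  unfolding cbr_class_def by (auto intro: cbr_eq.sym cbr_eq.trans)

lemma cBr_Cmp:
  assumes "cbr_arr f X Y" "cbr_arr g Y Z"
  shows "Cmp cBr (cbr_class g) (cbr_class f) = cbr_class (g \<cdot> f)"
proof -
  have 1: "cbr_class (g' \<cdot> f') = cbr_class (g \<cdot> f)" if "f' \<in> cbr_class f" "g' \<in> cbr_class g" for f' g'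
    using cbr_class_eq[OF cbr_eq.comp_cong[OF assms]] that[unfolded cbr_class_def mem_Collect_eq]
    by simp
  have f: "f \<in> cbr_class f" and g: "g \<in> cbr_class g"
    using cbr_eq.refl[OF assms(1)] cbr_eq.refl[OF assms(2)] unfolding cbr_class_def by simp_all
  have "(\<Union>g'\<in>cbr_class g. \<Union>f'\<in>cbr_class f. cbr_class (g' \<cdot> f')) = cbr_class (g \<cdot> f)"
  proof (intro equalityI UN_least)
    show "cbr_class (g \<cdot> f) \<subseteq> (\<Union>g'\<in>cbr_class g. \<Union>f'\<in>cbr_class f. cbr_class (g' \<cdot> f'))"
      by (rule order_trans[OF _ UN_upper[OF g]], rule UN_upper[OF f])
  qed (simp add: 1)
  then show ?thesis unfolding cBr_def by simp
qed

lemma cBr_TenM: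
  assumes "cbr_arr f X Y" "cbr_arr g X' Y'"
  shows "TenM cBr (cbr_class f) (cbr_class g) = cbr_class (f \<boxtimes> g)"
proof -
  have 1: "cbr_class (f' \<boxtimes> g') = cbr_class (f \<boxtimes> g)" if "f' \<in> cbr_class f" "g' \<in> cbr_class g" for f' g'
    using cbr_class_eq[OF cbr_eq.tensor_cong] that[unfolded cbr_class_def mem_Collect_eq]
    by simp
  have f: "f \<in> cbr_class f" and g: "g \<in> cbr_class g"
    using cbr_eq.refl[OF assms(1)] cbr_eq.refl[OF assms(2)] unfolding cbr_class_def by simp_all
  have "(\<Union>f'\<in>cbr_class f. \<Union>g'\<in>cbr_class g. cbr_class (f' \<boxtimes> g')) = cbr_class (f \<boxtimes> g)"
  proof (intro equalityI UN_least)
    show "cbr_class (f \<boxtimes> g) \<subseteq> (\<Union>f'\<in>cbr_class f. \<Union>g'\<in>cbr_class g. cbr_class (f' \<boxtimes> g'))"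
      by (rule order_trans[OF _ UN_upper[OF f]], rule UN_upper[OF g])
  qed (simp add: 1)
  then show ?thesis unfolding cBr_def by simp
qed


section \<open>Real vector spaces with a strict tensor product\<close>

text \<open>\<open>'v\<close> is the universe of vectors: an object of the category is any real vector space whose
  underlying set is a subset of \<open>'v\<close>.\<close>

type_synonym 'v rvs = "(real, 'v) module"

abbreviation real_field :: "real ring" where
  "real_field \<equiv> class_ring"

abbreviation is_rvs :: "'v rvs \<Rightarrow> bool" where
  "is_rvs V \<equiv> vectorspace real_field V"

text \<open>A linear map records its domain and codomain. Its underlying function is required to be
  \<^const>\<open>extensional\<close>, so that equality of morphisms is equality on the domain.\<close>

datatype 'v lin = Lin (Src: "'v rvs") (Tgt: "'v rvs") (App: "'v \<Rightarrow> 'v")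

definition lin_maps :: "'v rvs \<Rightarrow> 'v rvs \<Rightarrow> 'v lin set" where
  "lin_maps V W = {Lin V W f | f. linear_map real_field V W f \<and> f \<in> extensional (carrier V)}"

definition bilinear_rvs :: "'v rvs \<Rightarrow> 'v rvs \<Rightarrow> 'v rvs \<Rightarrow> ('v \<Rightarrow> 'v \<Rightarrow> 'v) \<Rightarrow> bool" where
  "bilinear_rvs V W U \<beta> \<longleftrightarrow>
     (\<forall>w\<in>carrier W. linear_map real_field V U (\<lambda>v. \<beta> v w)) \<and>
     (\<forall>v\<in>carrier V. linear_map real_field W U (\<beta> v))"

definition is_tensor_product :: "'v rvs \<Rightarrow> 'v rvs \<Rightarrow> 'v rvs \<Rightarrow> ('v \<Rightarrow> 'v \<Rightarrow> 'v) \<Rightarrow> bool" where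
  "is_tensor_product V W T \<tau> \<longleftrightarrow>
     is_rvs T \<and> bilinear_rvs V W T \<tau> \<and>
     (\<forall>U \<beta>. is_rvs U \<and> bilinear_rvs V W U \<beta> \<longrightarrow>
        (\<exists>!h. h \<in> lin_maps T U \<and>
              (\<forall>v\<in>carrier V. \<forall>w\<in>carrier W. App h (\<tau> v w) = \<beta> v w)))"

text \<open>A strict monoidal structure on real vector spaces, together with a monoidal equivalence to the
  usual tensor product whose underlying functor and whose unit comparison are identities; the
  Schauenburg tensor product is such a structure. Here \<open>VT V W\<close> is the object \<open>V \<otimes> W\<close>, and
  \<open>tn V W v w\<close> is the image of the usual pure tensor under the comparison \<open>\<xi>\<close> from the usual
  tensor product of \<open>V\<close> and \<open>W\<close>. That \<open>\<xi>\<close> is an isomorphism is the universal property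
  of \<open>tn V W\<close>; its coherence is expressed on pure tensors, which determine it. The unit object
  \<open>RR\<close> is the real line, \<open>\<iota>\<close> being the embedding of the reals into the universe.\<close>

locale strict_tensor_structure =
  fixes RR :: "'v rvs"
    and \<iota> :: "real \<Rightarrow> 'v"
    and VT :: "'v rvs \<Rightarrow> 'v rvs \<Rightarrow> 'v rvs"
    and tn :: "'v rvs \<Rightarrow> 'v rvs \<Rightarrow> 'v \<Rightarrow> 'v \<Rightarrow> 'v"
  assumes unit_rvs: "is_rvs RR"
    and unit_bij: "bij_betw \<iota> UNIV (carrier RR)"
    and unit_add: "\<iota> (r + s) = \<iota> r \<oplus>\<^bsub>RR\<^esub> \<iota> s"
    and unit_smult: "\<iota> (r * s) = r \<odot>\<^bsub>RR\<^esub> \<iota> s"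
    and tensor: "\<lbrakk>is_rvs V; is_rvs W\<rbrakk> \<Longrightarrow> is_tensor_product V W (VT V W) (tn V W)"
    and assoc_obj: "\<lbrakk>is_rvs U; is_rvs V; is_rvs W\<rbrakk> \<Longrightarrow> VT (VT U V) W = VT U (VT V W)"
    and assoc: "\<lbrakk>is_rvs U; is_rvs V; is_rvs W; u \<in> carrier U; v \<in> carrier V; w \<in> carrier W\<rbrakk>
          \<Longrightarrow> tn (VT U V) W (tn U V u v) w = tn U (VT V W) u (tn V W v w)"
    and unit_left_obj: "is_rvs V \<Longrightarrow> VT RR V = V"
    and unit_right_obj: "is_rvs V \<Longrightarrow> VT V RR = V"
    and unit_left: "\<lbrakk>is_rvs V; v \<in> carrier V\<rbrakk> \<Longrightarrow> tn RR V (\<iota> r) v = r \<odot>\<^bsub>V\<^esub> v"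
    and unit_right: "\<lbrakk>is_rvs V; v \<in> carrier V\<rbrakk> \<Longrightarrow> tn V RR v (\<iota> r) = r \<odot>\<^bsub>V\<^esub> v"

lemma linear_map_iff: "linear_map real_field V W f \<longleftrightarrow> is_rvs V \<and> is_rvs W \<and>
   f \<in> carrier V \<rightarrow> carrier W \<and> (\<forall>x\<in>carrier V. \<forall>y\<in>carrier V. f (x \<oplus>\<^bsub>V\<^esub> y) = f x \<oplus>\<^bsub>W\<^esub> f y)
   \<and> (\<forall>r. \<forall>x\<in>carrier V. f (r \<odot>\<^bsub>V\<^esub> x) = r \<odot>\<^bsub>W\<^esub> f x)"
  unfolding linear_map_def mod_hom_def mod_hom_axioms_def LinearCombinations.module_hom_def
  by (auto simp: vectorspace_def)

lemma bilin_comp: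
  assumes "bilinear_rvs V' W' U \<beta>" "linear_map real_field V V' f"
    "linear_map real_field W W' g"
  shows "bilinear_rvs V W U (\<lambda>v w. \<beta> (f v) (g w))"
proof -
  have V: "is_rvs V" "is_rvs W"
    and f: "\<And>v. v \<in> carrier V \<Longrightarrow> f v \<in> carrier V'"
      "\<And>v w. v \<in> carrier V \<Longrightarrow> w \<in> carrier V \<Longrightarrow> f (v \<oplus>\<^bsub>V\<^esub> w) = f v \<oplus>\<^bsub>V'\<^esub> f w"
      "\<And>r v. v \<in> carrier V \<Longrightarrow> f (r \<odot>\<^bsub>V\<^esub> v) = r \<odot>\<^bsub>V'\<^esub> f v"
    and g: "\<And>v. v \<in> carrier W \<Longrightarrow> g v \<in> carrier W'"
      "\<And>v w. v \<in> carrier W \<Longrightarrow> w \<in> carrier W \<Longrightarrow> g (v \<oplus>\<^bsub>W\<^esub> w) = g v \<oplus>\<^bsub>W'\<^esub> g w"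
      "\<And>r v. v \<in> carrier W \<Longrightarrow> g (r \<odot>\<^bsub>W\<^esub> v) = r \<odot>\<^bsub>W'\<^esub> g v"
    using assms(2,3) unfolding linear_map_iff Pi_iff by metis+
  have b: "linear_map real_field V' U (\<lambda>v. \<beta> v w)" if "w \<in> carrier W'" for w
    using assms(1) that unfolding bilinear_rvs_def by blast
  have c: "linear_map real_field W' U (\<beta> v)" if "v \<in> carrier V'" for v
    using assms(1) that unfolding bilinear_rvs_def by blast
  show ?thesis
    unfolding bilinear_rvs_def
  proof (intro conjI ballI)
    fix w assume "w \<in> carrier W"
    from b[OF g(1)[OF this]] show "linear_map real_field V U (\<lambda>v. \<beta> (f v) (g w))"
      using V f unfolding linear_map_iff by (simp add: Pi_iff)
  next
    fix v assume "v \<in> carrier V"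
    from c[OF f(1)[OF this]] show "linear_map real_field W U (\<lambda>w. \<beta> (f v) (g w))"
      using V g unfolding linear_map_iff by (simp add: Pi_iff)
  qed
qed

lemma tensor_ex1:
  assumes "is_tensor_product V W T \<tau>" "is_rvs U" "bilinear_rvs V W U \<beta>"
  shows "\<exists>!h. h \<in> lin_maps T U \<and> (\<forall>v\<in>carrier V. \<forall>w\<in>carrier W. App h (\<tau> v w) = \<beta> v w)"
  by (rule assms(1)[unfolded is_tensor_product_def, THEN conjunct2, THEN conjunct2,
        rule_format, OF conjI, OF assms(2,3)])

lemma tensor_bilinear:
  assumes "is_tensor_product V W T \<tau>"
  shows "is_rvs T" "bilinear_rvs V W T \<tau>"
  using assms unfolding is_tensor_product_def by simp_all

context strict_tensor_structure begin

lemma TenM_ex1: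
  assumes "f \<in> lin_maps V V'" "g \<in> lin_maps W W'"
  shows "\<exists>!h. h \<in> lin_maps (VT V W) (VT V' W') \<and>
        (\<forall>v\<in>carrier V. \<forall>w\<in>carrier W. App h (tn V W v w) = tn V' W' (App f v) (App g w))"
proof -
  have f: "linear_map real_field V V' (App f)" and g: "linear_map real_field W W' (App g)"
    using assms by (auto simp: lin_maps_def)
  have rv: "is_rvs V" "is_rvs V'" "is_rvs W" "is_rvs W'"
    using f g unfolding linear_map_iff by simp_all
  show ?thesis
    using tensor_ex1[OF tensor[OF rv(1,3)] tensor_bilinear(1)[OF tensor[OF rv(2,4)]]
        bilin_comp[OF tensor_bilinear(2)[OF tensor[OF rv(2,4)]] f g]] .
qed

lemma Brd_ex1:
  assumes "is_rvs V" "is_rvs W"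
  shows "\<exists>!h. h \<in> lin_maps (VT V W) (VT W V) \<and>
        (\<forall>v\<in>carrier V. \<forall>w\<in>carrier W. App h (tn V W v w) = tn W V w v)"
proof -
  have "bilinear_rvs V W (VT W V) (\<lambda>v w. tn W V w v)"
    using tensor_bilinear(2)[OF tensor[OF assms(2,1)]] unfolding bilinear_rvs_def by simp
  then show ?thesis
    by (rule tensor_ex1[OF tensor[OF assms] tensor_bilinear(1)[OF tensor[OF assms(2,1)]]])
qed

end

text \<open>The tensor product of linear maps and the braiding are the unique linear maps with the given
  values on pure tensors, which exist by \<open>TenM_ex1\<close> and \<open>Brd_ex1\<close>.\<close>

definition Vect ::
  "'v rvs \<Rightarrow> ('v rvs \<Rightarrow> 'v rvs \<Rightarrow> 'v rvs) \<Rightarrow> ('v rvs \<Rightarrow> 'v rvs \<Rightarrow> 'v \<Rightarrow> 'v \<Rightarrow> 'v)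
     \<Rightarrow> ('v rvs, 'v lin) monoidal_data" where
  "Vect RR VT tn = \<lparr> Ob = {V. is_rvs V},
     Mor = lin_maps,
     Idm = (\<lambda>V. Lin V V (\<lambda>v\<in>carrier V. v)),
     Cmp = (\<lambda>g f. Lin (Src f) (Tgt g) (compose (carrier (Src f)) (App g) (App f))),
     UnitO = RR,
     TenO = VT,
     TenM = (\<lambda>f g. THE h. h \<in> lin_maps (VT (Src f) (Src g)) (VT (Tgt f) (Tgt g)) \<and>
        (\<forall>v\<in>carrier (Src f). \<forall>w\<in>carrier (Src g).
           App h (tn (Src f) (Src g) v w) = tn (Tgt f) (Tgt g) (App f v) (App g w))),
     Brd = (\<lambda>V W. THE h. h \<in> lin_maps (VT V W) (VT W V) \<and>
        (\<forall>v\<in>carrier V. \<forall>w\<in>carrier W. App h (tn V W v w) = tn W V w v)) \<rparr>"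

end

theory Submission
  imports Defs
begin

text \<open>Write \<open>V k\<close> for the image of the object \<open>(k)\<close>. The image of the unit \<open>i\<close> of \<open>(k)\<close> is a finite
sum \<open>\<Sum> a\<^sub>i \<otimes> b\<^sub>i\<close> in \<open>V k \<otimes> V k\<close>, and the image of the counit is a bilinear form \<open>B\<close> on \<open>V k\<close>, which
is symmetric because the unit is. The zigzag relation becomes \<open>v = \<Sum> B(b\<^sub>i, v) a\<^sub>i\<close>
(\<open>dual_expansion\<close>). So the \<open>a\<^sub>i\<close> span \<open>V k\<close>, the form is nondegenerate, and the closed loop of
colour \<open>k\<close>, whose value is \<open>\<Sum> B(a\<^sub>i, b\<^sub>i)\<close>, is the trace of the identity, that is, the dimension
\<open>d k\<close> (\<open>fin_dim_object\<close>).

Suppose that the functor is faithful and \<open>\<Prod> d k powi l k = 1\<close>. The positive and the negative part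
of \<open>l\<close> give two families of loops with equal values, hence equal families of loops in the category.
The defining relations preserve the set of colours that occur in an expression
(\<open>colours_invariant\<close>), and the two parts of \<open>l\<close> have no colour in common. So both are empty.

For the converse, duality turns an arrow \<open>X \<rightarrow> Y\<close> into an effect, an arrow to the unit object
(\<open>bend_inverse\<close>), so it is enough to separate effects. Every effect is a family of loops next to a
tensor product of counits that is precomposed with a permutation of the strands
(\<open>effect_normal\<close>). It is determined by the multiset of the colours of the loops and by the perfect
matching of its endpoints (\<open>loops_mset\<close>, \<open>evs_perm_eq\<close>), because a permutation of strands has only
one expression up to the relations (\<open>perm_unique\<close>). On the pure tensor of vectors \<open>v x\<close>, one for each
endpoint \<open>x\<close>, the effect takes the value \<open>\<Prod> d k * \<Prod> B(v x, v y)\<close>, with one factor for each loop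
and one for each matched pair (\<open>act_normal\<close>).

Independence excludes \<open>d k = 1\<close>, so each \<open>V k\<close> contains orthogonal vectors \<open>e\<^sub>1\<close> and \<open>e\<^sub>2\<close> with
\<open>B(e\<^sub>1, e\<^sub>1) \<noteq> 0 \<noteq> B(e\<^sub>2, e\<^sub>2)\<close>. If one effect matches \<open>x\<close> with \<open>y\<close> and another does not, place \<open>e\<^sub>2\<close> at
\<open>x\<close> and \<open>y\<close> and \<open>e\<^sub>1\<close> at all other endpoints: the value of the first effect is then nonzero and that
of the second is zero (\<open>matching_subset_of_values\<close>). Effects with the same values therefore have the
same matching, hence the same product of loop values, and independence makes the families of loops
equal.\<close>

section \<open>Arrows of the chromatic Brauer category\<close>

text \<open>As elements of a type, classes of expressions turn the defining relations into equations between total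
operations, which the simplifier can use.\<close>

typedef arrow = "{cbr_class f | f X Y. cbr_arr f X Y}"
  by (blast intro: cbr_arr.intros(1))

definition arr :: "cbr_expr \<Rightarrow> arrow" where
  "arr f = Abs_arrow (cbr_class f)"

definition expr_of :: "arrow \<Rightarrow> cbr_expr" where
  "expr_of a = (SOME f. f \<in> Rep_arrow a)"

definition source :: "arrow \<Rightarrow> cbr_obj" where
  "source a = (THE X. \<exists>Y. cbr_arr (expr_of a) X Y)"

definition target :: "arrow \<Rightarrow> cbr_obj" where
  "target a = (THE Y. \<exists>X. cbr_arr (expr_of a) X Y)"

text \<open>Arrows that do not match have an arbitrary composite, since their formal composite is not well-typed.
The laws below therefore compare \<^term>\<open>source\<close> and \<^term>\<open>target\<close> where necessary.\<close>

definition comp_arrow :: "arrow \<Rightarrow> arrow \<Rightarrow> arrow"  (infixr "\<star>" 60) where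
  "g \<star> f = arr (expr_of g \<cdot> expr_of f)"

definition tensor_arrow :: "arrow \<Rightarrow> arrow \<Rightarrow> arrow"  (infixr "\<parallel>" 70) where
  "f \<parallel> g = arr (expr_of f \<boxtimes> expr_of g)"

abbreviation "ident X \<equiv> arr (Ident X)"
abbreviation "braid X Y \<equiv> arr (Braid X Y)"
abbreviation "coev X \<equiv> arr (Coev X)"
abbreviation "ev X \<equiv> arr (Ev X)"

lemma Rep_arr: "cbr_arr f X Y \<Longrightarrow> Rep_arrow (arr f) = cbr_class f"
  unfolding arr_def by (rule Abs_arrow_inverse) blast

lemma arr_eq_iff:
  assumes "cbr_arr f X Y" "cbr_arr g X' Y'"
  shows "arr f = arr g \<longleftrightarrow> f \<approx> g"
proof
  assume "arr f = arr g"
  then have "cbr_class f = cbr_class g"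
    using Rep_arr[OF assms(1)] Rep_arr[OF assms(2)] by simp
  then show "f \<approx> g"
    using cbr_eq.refl[OF assms(2)] unfolding cbr_class_def by blast
qed (simp add: arr_def cbr_class_eq)

lemma arrow_cases:
  obtains "cbr_arr (expr_of a) (source a) (target a)" "arr (expr_of a) = a"
proof -
  obtain f X Y where f: "cbr_arr f X Y" "Rep_arrow a = cbr_class f"
    using Rep_arrow[of a] by blast
  then have "f \<in> Rep_arrow a"
    using cbr_eq.refl[OF f(1)] unfolding cbr_class_def by simp
  then have e: "f \<approx> expr_of a"
    unfolding expr_of_def using f(2) by (metis (no_types, lifting) cbr_class_def mem_Collect_eq someI_ex)
  then have t: "cbr_arr (expr_of a) X Y"
    using f(1) cbr_eq_arr cbr_arr_unique by blast
  then have "source a = X" "target a = Y"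
    unfolding source_def target_def using cbr_arr_unique by blast+
  moreover have "arr (expr_of a) = a"
    unfolding arr_def using f(2) cbr_class_eq[OF e] Rep_arrow_inverse[of a] by simp
  ultimately show ?thesis using t that by simp
qed

lemma expr_of_typed [simp]: "cbr_arr (expr_of a) (source a) (target a)"
  and arr_expr_of [simp]: "arr (expr_of a) = a"
  using arrow_cases[of a] by blast+

lemma expr_of_arr: "cbr_arr f X Y \<Longrightarrow> expr_of (arr f) \<approx> f"
  using arr_eq_iff[OF expr_of_typed] by fastforce

lemma source_target_arr:
  assumes "cbr_arr f X Y" shows "source (arr f) = X" "target (arr f) = Y"
  using cbr_eq_arr[OF expr_of_arr[OF assms]] expr_of_typed[of "arr f"] assms cbr_arr_unique
  by blast+

lemma arr_Compose:
  assumes "cbr_arr f X Y" "cbr_arr g Y Z" shows "arr (g \<cdot> f) = arr g \<star> arr f"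
proof -
  have "expr_of (arr g) \<cdot> expr_of (arr f) \<approx> g \<cdot> f"
    using cbr_eq.comp_cong[OF _ _ expr_of_arr[OF assms(1)] expr_of_arr[OF assms(2)]]
      expr_of_typed[of "arr f"] expr_of_typed[of "arr g"]
    by (simp add: source_target_arr[OF assms(1)] source_target_arr[OF assms(2)])
  then show ?thesis unfolding comp_arrow_def by (simp add: arr_def cbr_class_eq)
qed

lemma arr_Tensor:
  assumes "cbr_arr f X Y" "cbr_arr g X' Y'" shows "arr (f \<boxtimes> g) = arr f \<parallel> arr g"
  using cbr_eq.tensor_cong[OF expr_of_arr[OF assms(1)] expr_of_arr[OF assms(2)]]
  unfolding tensor_arrow_def by (simp add: arr_def cbr_class_eq)

lemma source_target_generators [simp]:
  "source (ident X) = X" "target (ident X) = X"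
  "source (braid X Y) = X @ Y" "target (braid X Y) = Y @ X"
  "source (coev X) = []" "target (coev X) = X @ rev X"
  "source (ev X) = rev X @ X" "target (ev X) = []"
  by (rule source_target_arr, rule cbr_arr.intros)+

lemma source_comp [simp]: "target f = source g \<Longrightarrow> source (g \<star> f) = source f"
  and target_comp [simp]: "target f = source g \<Longrightarrow> target (g \<star> f) = target g"
proof -
  assume "target f = source g"
  then have "cbr_arr (expr_of g \<cdot> expr_of f) (source f) (target g)"
    using expr_of_typed[of f] expr_of_typed[of g] by (simp add: cbr_arr.intros(2))
  then show "source (g \<star> f) = source f" "target (g \<star> f) = target g"
    unfolding comp_arrow_def by (rule source_target_arr)+
qed

lemma source_tensor [simp]: "source (f \<parallel> g) = source f @ source g"
  and target_tensor [simp]: "target (f \<parallel> g) = target f @ target g"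
  unfolding tensor_arrow_def
  by (rule source_target_arr, rule cbr_arr.intros(3), rule expr_of_typed, rule expr_of_typed)+

lemma comp_arrow_assoc [simp]:
  assumes "target f = source g" "target g = source h"
  shows "(h \<star> g) \<star> f = h \<star> g \<star> f"
proof -
  note t = expr_of_typed[of f] expr_of_typed[of g, folded assms(1)] expr_of_typed[of h, folded assms(2)]
  have "arr ((expr_of h \<cdot> expr_of g) \<cdot> expr_of f) = arr (expr_of h \<cdot> (expr_of g \<cdot> expr_of f))"
    using cbr_eq.comp_assoc[OF t] by (simp add: arr_def cbr_class_eq)
  then show ?thesis
    by (simp add: arr_Compose[OF t(1) cbr_arr.intros(2)[OF t(2,3)]] arr_Compose[OF t(2,3)]
        arr_Compose[OF cbr_arr.intros(2)[OF t(1,2)] t(3)] arr_Compose[OF t(1,2)])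
qed

lemma ident_comp [simp]: "target f = X \<Longrightarrow> ident X \<star> f = f"
  using cbr_eq.id_left[OF expr_of_typed[of f]]
    arr_Compose[OF expr_of_typed[of f] cbr_arr.intros(1)]
  by (simp add: arr_def[symmetric] cbr_class_eq) (metis arr_def arr_expr_of cbr_class_eq)

lemma comp_ident [simp]: "source f = X \<Longrightarrow> f \<star> ident X = f"
  using cbr_eq.id_right[OF expr_of_typed[of f]]
    arr_Compose[OF cbr_arr.intros(1) expr_of_typed[of f]]
  by (metis arr_def arr_expr_of cbr_class_eq)

lemma tensor_arrow_assoc [simp]: "(f \<parallel> g) \<parallel> h = f \<parallel> g \<parallel> h"
  using cbr_eq.tensor_assoc[OF expr_of_typed[of f] expr_of_typed[of g] expr_of_typed[of h]]
    arr_Tensor[OF cbr_arr.intros(3)[OF expr_of_typed[of f] expr_of_typed[of g]] expr_of_typed[of h]]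
    arr_Tensor[OF expr_of_typed[of f] cbr_arr.intros(3)[OF expr_of_typed[of g] expr_of_typed[of h]]]
    arr_Tensor[OF expr_of_typed[of f] expr_of_typed[of g]]
    arr_Tensor[OF expr_of_typed[of g] expr_of_typed[of h]]
  by (metis arr_def arr_expr_of cbr_class_eq)

lemma tensor_ident: "ident X \<parallel> ident Y = ident (X @ Y)"
  using cbr_eq.tensor_id[of X Y] arr_Tensor[OF cbr_arr.intros(1)[of X] cbr_arr.intros(1)[of Y]]
  by (metis arr_def cbr_class_eq)

lemma ident_Nil_tensor [simp]: "ident [] \<parallel> f = f"
  using cbr_eq.tensor_unit_left[OF expr_of_typed[of f]]
    arr_Tensor[OF cbr_arr.intros(1)[of "[]"] expr_of_typed[of f]]
  by (metis arr_def arr_expr_of cbr_class_eq)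

lemma tensor_ident_Nil [simp]: "f \<parallel> ident [] = f"
  using cbr_eq.tensor_unit_right[OF expr_of_typed[of f]]
    arr_Tensor[OF expr_of_typed[of f] cbr_arr.intros(1)[of "[]"]]
  by (metis arr_def arr_expr_of cbr_class_eq)

lemma tensor_interchange:
  assumes "target f = source g" "target f' = source g'"
  shows "(g \<parallel> g') \<star> (f \<parallel> f') = (g \<star> f) \<parallel> (g' \<star> f')"
proof -
  note t = expr_of_typed[of f] expr_of_typed[of g, folded assms(1)]
    expr_of_typed[of f'] expr_of_typed[of g', folded assms(2)]
  show ?thesis
    using cbr_eq.interchange[OF t]
      arr_Tensor[OF cbr_arr.intros(2)[OF t(1,2)] cbr_arr.intros(2)[OF t(3,4)]]
      arr_Compose[OF cbr_arr.intros(3)[OF t(1,3)] cbr_arr.intros(3)[OF t(2,4)]]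
      arr_Compose[OF t(1,2)] arr_Compose[OF t(3,4)]
      arr_Tensor[OF t(1,3)] arr_Tensor[OF t(2,4)]
    by (metis arr_def arr_expr_of cbr_class_eq)
qed

text \<open>The defining relations, read as equations between arrows.\<close>

lemma braid_natural_left:
  "source f = X \<Longrightarrow> target f = Y \<Longrightarrow>
    braid Y Z \<star> (f \<parallel> ident Z) = (ident Z \<parallel> f) \<star> braid X Z"
  using cbr_eq.braid_nat_left[OF expr_of_typed[of f], of Z]
    arr_Compose[OF cbr_arr.intros(3)[OF expr_of_typed[of f] cbr_arr.intros(1)[of Z]]
      cbr_arr.intros(4)]
    arr_Compose[OF cbr_arr.intros(4) cbr_arr.intros(3)[OF cbr_arr.intros(1)[of Z] expr_of_typed[of f]]]
    arr_Tensor[OF expr_of_typed[of f] cbr_arr.intros(1)[of Z]]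
    arr_Tensor[OF cbr_arr.intros(1)[of Z] expr_of_typed[of f]]
  by (metis arr_def arr_expr_of cbr_class_eq)

lemma braid_natural_right:
  "source f = X \<Longrightarrow> target f = Y \<Longrightarrow>
    braid Z Y \<star> (ident Z \<parallel> f) = (f \<parallel> ident Z) \<star> braid Z X"
  using cbr_eq.braid_nat_right[OF expr_of_typed[of f], of Z]
    arr_Compose[OF cbr_arr.intros(3)[OF cbr_arr.intros(1)[of Z] expr_of_typed[of f]]
      cbr_arr.intros(4)]
    arr_Compose[OF cbr_arr.intros(4) cbr_arr.intros(3)[OF expr_of_typed[of f] cbr_arr.intros(1)[of Z]]]
    arr_Tensor[OF expr_of_typed[of f] cbr_arr.intros(1)[of Z]]
    arr_Tensor[OF cbr_arr.intros(1)[of Z] expr_of_typed[of f]]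
  by (metis arr_def arr_expr_of cbr_class_eq)

lemma braid_Nil [simp]: "braid X [] = ident X"
  using cbr_eq.braid_unit[of X] by (simp add: arr_def cbr_class_eq)

lemma coev_Nil [simp]: "coev [] = ident []"
  using cbr_eq.coev_unit by (simp add: arr_def cbr_class_eq)

lemma hexagon: "braid X (Y @ Z) = (ident Y \<parallel> braid X Z) \<star> (braid X Y \<parallel> ident Z)"
proof -
  have t: "cbr_arr (Ident Y \<boxtimes> Braid X Z) (Y @ X @ Z) (Y @ Z @ X)"
    "cbr_arr (Braid X Y \<boxtimes> Ident Z) (X @ Y @ Z) (Y @ X @ Z)"
    by (rule cbr_arr_TensorI, rule cbr_arr.intros, rule cbr_arr.intros, simp, simp)+
  show ?thesis
    using cbr_eq.braid_hexagon[of X Y Z] arr_Compose[OF t(2,1)]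
      arr_Tensor[OF cbr_arr.intros(1)[of Y] cbr_arr.intros(4)[of X Z]]
      arr_Tensor[OF cbr_arr.intros(4)[of X Y] cbr_arr.intros(1)[of Z]]
    by (metis arr_def cbr_class_eq)
qed

lemma braid_braid [simp]: "braid Y X \<star> braid X Y = ident (X @ Y)"
  using cbr_eq.braid_symmetry[of Y X] arr_Compose[OF cbr_arr.intros(4)[of X Y] cbr_arr.intros(4)[of Y X]]
  by (metis arr_def cbr_class_eq)

lemma left_zigzag: "(ev X \<parallel> ident (rev X)) \<star> (ident (rev X) \<parallel> coev X) = ident (rev X)"
proof -
  have t: "cbr_arr (Ev X \<boxtimes> Ident (rev X)) (rev X @ X @ rev X) (rev X)"
    "cbr_arr (Ident (rev X) \<boxtimes> Coev X) (rev X) (rev X @ X @ rev X)"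
    by (rule cbr_arr_TensorI, rule cbr_arr.intros, rule cbr_arr.intros, simp, simp)+
  show ?thesis
    using cbr_eq.zigzag_left[of X] arr_Compose[OF t(2,1)]
      arr_Tensor[OF cbr_arr.intros(6)[of X] cbr_arr.intros(1)[of "rev X"]]
      arr_Tensor[OF cbr_arr.intros(1)[of "rev X"] cbr_arr.intros(5)[of X]]
    by (metis arr_def cbr_class_eq)
qed

lemma right_zigzag: "(ident X \<parallel> ev X) \<star> (coev X \<parallel> ident X) = ident X"
proof -
  have t: "cbr_arr (Ident X \<boxtimes> Ev X) (X @ rev X @ X) X"
    "cbr_arr (Coev X \<boxtimes> Ident X) X (X @ rev X @ X)"
    by (rule cbr_arr_TensorI, rule cbr_arr.intros, rule cbr_arr.intros, simp, simp)+
  show ?thesis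
    using cbr_eq.zigzag_right[of X] arr_Compose[OF t(2,1)]
      arr_Tensor[OF cbr_arr.intros(1)[of X] cbr_arr.intros(6)[of X]]
      arr_Tensor[OF cbr_arr.intros(5)[of X] cbr_arr.intros(1)[of X]]
    by (metis arr_def cbr_class_eq)
qed

lemma coev_append:
  "coev (X @ Y) = (ident X \<parallel> coev Y \<parallel> ident (rev X)) \<star> coev X"
proof -
  have t: "cbr_arr (Coev Y \<boxtimes> Ident (rev X)) (rev X) (Y @ rev Y @ rev X)"
    by (rule cbr_arr_TensorI, rule cbr_arr.intros, rule cbr_arr.intros, simp, simp)
  have u: "cbr_arr (Ident X \<boxtimes> Coev Y \<boxtimes> Ident (rev X)) (X @ rev X) (X @ Y @ rev Y @ rev X)"
    by (rule cbr_arr_TensorI[OF cbr_arr.intros(1) t]) simp_all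
  show ?thesis
    using cbr_eq.coev_tensor[of X Y] arr_Compose[OF cbr_arr.intros(5) u]
      arr_Tensor[OF cbr_arr.intros(1)[of X] t]
      arr_Tensor[OF cbr_arr.intros(5)[of Y] cbr_arr.intros(1)[of "rev X"]]
    by (metis arr_def cbr_class_eq)
qed

lemma braid_coev: "braid X (rev X) \<star> coev X = coev (rev X)"
  using cbr_eq.coev_braid[of X] arr_Compose[OF cbr_arr.intros(5)[of X] cbr_arr.intros(4)]
  by (metis arr_def cbr_class_eq)

lemma tensor_ident_tensor [simp]: "ident X \<parallel> ident Y \<parallel> f = ident (X @ Y) \<parallel> f"
  by (metis tensor_arrow_assoc tensor_ident)

declare tensor_ident [simp]

lemma ident_tensor_comp: "target f = source g \<Longrightarrow> ident A \<parallel> (g \<star> f) = (ident A \<parallel> g) \<star> (ident A \<parallel> f)"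
  by (simp add: tensor_interchange)

lemma comp_tensor_ident: "target f = source g \<Longrightarrow> (g \<star> f) \<parallel> ident A = (g \<parallel> ident A) \<star> (f \<parallel> ident A)"
  by (simp add: tensor_interchange)

text \<open>The interchange law with identities as two of the factors: arrows on disjoint strands slide past each
other.\<close>

lemma tensor_eq_comp:
  assumes "source f = A" "target f = A'" "source g = B" "target g = B'"
  shows "(f \<parallel> ident B') \<star> (ident A \<parallel> g) = f \<parallel> g"
    and "(ident A' \<parallel> g) \<star> (f \<parallel> ident B) = f \<parallel> g"
  using assms by (simp_all add: tensor_interchange)

text \<open>By symmetry of the braiding, both sides have the inverse \<^term>\<open>braid Z (X @ Y)\<close>, which the given
hexagon decomposes.\<close>

lemma hexagon_left: "braid (X @ Y) Z = (braid X Z \<parallel> ident Y) \<star> (ident X \<parallel> braid Y Z)"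
proof -
  let ?a = "(braid X Z \<parallel> ident Y) \<star> (ident X \<parallel> braid Y Z)"
  let ?b = "(ident X \<parallel> braid Z Y) \<star> (braid Z X \<parallel> ident Y)"
  have "?a \<star> ?b = (braid X Z \<parallel> ident Y) \<star> ((ident X \<parallel> braid Y Z) \<star> (ident X \<parallel> braid Z Y)) \<star> (braid Z X \<parallel> ident Y)"
    by simp
  also have "\<dots> = ident (Z @ X @ Y)"
    by (simp add: tensor_interchange)
  finally have ab: "?a \<star> ?b = ident (Z @ X @ Y)" .
  have "braid (X @ Y) Z = (?a \<star> ?b) \<star> braid (X @ Y) Z"
    unfolding ab by simp
  also have "\<dots> = ?a \<star> (braid Z (X @ Y) \<star> braid (X @ Y) Z)"
    unfolding hexagon[of Z X Y] by simp
  also have "\<dots> = ?a"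
    unfolding braid_braid by simp
  finally show ?thesis .
qed

lemma braid_Nil_left [simp]: "braid [] X = ident X"
proof -
  have "braid [] X = braid [] X \<star> braid X []" by simp
  also have "\<dots> = ident X" unfolding braid_braid by simp
  finally show ?thesis .
qed

section \<open>Coherence for permutations of named points\<close>

text \<open>A point is an endpoint of a strand: its colour together with a number that tells it apart from other
points of the same colour. Objects only record the colours (\<open>lab\<close>), and the permutation that underlies
an expression in braidings could not be recovered from its source and target alone.\<close>

type_synonym point = "nat \<times> nat"

abbreviation lab :: "point list \<Rightarrow> cbr_obj" where "lab \<equiv> map fst"

inductive perm :: "arrow \<Rightarrow> point list \<Rightarrow> point list \<Rightarrow> bool" where
  perm_ident: "X = lab xs \<Longrightarrow> perm (ident X) xs xs"
| perm_comp: "perm f xs ys \<Longrightarrow> perm g ys zs \<Longrightarrow> perm (g \<star> f) xs zs"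
| perm_tensor: "perm f xs ys \<Longrightarrow> perm g us vs \<Longrightarrow> ps = xs @ us \<Longrightarrow> qs = ys @ vs \<Longrightarrow> perm (f \<parallel> g) ps qs"
| perm_braid: "X = lab xs \<Longrightarrow> Y = lab ys \<Longrightarrow> ps = xs @ ys \<Longrightarrow> qs = ys @ xs \<Longrightarrow> perm (braid X Y) ps qs"

lemma perm_source_target: "perm f xs ys \<Longrightarrow> source f = lab xs \<and> target f = lab ys"
  by (induction rule: perm.induct) auto

lemma perm_source [simp]: "perm f xs ys \<Longrightarrow> source f = lab xs"
  and perm_target [simp]: "perm f xs ys \<Longrightarrow> target f = lab ys"
  using perm_source_target by blast+

lemma perm_mset: "perm f xs ys \<Longrightarrow> mset ys = mset xs"
  by (induction rule: perm.induct) auto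

text \<open>The canonical expression of a permutation is insertion sort: the points after the first one are put
in order, and then the first point crosses those that must precede it.\<close>

inductive canon :: "arrow \<Rightarrow> point list \<Rightarrow> point list \<Rightarrow> bool" where
  canon_Nil: "canon (ident []) [] []"
| canon_Cons: "canon f xs (A @ B) \<Longrightarrow>
    canon ((braid [fst x] (lab A) \<parallel> ident (lab B)) \<star> (ident [fst x] \<parallel> f)) (x # xs) (A @ x # B)"

lemma canon_source_target: "canon f xs ys \<Longrightarrow> source f = lab xs \<and> target f = lab ys"
  by (induction rule: canon.induct) auto

lemma canon_source [simp]: "canon f xs ys \<Longrightarrow> source f = lab xs"
  and canon_target [simp]: "canon f xs ys \<Longrightarrow> target f = lab ys"
  using canon_source_target by blast+

text \<open>Only the position at which the first point is inserted could vary, and in a list without repetitions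
it is determined.\<close>

lemma canon_unique:
  "canon f xs ys \<Longrightarrow> canon g xs ys \<Longrightarrow> distinct ys \<Longrightarrow> f = g"
proof (induction arbitrary: g rule: canon.induct)
  case canon_Nil
  then show ?case by (auto elim: canon.cases)
next
  case (canon_Cons f xs A B x)
  from canon_Cons.prems(1) obtain f' A' B' where
    g: "g = (braid [fst x] (lab A') \<parallel> ident (lab B')) \<star> (ident [fst x] \<parallel> f')"
       "canon f' xs (A' @ B')" "A @ x # B = A' @ x # B'"
    by (auto elim: canon.cases)
  have "A' = A \<and> B' = B"
    using g(3) canon_Cons.prems(2) by (auto simp: append_eq_append_conv2 Cons_eq_append_conv append_eq_Cons_conv)
  then show ?case using g canon_Cons by auto
qed

lemma canon_ident: "canon (ident (lab xs)) xs xs"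
proof (induction xs)
  case (Cons x xs)
  then show ?case using canon_Cons[of "ident (lab xs)" xs "[]" xs x] by simp
qed (simp add: canon_Nil)

text \<open>A transposition of neighbours is absorbed by a canonical expression. If it does not move the point
that was inserted last, naturality of the braiding pushes it back to the expression for the other
points. Otherwise it prolongs the path of this point by one crossing, by the hexagon, or cancels the
last crossing, by symmetry.\<close>

lemma canon_swap:
  "canon f xs ys \<Longrightarrow> ys = U @ y # z # V \<Longrightarrow>
    canon ((ident (lab U) \<parallel> braid [fst y] [fst z] \<parallel> ident (lab V)) \<star> f) xs (U @ z # y # V)"
proof (induction arbitrary: U y z V rule: canon.induct)
  case (canon_Cons f xs A B x)
  note f = canon_source[OF canon_Cons.hyps(1)] canon_target[OF canon_Cons.hyps(1)]
  let ?T = "ident (lab U) \<parallel> braid [fst y] [fst z] \<parallel> ident (lab V)"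
  let ?b = "braid [fst x] (lab A) \<parallel> ident (lab B)"
  let ?g = "ident [fst x] \<parallel> f"
  consider C where "A = U @ y # z # C" "V = C @ x # B" | "A = U @ [y]" "x = z" "B = V"
    | "x = y" "A = U" "B = z # V" | C where "U = A @ x # C" "B = C @ y # z # V"
    using canon_Cons.prems by (auto simp: append_eq_append_conv2 append_eq_Cons_conv Cons_eq_append_conv)
  then show ?case
  proof cases
    case 1
    let ?s = "ident (lab U) \<parallel> braid [fst y] [fst z] \<parallel> ident (lab C)"
    let ?A' = "U @ z # y # C"
    have "?T \<star> ?b \<star> ?g = ((?s \<parallel> ident [fst x]) \<parallel> ident (lab B)) \<star> ?b \<star> ?g"
      using 1 by simp
    also have "\<dots> = (((?s \<parallel> ident [fst x]) \<star> braid [fst x] (lab A)) \<parallel> ident (lab B)) \<star> ?g"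
      using 1 f by (subst comp_tensor_ident) simp_all
    also have "(?s \<parallel> ident [fst x]) \<star> braid [fst x] (lab A) = braid [fst x] (lab ?A') \<star> (ident [fst x] \<parallel> ?s)"
      using 1 by (subst braid_natural_right[symmetric, where Y = "lab ?A'"]) simp_all
    also have "((braid [fst x] (lab ?A') \<star> (ident [fst x] \<parallel> ?s)) \<parallel> ident (lab B)) \<star> ?g
       = (braid [fst x] (lab ?A') \<parallel> ident (lab B)) \<star> (ident [fst x] \<parallel> ((?s \<parallel> ident (lab B)) \<star> f))"
      using 1 f by (subst comp_tensor_ident) (simp_all add: ident_tensor_comp)
    finally show ?thesis
      using canon.canon_Cons[of "(?s \<parallel> ident (lab B)) \<star> f" xs "?A'" B x]
        canon_Cons.IH[of U y z "C @ B"] 1 f by simp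
  next
    case 2
    have "?T \<star> ?b \<star> ?g = ?T \<star> (ident (lab U) \<parallel> braid [fst z] [fst y] \<parallel> ident (lab V))
        \<star> (braid [fst z] (lab U) \<parallel> ident (fst y # lab V)) \<star> ?g"
      using 2 f by (simp add: hexagon[of "[fst z]" "lab U" "[fst y]"] comp_tensor_ident)
    also have "\<dots> = (?T \<star> (ident (lab U) \<parallel> braid [fst z] [fst y] \<parallel> ident (lab V)))
        \<star> (braid [fst z] (lab U) \<parallel> ident (fst y # lab V)) \<star> ?g"
      using 2 f by simp
    also have "?T \<star> (ident (lab U) \<parallel> braid [fst z] [fst y] \<parallel> ident (lab V)) = ident (lab U @ fst z # fst y # lab V)"
      by (simp add: tensor_interchange)
    finally show ?thesis
      using canon.canon_Cons[of f xs U "y # V" x] canon_Cons.hyps 2 f by simp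
  next
    case 3
    have "?T \<star> ?b = (braid [fst y] (lab (U @ [z])) \<parallel> ident (lab V))"
      using 3 by (simp add: hexagon[of "[fst y]" "lab U" "[fst z]"] comp_tensor_ident)
    then have "?T \<star> ?b \<star> ?g = (braid [fst y] (lab (U @ [z])) \<parallel> ident (lab V)) \<star> ?g"
      using 3 f by (subst comp_arrow_assoc[symmetric]) simp_all
    then show ?thesis
      using canon.canon_Cons[of f xs "U @ [z]" V x] canon_Cons.hyps 3 f by simp
  next
    case 4
    let ?s = "ident (lab C) \<parallel> braid [fst y] [fst z] \<parallel> ident (lab V)"
    let ?B' = "C @ z # y # V"
    have "?T \<star> ?b \<star> ?g = ((ident (lab A @ [fst x]) \<parallel> ?s) \<star> ?b) \<star> ?g"
      using 4 f by simp
    also have "(ident (lab A @ [fst x]) \<parallel> ?s) \<star> ?b = braid [fst x] (lab A) \<parallel> ?s"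
      using 4 by (intro tensor_eq_comp) simp_all
    also have "\<dots> = (braid [fst x] (lab A) \<parallel> ident (lab ?B')) \<star> (ident ([fst x] @ lab A) \<parallel> ?s)"
      using 4 by (intro tensor_eq_comp(1)[symmetric]) simp_all
    also have "\<dots> \<star> ?g = (braid [fst x] (lab A) \<parallel> ident (lab ?B')) \<star> (ident [fst x] \<parallel> ((ident (lab A) \<parallel> ?s) \<star> f))"
      using 4 f by (simp add: ident_tensor_comp)
    finally show ?thesis
      using canon.canon_Cons[of "(ident (lab A) \<parallel> ?s) \<star> f" xs A ?B' x]
        canon_Cons.IH[of "A @ C" y z V] 4 f by simp
  qed
qed simp

text \<open>The hexagons cut an arbitrary braiding into transpositions of neighbours, first in the second and then
in the first argument.\<close>

lemma canon_braid_single: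
  "canon f xs (U @ y # Z @ V) \<Longrightarrow>
    canon ((ident (lab U) \<parallel> braid [fst y] (lab Z) \<parallel> ident (lab V)) \<star> f) xs (U @ Z @ y # V)"
proof (induction Z arbitrary: U f)
  case Nil
  then show ?case by simp
next
  case (Cons z Z)
  let ?f = "(ident (lab U) \<parallel> braid [fst y] [fst z] \<parallel> ident (lab (Z @ V))) \<star> f"
  have "canon ?f xs (U @ z # y # Z @ V)"
    using canon_swap[OF Cons.prems[simplified] HOL.refl] by simp
  then have "canon ((ident (lab (U @ [z])) \<parallel> braid [fst y] (lab Z) \<parallel> ident (lab V)) \<star> ?f) xs (U @ z # Z @ y # V)"
    using Cons.IH[of ?f "U @ [z]"] by simp
  moreover have "(ident (lab (U @ [z])) \<parallel> braid [fst y] (lab Z) \<parallel> ident (lab V)) \<star> ?f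
      = (ident (lab U) \<parallel> braid [fst y] (lab (z # Z)) \<parallel> ident (lab V)) \<star> f"
    using canon_target[OF Cons.prems] hexagon[of "[fst y]" "[fst z]" "lab Z"]
    by (simp add: ident_tensor_comp comp_tensor_ident)
  ultimately show ?case by simp
qed

lemma canon_braid:
  "canon f xs (U @ Y @ Z @ V) \<Longrightarrow>
    canon ((ident (lab U) \<parallel> braid (lab Y) (lab Z) \<parallel> ident (lab V)) \<star> f) xs (U @ Z @ Y @ V)"
proof (induction Y arbitrary: U f)
  case Nil
  then show ?case by simp
next
  case (Cons y Y)
  let ?f = "(ident (lab (U @ [y])) \<parallel> braid (lab Y) (lab Z) \<parallel> ident (lab V)) \<star> f"
  have "canon ?f xs ((U @ [y]) @ Z @ Y @ V)"
    using Cons.prems by (intro Cons.IH) simp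
  then have "canon ?f xs (U @ y # Z @ Y @ V)" by simp
  from canon_braid_single[OF this]
  have "canon ((ident (lab U) \<parallel> braid [fst y] (lab Z) \<parallel> ident (lab (Y @ V))) \<star> ?f) xs (U @ Z @ (y # Y) @ V)"
    by simp
  moreover have "(ident (lab U) \<parallel> braid [fst y] (lab Z) \<parallel> ident (lab (Y @ V))) \<star> ?f
      = (ident (lab U) \<parallel> braid (lab (y # Y)) (lab Z) \<parallel> ident (lab V)) \<star> f"
    using canon_target[OF Cons.prems] hexagon_left[of "[fst y]" "lab Y" "lab Z"]
    by (simp add: ident_tensor_comp comp_tensor_ident)
  ultimately show ?case by simp
qed

text \<open>The claim allows for strands on both sides, since this is what the induction needs for tensor products.\<close>

lemma canon_perm:
  "perm g ys zs \<Longrightarrow> canon f xs (U @ ys @ V) \<Longrightarrow>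
    canon ((ident (lab U) \<parallel> g \<parallel> ident (lab V)) \<star> f) xs (U @ zs @ V)"
proof (induction arbitrary: U V f rule: perm.induct)
  case (perm_ident X ys)
  then show ?case by simp
next
  case (perm_comp g ws ys h zs)
  from perm_comp.IH(2)[OF perm_comp.IH(1)[OF perm_comp.prems]]
  show ?case
    using perm_source_target[OF perm_comp.hyps(1)] perm_source_target[OF perm_comp.hyps(2)]
      canon_target[OF perm_comp.prems]
    by (simp add: ident_tensor_comp comp_tensor_ident)
next
  case (perm_tensor g ys zs h us vs)
  have "canon f xs (U @ ys @ us @ V)"
    using perm_tensor by simp
  from perm_tensor.IH(1)[OF this]
  have "canon ((ident (lab U) \<parallel> g \<parallel> ident (lab (us @ V))) \<star> f) xs ((U @ zs) @ us @ V)"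
    by simp
  from perm_tensor.IH(2)[OF this]
  have *: "canon ((ident (lab (U @ zs)) \<parallel> h \<parallel> ident (lab V)) \<star> (ident (lab U) \<parallel> g \<parallel> ident (lab (us @ V))) \<star> f)
      xs (U @ (zs @ vs) @ V)"
    by simp
  have t: "source g = lab ys" "target g = lab zs" "source h = lab us" "target h = lab vs"
    using perm_tensor.hyps by simp_all
  have "(ident (lab (U @ zs)) \<parallel> h \<parallel> ident (lab V)) \<star> (ident (lab U) \<parallel> g \<parallel> ident (lab (us @ V))) \<star> f
    = ((ident (lab U) \<parallel> (ident (lab zs) \<parallel> h \<parallel> ident (lab V))) \<star> (ident (lab U) \<parallel> (g \<parallel> ident (lab (us @ V))))) \<star> f"
    using t canon_target[OF \<open>canon f xs (U @ ys @ us @ V)\<close>] by simp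
  also have "\<dots> = (ident (lab U) \<parallel> ((ident (lab zs) \<parallel> (h \<parallel> ident (lab V))) \<star> (g \<parallel> ident (lab (us @ V))))) \<star> f"
    using t by (subst ident_tensor_comp) simp_all
  also have "(ident (lab zs) \<parallel> (h \<parallel> ident (lab V))) \<star> (g \<parallel> ident (lab (us @ V))) = g \<parallel> (h \<parallel> ident (lab V))"
    using t by (intro tensor_eq_comp) simp_all
  finally show ?case using * perm_tensor.hyps by simp
next
  case (perm_braid X ys Y zs)
  then show ?case using canon_braid[of f xs U ys zs V] by simp
qed

text \<open>Coherence for symmetric monoidal categories: composing an expression with the canonical expression of
the identity yields the canonical expression of its permutation.\<close>

theorem perm_unique:
  assumes "perm f xs ys" "perm g xs ys" "distinct xs"
  shows "f = g"
proof -
  have "canon f xs ys" if "perm f xs ys" for f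
    using canon_perm[OF that, of "ident (lab xs)" xs "[]" "[]"] canon_ident[of xs] that
    by (simp add: perm_source_target)
  moreover have "distinct ys"
    using perm_mset[OF assms(1)] assms(3) by (metis distinct_count_atmost_1 mset_eq_setD)
  ultimately show ?thesis using canon_unique assms by blast
qed

lemma perm_move:
  "perm (braid [fst x] (lab A) \<parallel> ident (lab B)) (x # A @ B) (A @ x # B)"
  by (rule perm_tensor[OF perm_braid[of "[fst x]" "[x]" "lab A" A] perm_ident[of "lab B" B]]) simp_all

lemma perm_exists: "mset xs = mset ys \<Longrightarrow> \<exists>f. perm f xs ys"
proof (induction xs arbitrary: ys)
  case Nil
  then show ?case using perm_ident by fastforce
next
  case (Cons x xs)
  have "x \<in> set ys" using Cons.prems by (metis list.set_intros(1) mset_eq_setD)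
  then obtain A B where ys: "ys = A @ x # B" by (meson split_list)
  then obtain f where "perm f xs (A @ B)" using Cons.IH[of "A @ B"] Cons.prems by auto
  then have "perm (ident [fst x] \<parallel> f) (x # xs) (x # A @ B)"
    using perm_tensor[OF perm_ident[of "[fst x]" "[x]"]] by simp
  then show ?case unfolding ys using perm_comp perm_move by blast
qed

section \<open>Counits\<close>

text \<open>A counit is determined by the unit: one zigzag relation inserts \<open>e\<close> on a strand that leads to
\<^term>\<open>ev X\<close>, and after sliding the two past each other the other relation removes \<^term>\<open>ev X\<close>. No
relations are imposed on the counits of tensor products or on their symmetry; with this lemma they
follow from those of the units.\<close>

lemma ev_unique:
  assumes "source e = rev X @ X" "target e = []"
    and "(ident X \<parallel> e) \<star> (coev X \<parallel> ident X) = ident X"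
  shows "e = ev X"
proof -
  have "ev X = ev X \<star> (ident (rev X) \<parallel> ((ident X \<parallel> e) \<star> (coev X \<parallel> ident X)))"
    unfolding assms(3) using assms(1,2) by simp
  also have "\<dots> = (ev X \<star> (ident (rev X @ X) \<parallel> e)) \<star> (ident (rev X) \<parallel> coev X \<parallel> ident X)"
    using assms(1,2) by (simp add: ident_tensor_comp)
  also have "ev X \<star> (ident (rev X @ X) \<parallel> e) = ev X \<parallel> e"
    using tensor_eq_comp(1)[of "ev X" "rev X @ X" "[]" e "rev X @ X" "[]"] assms(1,2) by simp
  also have "\<dots> = e \<star> ((ev X \<parallel> ident (rev X)) \<parallel> ident X)"
    using tensor_eq_comp(2)[of "ev X" "rev X @ X" "[]" e "rev X @ X" "[]"] assms(1,2) by simp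
  also have "\<dots> \<star> (ident (rev X) \<parallel> coev X \<parallel> ident X)
      = e \<star> (((ev X \<parallel> ident (rev X)) \<star> (ident (rev X) \<parallel> coev X)) \<parallel> ident X)"
    using assms(1) by (simp add: comp_tensor_ident)
  also have "\<dots> = e"
    unfolding left_zigzag using assms(1) by simp
  finally show ?thesis by simp
qed

lemma ev_Nil [simp]: "ev [] = ident []"
  by (rule ev_unique[symmetric]) simp_all

lemma ev_append: "ev (X @ Y) = ev Y \<star> (ident (rev Y) \<parallel> ev X \<parallel> ident Y)"
proof (rule ev_unique[symmetric])
  let ?e = "ev Y \<star> (ident (rev Y) \<parallel> ev X \<parallel> ident Y)"
  have 1: "(ident (X @ Y @ rev Y) \<parallel> ev X \<parallel> ident Y) \<star> (ident X \<parallel> coev Y \<parallel> ident (rev X @ X @ Y))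
      = (ident X \<parallel> coev Y \<parallel> ident Y) \<star> (ident X \<parallel> ev X \<parallel> ident Y)"
  proof -
    have "(ident (Y @ rev Y) \<parallel> (ev X \<parallel> ident Y)) \<star> (coev Y \<parallel> ident (rev X @ X @ Y)) = coev Y \<parallel> (ev X \<parallel> ident Y)"
      by (rule tensor_eq_comp) simp_all
    also have "\<dots> = (coev Y \<parallel> ident Y) \<star> (ident [] \<parallel> (ev X \<parallel> ident Y))"
      by (rule tensor_eq_comp(1)[symmetric]) simp_all
    finally have "ident X \<parallel> ((ident (Y @ rev Y) \<parallel> (ev X \<parallel> ident Y)) \<star> (coev Y \<parallel> ident (rev X @ X @ Y)))
       = ident X \<parallel> ((coev Y \<parallel> ident Y) \<star> (ev X \<parallel> ident Y))" by simp
    then show ?thesis by (simp add: ident_tensor_comp)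
  qed
  have "(ident (X @ Y) \<parallel> ?e) \<star> (coev (X @ Y) \<parallel> ident (X @ Y))
     = (ident (X @ Y) \<parallel> ev Y) \<star> ((ident (X @ Y @ rev Y) \<parallel> ev X \<parallel> ident Y) \<star> (ident X \<parallel> coev Y \<parallel> ident (rev X @ X @ Y)))
        \<star> (coev X \<parallel> ident (X @ Y))"
    by (simp add: coev_append ident_tensor_comp comp_tensor_ident)
  also have "\<dots> = ((ident (X @ Y) \<parallel> ev Y) \<star> (ident X \<parallel> coev Y \<parallel> ident Y)) \<star> ((ident X \<parallel> ev X \<parallel> ident Y)
        \<star> (coev X \<parallel> ident (X @ Y)))"
    unfolding 1 by simp
  also have "(ident (X @ Y) \<parallel> ev Y) \<star> (ident X \<parallel> coev Y \<parallel> ident Y) = ident X \<parallel> ((ident Y \<parallel> ev Y) \<star> (coev Y \<parallel> ident Y))"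
    by (simp add: ident_tensor_comp)
  also have "(ident X \<parallel> ev X \<parallel> ident Y) \<star> (coev X \<parallel> ident (X @ Y)) = ((ident X \<parallel> ev X) \<star> (coev X \<parallel> ident X)) \<parallel> ident Y"
    by (simp add: comp_tensor_ident)
  finally show "(ident (X @ Y) \<parallel> ?e) \<star> (coev (X @ Y) \<parallel> ident (X @ Y)) = ident (X @ Y)"
    by (simp add: right_zigzag)
qed simp_all

lemma ev_braid: "ev [k] \<star> braid [k] [k] = ev [k]"
proof (rule ev_unique)
  let ?c = "coev [k]" and ?b = "braid [k] [k]" and ?i = "ident [k]"
  have "(?b \<parallel> ?i) \<star> (?b \<parallel> ?i) = ident [k, k, k]"
    by (simp add: tensor_interchange)
  \<comment> \<open>A strand that crosses both ends of a cup, or of a cap, can be pulled off it; undoing one of the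
    two crossings leaves the next two equations.\<close>
  have 1: "(?i \<parallel> ?b) \<star> (?c \<parallel> ?i) = (?b \<parallel> ?i) \<star> (?i \<parallel> ?c)"
  proof -
    have "(?b \<parallel> ?i) \<star> (?i \<parallel> ?b) \<star> (?c \<parallel> ?i) = ?i \<parallel> ?c"
      using braid_natural_left[of ?c "[]" "[k, k]" "[k]"] hexagon_left[of "[k]" "[k]" "[k]"] by simp
    then have "(?b \<parallel> ?i) \<star> ((?b \<parallel> ?i) \<star> (?i \<parallel> ?b) \<star> (?c \<parallel> ?i)) = (?b \<parallel> ?i) \<star> (?i \<parallel> ?c)" by simp
    moreover have "(?b \<parallel> ?i) \<star> ((?b \<parallel> ?i) \<star> (?i \<parallel> ?b) \<star> (?c \<parallel> ?i))
        = ((?b \<parallel> ?i) \<star> (?b \<parallel> ?i)) \<star> (?i \<parallel> ?b) \<star> (?c \<parallel> ?i)" by simp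
    ultimately show ?thesis using \<open>(?b \<parallel> ?i) \<star> (?b \<parallel> ?i) = ident [k, k, k]\<close> by simp
  qed
  have 2: "(?i \<parallel> ev [k]) \<star> (?b \<parallel> ?i) = (ev [k] \<parallel> ?i) \<star> (?i \<parallel> ?b)"
  proof -
    have "?i \<parallel> ev [k] = (ev [k] \<parallel> ?i) \<star> (?i \<parallel> ?b) \<star> (?b \<parallel> ?i)"
      using braid_natural_right[of "ev [k]" "[k, k]" "[]" "[k]"] hexagon[of "[k]" "[k]" "[k]"] by simp
    then have "(?i \<parallel> ev [k]) \<star> (?b \<parallel> ?i) = ((ev [k] \<parallel> ?i) \<star> (?i \<parallel> ?b)) \<star> ((?b \<parallel> ?i) \<star> (?b \<parallel> ?i))"
      by simp
    then show ?thesis unfolding \<open>(?b \<parallel> ?i) \<star> (?b \<parallel> ?i) = ident [k, k, k]\<close> by simp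
  qed
  have "(?i \<parallel> (ev [k] \<star> ?b)) \<star> (?c \<parallel> ?i) = (?i \<parallel> ev [k]) \<star> (?i \<parallel> ?b) \<star> (?c \<parallel> ?i)"
    by (simp add: ident_tensor_comp)
  also have "\<dots> = ((?i \<parallel> ev [k]) \<star> (?b \<parallel> ?i)) \<star> (?i \<parallel> ?c)"
    unfolding 1 by simp
  also have "\<dots> = (ev [k] \<parallel> ?i) \<star> (?i \<parallel> (?b \<star> ?c))"
    unfolding 2 by (simp add: ident_tensor_comp)
  also have "?b \<star> ?c = ?c"
    using braid_coev[of "[k]"] by simp
  finally show "(?i \<parallel> (ev [k] \<star> ?b)) \<star> (?c \<parallel> ?i) = ?i"
    using left_zigzag[of "[k]"] by simp
qed simp_all

section \<open>Normal forms of effects\<close>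

fun flat :: "('a \<times> 'a) list \<Rightarrow> 'a list" where
  "flat [] = []"
| "flat ((x, y) # ps) = x # y # flat ps"

fun evs :: "(point \<times> point) list \<Rightarrow> arrow" where
  "evs [] = ident []"
| "evs ((x, y) # ps) = ev [fst x] \<parallel> evs ps"

text \<open>Only points of equal colour can be joined by a counit.\<close>

definition well_coloured :: "(point \<times> point) list \<Rightarrow> bool" where
  "well_coloured ps \<longleftrightarrow> (\<forall>(x, y)\<in>set ps. fst x = fst y)"

lemma well_coloured_simps [simp]:
  "well_coloured []"
  "well_coloured ((x, y) # ps) \<longleftrightarrow> fst x = fst y \<and> well_coloured ps"
  by (auto simp: well_coloured_def)

lemma evs_target [simp]: "target (evs ps) = []"
  and evs_source [simp]: "well_coloured ps \<Longrightarrow> source (evs ps) = lab (flat ps)"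
  by (induction ps rule: evs.induct) auto

fun loops :: "nat list \<Rightarrow> arrow" where
  "loops [] = ident []"
| "loops (k # ks) = (ev [k] \<star> coev [k]) \<parallel> loops ks"

lemma loops_source_target [simp]: "source (loops ks) = []" "target (loops ks) = []"
  by (induction ks) auto

definition matching :: "('a \<times> 'a) list \<Rightarrow> 'a set set" where
  "matching ps = (\<lambda>(x, y). {x, y}) ` set ps"

lemma matching_simps [simp]:
  "matching [] = {}"
  "matching ((x, y) # ps) = insert {x, y} (matching ps)"
  by (simp_all add: matching_def)

text \<open>Counits are effects, so by naturality two of them may change places together with their endpoints.\<close>

lemma ev_tensor_ev: "(ev [b] \<parallel> ev [a]) \<star> braid [a, a] [b, b] = ev [a] \<parallel> ev [b]"
proof -
  have "(ev [b] \<parallel> ev [a]) \<star> braid [a, a] [b, b]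
      = (ev [b] \<star> (ident [b, b] \<parallel> ev [a])) \<star> braid [a, a] [b, b]"
    using tensor_eq_comp(1)[of "ev [b]" "[b, b]" "[]" "ev [a]" "[a, a]" "[]"] by simp
  also have "\<dots> = ev [b] \<star> ((ident [b, b] \<parallel> ev [a]) \<star> braid [a, a] [b, b])"
    by simp
  also have "(ident [b, b] \<parallel> ev [a]) \<star> braid [a, a] [b, b] = ev [a] \<parallel> ident [b, b]"
    using braid_natural_left[of "ev [a]" "[a, a]" "[]" "[b, b]"] by simp
  also have "ev [b] \<star> (ev [a] \<parallel> ident [b, b]) = ev [a] \<parallel> ev [b]"
    using tensor_eq_comp(2)[of "ev [a]" "[a, a]" "[]" "ev [b]" "[b, b]" "[]"] by simp
  finally show ?thesis .
qed

text \<open>A tensor product of counits can be rearranged until a given point comes first: exchange neighbouring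
counits, and turn a counit round by its symmetry.\<close>

lemma evs_front:
  "well_coloured ps \<Longrightarrow> x \<in> set (flat ps) \<Longrightarrow>
    \<exists>w qs q. well_coloured ((x, w) # qs) \<and> perm q (flat ps) (x # w # flat qs) \<and>
      evs ps = evs ((x, w) # qs) \<star> q \<and>
      matching ps = matching ((x, w) # qs)"
proof (induction ps rule: flat.induct)
  case (2 a b ps)
  consider "x = a" | "x = b" | "x \<in> set (flat ps)" using 2 by auto
  then show ?case
  proof cases
    case 1
    then show ?thesis
      using 2(2) perm_ident[of _ "a # b # flat ps"]
      by (intro exI[of _ b] exI[of _ ps] exI[of _ "ident (lab (a # b # flat ps))"]) simp
  next
    case 2
    have "perm (braid [fst a] [fst b] \<parallel> ident (lab (flat ps))) (a # b # flat ps) (b # a # flat ps)"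
      by (rule perm_tensor[OF perm_braid[of _ "[a]" _ "[b]"] perm_ident]) auto
    moreover have "evs ((a, b) # ps) = evs ((b, a) # ps) \<star> (braid [fst a] [fst b] \<parallel> ident (lab (flat ps)))"
      using \<open>well_coloured ((a, b) # ps)\<close> by (simp add: tensor_interchange ev_braid)
    ultimately show ?thesis
      using 2 \<open>well_coloured ((a, b) # ps)\<close>
      by (intro exI[of _ a] exI[of _ ps] exI[of _ "braid [fst a] [fst b] \<parallel> ident (lab (flat ps))"]) auto
  next
    case 3
    then obtain w qs q where *: "well_coloured ((x, w) # qs)" "perm q (flat ps) (x # w # flat qs)"
      "evs ps = evs ((x, w) # qs) \<star> q"
      "matching ps = matching ((x, w) # qs)"
      using 2 by auto
    let ?k = "fst a" and ?l = "fst x"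
    let ?b = "braid [?k, ?k] [?l, ?l] \<parallel> ident (lab (flat qs))"
    have ab: "fst b = ?k" using 2(2) by simp
    have xw: "fst w = ?l" using *(1) by simp
    have wq: "well_coloured qs" using *(1) by simp
    have "perm (ident [?k, ?k] \<parallel> q) (a # b # flat ps) (a # b # x # w # flat qs)"
      using ab by (intro perm_tensor[OF perm_ident[of _ "[a, b]"] *(2)]) auto
    moreover have "perm ?b (a # b # x # w # flat qs) (x # w # a # b # flat qs)"
      using ab xw by (intro perm_tensor[OF perm_braid[of _ "[a, b]" _ "[x, w]"] perm_ident[of _ "flat qs"]]) auto
    ultimately have "perm (?b \<star> (ident [?k, ?k] \<parallel> q)) (a # b # flat ps) (x # w # a # b # flat qs)"
      by (rule perm_comp)
    moreover have "evs ((a, b) # ps) = evs ((x, w) # (a, b) # qs) \<star> (?b \<star> (ident [?k, ?k] \<parallel> q))"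
    proof -
      have "evs ((a, b) # ps) = (ev [?k] \<parallel> (ev [?l] \<parallel> evs qs)) \<star> (ident [?k, ?k] \<parallel> q)"
        using *(2) ab xw wq by (simp add: *(3) tensor_interchange)
      also have "ev [?k] \<parallel> (ev [?l] \<parallel> evs qs) = ((ev [?l] \<parallel> ev [?k]) \<star> braid [?k, ?k] [?l, ?l]) \<parallel> evs qs"
        by (simp add: ev_tensor_ev)
      also have "\<dots> = ((ev [?l] \<parallel> ev [?k]) \<parallel> evs qs) \<star> ?b"
        using wq by (subst tensor_interchange) simp_all
      finally show ?thesis
        using *(2) ab xw wq by simp
    qed
    ultimately show ?thesis
      using *(1,4) ab xw
      by (intro exI[of _ w] exI[of _ "(a, b) # qs"] exI[of _ "?b \<star> (ident [?k, ?k] \<parallel> q)"]) auto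
  qed
qed simp

text \<open>An effect is an arrow to the unit object. The points in \<open>xs\<close> name the endpoints of its source.\<close>

definition normal_effect :: "arrow \<Rightarrow> point list \<Rightarrow> bool" where
  "normal_effect h xs \<longleftrightarrow> (\<exists>ks ps p. well_coloured ps \<and> perm p xs (flat ps) \<and> h = loops ks \<parallel> (evs ps \<star> p))"

lemma scalar_tensor_comp:
  assumes "source s = []" "target s = []" "source g = target f"
  shows "(s \<parallel> g) \<star> f = s \<parallel> (g \<star> f)"
  using assms tensor_interchange[of "ident []" s f g] by simp

lemma normal_perm:
  assumes "normal_effect h ys" "perm q xs ys" shows "normal_effect (h \<star> q) xs"
proof -
  obtain ks ps p where h: "well_coloured ps" "perm p ys (flat ps)" "h = loops ks \<parallel> (evs ps \<star> p)"
    using assms(1) unfolding normal_effect_def by blast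
  then have "h \<star> q = loops ks \<parallel> (evs ps \<star> (p \<star> q))"
    using assms(2) by (simp add: scalar_tensor_comp)
  then show ?thesis
    unfolding normal_effect_def using h perm_comp[OF assms(2) h(2)] by blast
qed

lemma normal_ev:
  assumes "normal_effect h (A @ B)" "fst x = k" "fst y = k"
  shows "normal_effect (h \<star> (ident (lab A) \<parallel> ev [k] \<parallel> ident (lab B))) (A @ x # y # B)"
proof -
  obtain ks ps p where h: "well_coloured ps" "perm p (A @ B) (flat ps)" "h = loops ks \<parallel> (evs ps \<star> p)"
    using assms(1) unfolding normal_effect_def by blast
  let ?b = "braid (lab A) [k, k] \<parallel> ident (lab B)"
  have "perm ?b (A @ x # y # B) (x # y # A @ B)"
    using assms by (intro perm_tensor[OF perm_braid[of _ A _ "[x, y]"] perm_ident[of _ B]]) auto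
  moreover have "perm (ident [k, k] \<parallel> p) (x # y # A @ B) (x # y # flat ps)"
    using assms by (intro perm_tensor[OF perm_ident[of _ "[x, y]"] h(2)]) auto
  ultimately have "perm ((ident [k, k] \<parallel> p) \<star> ?b) (A @ x # y # B) (flat ((x, y) # ps))"
    using perm_comp by fastforce
  moreover have "h \<star> (ident (lab A) \<parallel> ev [k] \<parallel> ident (lab B)) = loops ks \<parallel> (evs ((x, y) # ps) \<star> ((ident [k, k] \<parallel> p) \<star> ?b))"
  proof -
    have "evs ((x, y) # ps) \<star> ((ident [k, k] \<parallel> p) \<star> ?b) = ((ev [k] \<parallel> evs ps) \<star> (ident [k, k] \<parallel> p)) \<star> ?b"
      using h assms by simp
    also have "(ev [k] \<parallel> evs ps) \<star> (ident [k, k] \<parallel> p) = ev [k] \<parallel> (evs ps \<star> p)"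
      using h by (simp add: tensor_interchange)
    also have "\<dots> = (evs ps \<star> p) \<star> (ev [k] \<parallel> ident (lab (A @ B)))"
      using h tensor_eq_comp(2)[of "ev [k]" "[k, k]" "[]" "evs ps \<star> p" "lab (A @ B)" "[]"] by simp
    also have "\<dots> \<star> ?b = (evs ps \<star> p) \<star> ((ev [k] \<parallel> ident (lab A)) \<parallel> ident (lab B)) \<star> ?b"
      using h by simp
    also have "((ev [k] \<parallel> ident (lab A)) \<parallel> ident (lab B)) \<star> ?b = ((ev [k] \<parallel> ident (lab A)) \<star> braid (lab A) [k, k]) \<parallel> ident (lab B)"
      by (subst comp_tensor_ident) simp_all
    also have "(ev [k] \<parallel> ident (lab A)) \<star> braid (lab A) [k, k] = ident (lab A) \<parallel> ev [k]"
      using braid_natural_right[of "ev [k]" "[k, k]" "[]" "lab A"] by simp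
    finally show ?thesis using h by (simp add: scalar_tensor_comp)
  qed
  ultimately show ?thesis
    unfolding normal_effect_def using h assms by (intro exI[of _ ks] exI[of _ "(x, y) # ps"] exI) auto
qed

text \<open>Endomorphisms of the unit object commute, because they slide past each other.\<close>

lemma loops_mset: "mset ks = mset ls \<Longrightarrow> loops ks = loops ls"
proof -
  have comm: "f \<parallel> g = g \<parallel> f" if "source f = []" "target f = []" "source g = []" "target g = []" for f g
    using tensor_eq_comp(2)[of f "[]" "[]" g "[]" "[]"] tensor_eq_comp(1)[of g "[]" "[]" f "[]" "[]"] that
    by simp
  have front: "loops (as @ k # bs) = loops (k # as @ bs)" for as k bs
  proof (induction as)
    case (Cons a as)
    then show ?case
      using comm[of "ev [a] \<star> coev [a]" "ev [k] \<star> coev [k]"]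
      by (simp flip: tensor_arrow_assoc)
  qed simp
  show "mset ks = mset ls \<Longrightarrow> loops ks = loops ls"
  proof (induction ks arbitrary: ls)
    case (Cons k ks)
    then have "k \<in> set ls" by (metis list.set_intros(1) mset_eq_setD)
    then obtain as bs where ls: "ls = as @ k # bs" by (meson split_list)
    then show ?case using Cons.IH[of "as @ bs"] Cons.prems by (simp add: front)
  qed simp
qed

lemma normal_loop:
  assumes "normal_effect h xs" shows "normal_effect ((ev [k] \<star> coev [k]) \<parallel> h) xs"
proof -
  obtain ks ps p where h: "well_coloured ps" "perm p xs (flat ps)" "h = loops ks \<parallel> (evs ps \<star> p)"
    using assms unfolding normal_effect_def by blast
  then show ?thesis unfolding normal_effect_def by (intro exI[of _ "k # ks"] exI conjI) simp_all
qed

lemma normal_scalar_loops: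
  assumes "normal_effect h xs" shows "normal_effect (loops ks \<parallel> h) xs"
  using assms by (induction ks) (auto simp: normal_loop)

lemma normal_evs: "well_coloured ps \<Longrightarrow> perm p xs (flat ps) \<Longrightarrow> normal_effect (evs ps \<star> p) xs"
  unfolding normal_effect_def by (intro exI[of _ "[]"] exI conjI) simp_all

text \<open>A unit emerges from no strands at all, so by naturality the strands in front of it need not cross it.\<close>

lemma move_coev:
  "(braid (lab A) [k, k] \<parallel> ident (lab B)) \<star> (ident (lab A) \<parallel> coev [k] \<parallel> ident (lab B))
     = coev [k] \<parallel> ident (lab (A @ B))"
proof -
  have "(braid (lab A) [k, k] \<parallel> ident (lab B)) \<star> ((ident (lab A) \<parallel> coev [k]) \<parallel> ident (lab B))
     = (braid (lab A) [k, k] \<star> (ident (lab A) \<parallel> coev [k])) \<parallel> ident (lab B)"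
    by (rule comp_tensor_ident[symmetric]) simp
  also have "braid (lab A) [k, k] \<star> (ident (lab A) \<parallel> coev [k]) = coev [k] \<parallel> ident (lab A)"
    using braid_natural_right[of "coev [k]" "[]" "[k, k]" "lab A"] by simp
  finally show ?thesis by simp
qed

text \<open>A unit whose two ends lead to the same counit closes up to a loop. By coherence the permutation may be
chosen to bring the two ends to the front and to permute the other strands separately.\<close>

lemma normal_coev_loop:
  assumes "well_coloured ps" "perm p (A @ x # y # B) (x # y # flat ps)"
    and "distinct (A @ x # y # B)" "fst x = k" "fst y = k"
  shows "normal_effect ((evs ((x, y) # ps) \<star> p) \<star> (ident (lab A) \<parallel> coev [k] \<parallel> ident (lab B))) (A @ B)"
proof -
  obtain q where q: "perm q (A @ B) (flat ps)"
    using perm_exists[of "A @ B" "flat ps"] perm_mset[OF assms(2)] by auto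
  let ?b = "braid (lab A) [k, k] \<parallel> ident (lab B)"
  let ?c = "ident (lab A) \<parallel> coev [k] \<parallel> ident (lab B)"
  have "perm ?b (A @ x # y # B) (x # y # A @ B)"
    using assms by (intro perm_tensor[OF perm_braid[of _ A _ "[x, y]"] perm_ident[of _ B]]) auto
  moreover have "perm (ident [k, k] \<parallel> q) (x # y # A @ B) (x # y # flat ps)"
    using assms by (intro perm_tensor[OF perm_ident[of _ "[x, y]"] q]) auto
  ultimately have "perm ((ident [k, k] \<parallel> q) \<star> ?b) (A @ x # y # B) (x # y # flat ps)"
    using perm_comp by blast
  then have p: "p = (ident [k, k] \<parallel> q) \<star> ?b"
    using perm_unique assms(2,3) by blast
  have "(evs ((x, y) # ps) \<star> p) \<star> ?c = (ev [k] \<parallel> evs ps) \<star> (ident [k, k] \<parallel> q) \<star> (?b \<star> ?c)"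
    using assms q by (simp add: p)
  also have "?b \<star> ?c = coev [k] \<parallel> ident (lab (A @ B))"
    by (rule move_coev)
  also have "(ev [k] \<parallel> evs ps) \<star> (ident [k, k] \<parallel> q) \<star> (coev [k] \<parallel> ident (lab (A @ B)))
      = (ev [k] \<star> coev [k]) \<parallel> (evs ps \<star> q)"
    using assms q by (simp add: tensor_interchange)
  finally show ?thesis
    using normal_loop[OF normal_evs[OF assms(1) q]] by simp
qed

text \<open>If the two ends \<open>x\<close> and \<open>y\<close> of a unit lead to different counits, the zigzag relation straightens the
strand through these three arcs, so that \<open>w\<close> and \<open>v\<close> become matched. By coherence the permutation may
be chosen to pull \<open>x\<close> and \<open>y\<close> to the front, to permute the other strands, and to move \<open>w\<close> before \<open>x\<close>.\<close>

lemma normal_coev_join: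
  assumes "well_coloured ps" "perm p (A @ x # y # B) (w # x # y # v # flat ps)"
    and "distinct (A @ x # y # B)" "fst x = k" "fst y = k" "fst w = k" "fst v = k"
  shows "normal_effect ((evs ((w, x) # (y, v) # ps) \<star> p) \<star> (ident (lab A) \<parallel> coev [k] \<parallel> ident (lab B))) (A @ B)"
proof -
  obtain q where q: "perm q (A @ B) (w # v # flat ps)"
    using perm_exists[of "A @ B" "w # v # flat ps"] perm_mset[OF assms(2)] by auto
  let ?b = "braid (lab A) [k, k] \<parallel> ident (lab B)"
  let ?c = "ident (lab A) \<parallel> coev [k] \<parallel> ident (lab B)"
  let ?R = "lab (flat ps)"
  let ?d = "braid [k, k] [k] \<parallel> ident (k # ?R)"
  have b: "perm ?b (A @ x # y # B) (x # y # A @ B)"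
    using assms by (intro perm_tensor[OF perm_braid[of _ A _ "[x, y]"] perm_ident[of _ B]]) auto
  have i: "perm (ident [k, k] \<parallel> q) (x # y # A @ B) (x # y # w # v # flat ps)"
    using assms by (intro perm_tensor[OF perm_ident[of _ "[x, y]"] q]) auto
  have d: "perm ?d (x # y # w # v # flat ps) (w # x # y # v # flat ps)"
    using assms by (intro perm_tensor[OF perm_braid[of _ "[x, y]" _ "[w]"] perm_ident[of _ "v # flat ps"]]) auto
  have p: "p = ?d \<star> (ident [k, k] \<parallel> q) \<star> ?b"
    using perm_unique[OF assms(2) perm_comp[OF perm_comp[OF b i] d]] assms(3) by blast
  have "(evs ((w, x) # (y, v) # ps) \<star> p) \<star> ?c
      = (ev [k] \<parallel> ev [k] \<parallel> evs ps) \<star> ?d \<star> (ident [k, k] \<parallel> q) \<star> (?b \<star> ?c)"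
    using assms q by (simp add: p)
  also have "?b \<star> ?c = coev [k] \<parallel> ident (lab (A @ B))"
    by (rule move_coev)
  also have "(ident [k, k] \<parallel> q) \<star> \<dots> = (coev [k] \<parallel> ident (k # k # ?R)) \<star> q"
    using q tensor_eq_comp(1)[of "coev [k]" "[]" "[k, k]" q "lab (A @ B)" "k # k # ?R"]
      tensor_eq_comp(2)[of "coev [k]" "[]" "[k, k]" q "lab (A @ B)" "k # k # ?R"] assms
    by simp
  also have "?d \<star> (coev [k] \<parallel> ident (k # k # ?R)) \<star> q = (?d \<star> ((coev [k] \<parallel> ident [k]) \<parallel> ident (k # ?R))) \<star> q"
    using q assms by simp
  also have "?d \<star> ((coev [k] \<parallel> ident [k]) \<parallel> ident (k # ?R)) = (ident [k] \<parallel> coev [k]) \<parallel> ident (k # ?R)"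
    using braid_natural_left[of "coev [k]" "[]" "[k, k]" "[k]"] by (subst tensor_interchange) simp_all
  also have "(ev [k] \<parallel> ev [k] \<parallel> evs ps) \<star> ((ident [k] \<parallel> coev [k]) \<parallel> ident (k # ?R)) \<star> q
     = ((ev [k] \<parallel> ev [k] \<parallel> evs ps) \<star> ((ident [k] \<parallel> coev [k]) \<parallel> ident (k # ?R))) \<star> q"
    using q assms by simp
  also have "(ev [k] \<parallel> ev [k] \<parallel> evs ps) \<star> ((ident [k] \<parallel> coev [k]) \<parallel> ident (k # ?R)) = ev [k] \<parallel> evs ps"
  proof -
    have ee: "ev [k] \<parallel> ev [k] = ev [k] \<star> (ev [k] \<parallel> ident [k, k])"
      using tensor_eq_comp(2)[of "ev [k]" "[k, k]" "[]" "ev [k]" "[k, k]" "[]"] by simp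
    have "(ev [k] \<parallel> ev [k]) \<star> (ident [k] \<parallel> coev [k] \<parallel> ident [k])
        = ev [k] \<star> (((ev [k] \<parallel> ident [k]) \<star> (ident [k] \<parallel> coev [k])) \<parallel> ident [k])"
      unfolding ee by (simp add: comp_tensor_ident)
    also have "(ev [k] \<parallel> ident [k]) \<star> (ident [k] \<parallel> coev [k]) = ident [k]"
      using left_zigzag[of "[k]"] by simp
    finally have "(ev [k] \<parallel> ev [k]) \<star> (ident [k] \<parallel> coev [k] \<parallel> ident [k]) = ev [k]" by simp
    moreover have "((ev [k] \<parallel> ev [k]) \<parallel> evs ps) \<star> ((ident [k] \<parallel> coev [k] \<parallel> ident [k]) \<parallel> ident ?R)
      = ((ev [k] \<parallel> ev [k]) \<star> (ident [k] \<parallel> coev [k] \<parallel> ident [k])) \<parallel> (evs ps \<star> ident ?R)"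
      using assms(1) by (intro tensor_interchange) simp_all
    ultimately show ?thesis using assms(1) by simp
  qed
  also have "\<dots> \<star> q = evs ((w, v) # ps) \<star> q"
    using assms by simp
  finally show ?thesis
    using normal_evs[of "(w, v) # ps" q "A @ B"] q assms by simp
qed

text \<open>Rearranging the counits reduces to the two preceding situations, according to whether \<open>x\<close> and \<open>y\<close>
are matched with each other.\<close>

lemma normal_coev:
  assumes "normal_effect h (A @ x # y # B)" "distinct (A @ x # y # B)" "fst x = k" "fst y = k"
  shows "normal_effect (h \<star> (ident (lab A) \<parallel> coev [k] \<parallel> ident (lab B))) (A @ B)"
proof -
  let ?c = "ident (lab A) \<parallel> coev [k] \<parallel> ident (lab B)"
  obtain ks ps p where h: "well_coloured ps" "perm p (A @ x # y # B) (flat ps)" "h = loops ks \<parallel> (evs ps \<star> p)"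
    using assms(1) unfolding normal_effect_def by blast
  have set: "set (flat ps) = set (A @ x # y # B)" "distinct (flat ps)"
    using perm_mset[OF h(2)] assms(2) by (metis mset_eq_setD, metis mset_eq_imp_distinct_iff)
  obtain w qs q where q: "well_coloured ((x, w) # qs)" "perm q (flat ps) (x # w # flat qs)"
      "evs ps = evs ((x, w) # qs) \<star> q"
    using evs_front[OF h(1), of x] set by auto
  have set': "set (x # w # flat qs) = set (A @ x # y # B)" "distinct (x # w # flat qs)"
    using perm_mset[OF q(2)] set by (metis mset_eq_setD, metis mset_eq_imp_distinct_iff)
  have "normal_effect ((evs ps \<star> p) \<star> ?c) (A @ B)"
  proof (cases "w = y")
    case True
    have "evs ps \<star> p = evs ((x, y) # qs) \<star> (q \<star> p)"
      using q h True by simp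
    then show ?thesis
      using normal_coev_loop[of qs "q \<star> p" A x y B k] q True perm_comp[OF h(2) q(2)] assms by simp
  next
    case False
    then have "y \<in> set (flat qs)"
      using set' assms(2) by auto
    then obtain v rs r where r: "well_coloured ((y, v) # rs)" "perm r (flat qs) (y # v # flat rs)"
      "evs qs = evs ((y, v) # rs) \<star> r"
      using evs_front[of qs y] q by auto
    have wv: "fst w = k" "fst v = k" using q r assms by simp_all
    let ?t = "braid [k] [k] \<parallel> r"
    have t: "perm ?t (x # w # flat qs) (w # x # y # v # flat rs)"
      using assms wv by (intro perm_tensor[OF perm_braid[of _ "[x]" _ "[w]"] r(2)]) auto
    have "evs ((x, w) # qs) = evs ((w, x) # (y, v) # rs) \<star> ?t"
      using r q wv assms by (simp add: tensor_interchange ev_braid)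
    then have "evs ps \<star> p = evs ((w, x) # (y, v) # rs) \<star> ((?t \<star> q) \<star> p)"
      using q h t r wv assms by simp
    moreover have "perm ((?t \<star> q) \<star> p) (A @ x # y # B) (w # x # y # v # flat rs)"
      using perm_comp h(2) q(2) t by blast
    ultimately show ?thesis
      using normal_coev_join[of rs "(?t \<star> q) \<star> p" A x y B w v k] r wv assms by simp
  qed
  moreover have "h \<star> ?c = loops ks \<parallel> ((evs ps \<star> p) \<star> ?c)"
    using h assms by (simp add: scalar_tensor_comp)
  ultimately show ?thesis
    using normal_scalar_loops by simp
qed

text \<open>Precomposition with \<open>f\<close>, in the presence of other strands on both sides, preserves normal forms. This
property is stable under composition and tensor products. Normal forms are required for every naming
of the endpoints, so that fresh names are available for the strands that a unit closes off.\<close>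

definition normal_pullback :: "arrow \<Rightarrow> bool" where
  "normal_pullback f \<longleftrightarrow> (\<forall>A B h. source h = A @ target f @ B \<longrightarrow>
     (\<forall>ys. lab ys = A @ target f @ B \<longrightarrow> distinct ys \<longrightarrow> normal_effect h ys) \<longrightarrow>
     (\<forall>xs. lab xs = A @ source f @ B \<longrightarrow> distinct xs \<longrightarrow> normal_effect (h \<star> (ident A \<parallel> f \<parallel> ident B)) xs))"

lemma normal_pullback_comp:
  assumes "normal_pullback f" "normal_pullback g" "target f = source g"
  shows "normal_pullback (g \<star> f)"
  unfolding normal_pullback_def
proof (intro allI impI)
  fix A B h xs
  assume h: "source h = A @ target (g \<star> f) @ B"
    "\<forall>ys. lab ys = A @ target (g \<star> f) @ B \<longrightarrow> distinct ys \<longrightarrow> normal_effect h ys"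
    and xs: "lab xs = A @ source (g \<star> f) @ B" "distinct xs"
  let ?h = "h \<star> (ident A \<parallel> g \<parallel> ident B)"
  have "normal_effect ?h ys" if "lab ys = A @ target f @ B" "distinct ys" for ys
    using assms(2)[unfolded normal_pullback_def, rule_format, of h A B] h that assms(3) by simp
  then have "normal_effect (?h \<star> (ident A \<parallel> f \<parallel> ident B)) xs"
    using assms(1)[unfolded normal_pullback_def, rule_format, of ?h A B] h xs assms(3) by simp
  then show "normal_effect (h \<star> (ident A \<parallel> (g \<star> f) \<parallel> ident B)) xs"
    using h assms(3) by (simp add: ident_tensor_comp comp_tensor_ident)
qed

lemma normal_pullback_whisker:
  assumes "normal_pullback f"
  shows "normal_pullback (ident X \<parallel> f \<parallel> ident Y)"
  unfolding normal_pullback_def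
proof (intro allI impI)
  fix A B h xs
  let ?f = "ident X \<parallel> f \<parallel> ident Y"
  assume "source h = A @ target ?f @ B"
    "\<forall>ys. lab ys = A @ target ?f @ B \<longrightarrow> distinct ys \<longrightarrow> normal_effect h ys"
    "lab xs = A @ source ?f @ B" "distinct xs"
  then show "normal_effect (h \<star> (ident A \<parallel> ?f \<parallel> ident B)) xs"
    using assms[unfolded normal_pullback_def, rule_format, of h "A @ X" "Y @ B"] by simp
qed

lemma normal_pullback_tensor:
  assumes "normal_pullback f" "normal_pullback g"
  shows "normal_pullback (f \<parallel> g)"
proof -
  have "f \<parallel> g = (ident [] \<parallel> f \<parallel> ident (target g)) \<star> (ident (source f) \<parallel> g \<parallel> ident [])"
    using tensor_eq_comp(1)[of f _ _ g] by simp
  moreover have "normal_pullback \<dots>"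
    by (rule normal_pullback_comp[OF normal_pullback_whisker[OF assms(2)] normal_pullback_whisker[OF assms(1)]])
      simp
  ultimately show ?thesis by simp
qed

lemma normal_pullback_ident: "normal_pullback (ident X)"
  unfolding normal_pullback_def by simp

lemma lab_append_split:
  assumes "lab xs = X @ Y" obtains as bs where "xs = as @ bs" "lab as = X" "lab bs = Y"
  using assms by (auto simp: map_eq_append_conv)

lemma normal_pullback_braid: "normal_pullback (braid X Y)"
  unfolding normal_pullback_def
proof (intro allI impI)
  fix A B h xs
  assume h: "source h = A @ target (braid X Y) @ B"
    "\<forall>ys. lab ys = A @ target (braid X Y) @ B \<longrightarrow> distinct ys \<longrightarrow> normal_effect h ys"
    and xs: "lab xs = A @ source (braid X Y) @ B" "distinct xs"
  from xs(1) obtain as rs where 1: "xs = as @ rs" "lab as = A" "lab rs = X @ Y @ B"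
    by (auto elim: lab_append_split)
  then obtain us ss where 2: "rs = us @ ss" "lab us = X" "lab ss = Y @ B"
    by (auto elim: lab_append_split)
  then obtain vs bs where 3: "ss = vs @ bs" "lab vs = Y" "lab bs = B"
    by (auto elim: lab_append_split)
  note s = 1 2 3
  let ?ys = "as @ vs @ us @ bs"
  have "perm (ident A \<parallel> braid X Y \<parallel> ident B) xs ?ys"
    using s by (intro perm_tensor[OF perm_ident[of _ as]
        perm_tensor[OF perm_braid[of _ us _ vs] perm_ident[of _ bs]]]) simp_all
  moreover have "normal_effect h ?ys"
  proof (rule h(2)[rule_format])
    show "distinct ?ys" using s xs(2) by auto
  qed (use s in simp)
  ultimately show "normal_effect (h \<star> (ident A \<parallel> braid X Y \<parallel> ident B)) xs"
    using normal_perm by blast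
qed

lemma normal_pullback_ev_single: "normal_pullback (ev [k])"
  unfolding normal_pullback_def
proof (intro allI impI)
  fix A B h xs
  assume h: "source h = A @ target (ev [k]) @ B"
    "\<forall>ys. lab ys = A @ target (ev [k]) @ B \<longrightarrow> distinct ys \<longrightarrow> normal_effect h ys"
    and xs: "lab xs = A @ source (ev [k]) @ B" "distinct xs"
  from xs(1) obtain as rs where 1: "xs = as @ rs" "lab as = A" "lab rs = k # k # B"
    by (auto elim: lab_append_split)
  then obtain x y bs where "rs = x # y # bs" "fst x = k" "fst y = k" "lab bs = B"
    by (auto simp: map_eq_Cons_conv)
  note s = 1 this
  then show "normal_effect (h \<star> (ident A \<parallel> ev [k] \<parallel> ident B)) xs"
    using normal_ev[of h as bs x k y] h xs(2) s by simp
qed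

lemma normal_pullback_coev_single: "normal_pullback (coev [k])"
  unfolding normal_pullback_def
proof (intro allI impI)
  fix A B h xs
  assume h: "source h = A @ target (coev [k]) @ B"
    "\<forall>ys. lab ys = A @ target (coev [k]) @ B \<longrightarrow> distinct ys \<longrightarrow> normal_effect h ys"
    and xs: "lab xs = A @ source (coev [k]) @ B" "distinct xs"
  from xs(1) obtain as bs where s: "xs = as @ bs" "lab as = A" "lab bs = B"
    by (auto elim: lab_append_split)
  \<comment> \<open>The number of a point is immaterial, so a bound on the numbers yields two fresh points.\<close>
  obtain n where n: "\<forall>x\<in>set xs. snd x < n"
    by (metis finite_imageI finite_nat_set_iff_bounded finite_set imageI)
  let ?x = "(k, n)" and ?y = "(k, Suc n)"
  have "distinct (as @ ?x # ?y # bs)"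
    using n xs(2) s by (auto dest: bspec)
  then show "normal_effect (h \<star> (ident A \<parallel> coev [k] \<parallel> ident B)) xs"
    using normal_coev[of h as ?x ?y bs k] h s by simp
qed

lemma normal_pullback_ev: "normal_pullback (ev X)"
proof (induction X)
  case (Cons k X)
  then show ?case
    using normal_pullback_comp[OF normal_pullback_whisker[OF normal_pullback_ev_single], of "ev X" "rev X" k X]
      ev_append[of "[k]" X] by simp
qed (simp add: normal_pullback_ident)

lemma normal_pullback_coev: "normal_pullback (coev X)"
proof (induction X)
  case (Cons k X)
  then show ?case
    using normal_pullback_comp[OF normal_pullback_coev_single normal_pullback_whisker[of "coev X" "[k]" "[k]"], of k]
      coev_append[of "[k]" X] by simp
qed (simp add: normal_pullback_ident)

lemma normal_pullback_arr: "cbr_arr f X Y \<Longrightarrow> normal_pullback (arr f)"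
proof (induction rule: cbr_arr.induct)
  case (2 f X Y g Z)
  then show ?case
    using normal_pullback_comp[of "arr f" "arr g"] by (simp add: arr_Compose source_target_arr)
next
  case (3 f X Y g X' Y')
  then show ?case
    using normal_pullback_tensor[of "arr f" "arr g"] by (simp add: arr_Tensor)
qed (simp_all add: normal_pullback_ident normal_pullback_braid normal_pullback_ev normal_pullback_coev)

text \<open>Every effect arises by precomposition from the empty one.\<close>

theorem effect_normal:
  assumes "target h = []" "lab xs = source h" "distinct xs"
  shows "normal_effect h xs"
proof -
  have "normal_pullback h"
    using normal_pullback_arr[OF expr_of_typed[of h]] by simp
  moreover have "normal_effect (ident []) []"
    using normal_evs[of "[]" "ident []" "[]"] perm_ident[of "[]" "[]"] by simp
  ultimately show ?thesis
    using assms normal_pullback_def[of h, THEN iffD1, rule_format, of "ident []" "[]" "[]" xs] by simp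
qed

lemma matching_subset: "e \<in> matching ps \<Longrightarrow> e \<subseteq> set (flat ps)"
  by (induction ps rule: flat.induct) auto

text \<open>Bring the first pair of \<open>ps\<close> to the front of \<open>qs\<close> and continue with the remaining pairs.\<close>

lemma matching_eq_imp:
  "well_coloured ps \<Longrightarrow> well_coloured qs \<Longrightarrow> distinct (flat ps) \<Longrightarrow> distinct (flat qs) \<Longrightarrow>
    matching ps = matching qs \<Longrightarrow> \<exists>q. perm q (flat qs) (flat ps) \<and> evs qs = evs ps \<star> q"
proof (induction ps arbitrary: qs rule: flat.induct)
  case 1
  then have "qs = []" by (simp add: matching_def)
  then show ?case using perm_ident[of "[]" "[]"] by auto
next
  case (2 x y ps)
  have "{x, y} \<in> matching qs" using 2(6) by auto
  then have "x \<in> set (flat qs)" using matching_subset by blast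
  from evs_front[OF 2(3) this] obtain w rs q where q: "well_coloured ((x, w) # rs)"
    "perm q (flat qs) (x # w # flat rs)" "evs qs = evs ((x, w) # rs) \<star> q"
    "matching qs = matching ((x, w) # rs)" by blast
  have d: "distinct (x # w # flat rs)"
    using perm_mset[OF q(2)] 2(5) by (metis mset_eq_imp_distinct_iff)
  have "{x, w} \<in> matching ((x, y) # ps)" using q(4) 2(6) by simp
  then have w: "w = y"
    using 2(4) matching_subset[of "{x, w}" ps] by (auto simp: doubleton_eq_iff)
  have "{x, y} \<notin> matching rs" "{x, y} \<notin> matching ps"
    using 2(4) d matching_subset by fastforce+
  then have "matching ps = matching rs"
    using q(4) 2(6) w by (simp add: insert_ident)
  then obtain r where r: "perm r (flat rs) (flat ps)" "evs rs = evs ps \<star> r"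
    using 2(1)[of rs] 2(2,4) q(1) d by auto
  have "perm (ident [fst x, fst x] \<parallel> r) (x # w # flat rs) (x # y # flat ps)"
    using w 2(2) by (intro perm_tensor[OF perm_ident[of _ "[x, y]"] r(1)]) auto
  then have "perm ((ident [fst x, fst x] \<parallel> r) \<star> q) (flat qs) (flat ((x, y) # ps))"
    using perm_comp[OF q(2)] by simp
  moreover have "evs qs = evs ((x, y) # ps) \<star> ((ident [fst x, fst x] \<parallel> r) \<star> q)"
  proof -
    have "evs qs = ((ev [fst x] \<parallel> evs ps) \<star> (ident [fst x, fst x] \<parallel> r)) \<star> q"
      using q(3) r 2(2) w by (simp add: tensor_interchange)
    also have "\<dots> = evs ((x, y) # ps) \<star> ((ident [fst x, fst x] \<parallel> r) \<star> q)"
      using q(1,2) r 2(2) w by simp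
    finally show ?thesis .
  qed
  ultimately show ?case by blast
qed

lemma evs_perm_eq:
  assumes "well_coloured ps" "well_coloured qs" "perm p xs (flat ps)" "perm q xs (flat qs)"
    and "distinct xs" "matching ps = matching qs"
  shows "evs ps \<star> p = evs qs \<star> q"
proof -
  have "distinct (flat ps)" "distinct (flat qs)"
    using perm_mset[OF assms(3)] perm_mset[OF assms(4)] assms(5) by (metis mset_eq_imp_distinct_iff)+
  then obtain r where r: "perm r (flat qs) (flat ps)" "evs qs = evs ps \<star> r"
    using matching_eq_imp assms by blast
  have "r \<star> q = p"
    using perm_unique[OF perm_comp[OF assms(4) r(1)] assms(3,5)] .
  then show ?thesis using r assms by auto
qed

section \<open>Bending arrows into effects\<close>

definition bend :: "arrow \<Rightarrow> arrow" where
  "bend f = ev (target f) \<star> (ident (rev (target f)) \<parallel> f)"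

lemma bend_target [simp]: "target (bend f) = []"
  and bend_source [simp]: "source (bend f) = rev (target f) @ source f"
  by (simp_all add: bend_def)

text \<open>Composing with the unit straightens the bent strands, by the zigzag relation.\<close>

lemma bend_inverse: "(ident (target f) \<parallel> bend f) \<star> (coev (target f) \<parallel> ident (source f)) = f"
proof -
  let ?Y = "target f"
  have "(ident ?Y \<parallel> bend f) \<star> (coev ?Y \<parallel> ident (source f))
    = (ident ?Y \<parallel> ev ?Y) \<star> ((ident (?Y @ rev ?Y) \<parallel> f) \<star> (coev ?Y \<parallel> ident (source f)))"
    by (simp add: bend_def ident_tensor_comp)
  also have "(ident (?Y @ rev ?Y) \<parallel> f) \<star> (coev ?Y \<parallel> ident (source f)) = (coev ?Y \<parallel> ident ?Y) \<star> f"
    using tensor_eq_comp[of "coev ?Y" "[]" "?Y @ rev ?Y" f "source f" ?Y] by simp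
  also have "(ident ?Y \<parallel> ev ?Y) \<star> (coev ?Y \<parallel> ident ?Y) \<star> f = ((ident ?Y \<parallel> ev ?Y) \<star> (coev ?Y \<parallel> ident ?Y)) \<star> f"
    by simp
  finally show ?thesis by (simp add: right_zigzag)
qed

section \<open>Colours\<close>

text \<open>This coarse invariant replaces the numbers of loops of each colour. It is enough for distinguishing
families of loops that have no colour in common.\<close>

fun colours :: "cbr_expr \<Rightarrow> nat set" where
  "colours (Ident X) = set X"
| "colours (g \<cdot> f) = colours g \<union> colours f"
| "colours (f \<boxtimes> g) = colours f \<union> colours g"
| "colours (Braid X Y) = set X \<union> set Y"
| "colours (Coev X) = set X"
| "colours (Ev X) = set X"

lemma colours_ends: "cbr_arr f X Y \<Longrightarrow> set X \<union> set Y \<subseteq> colours f"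
  by (induction rule: cbr_arr.induct) auto

text \<open>A relation that deletes a part of an expression, such as an identity, deletes only colours that
reappear in the source or the target of what remains.\<close>

lemma colours_invariant: "f \<approx> g \<Longrightarrow> colours f = colours g"
proof (induction rule: cbr_eq.induct)
qed (use colours_ends in \<open>(fastforce)+\<close>)

fun loops_expr :: "nat list \<Rightarrow> cbr_expr" where
  "loops_expr [] = Ident []"
| "loops_expr (k # ks) = (Ev [k] \<cdot> Coev [k]) \<boxtimes> loops_expr ks"

lemma loop_expr_arr: "cbr_arr (Ev [k] \<cdot> Coev [k]) [] []"
  by (rule cbr_arr.intros(2)[where Y = "[k, k]"])
    (use cbr_arr.intros(5)[of "[k]"] cbr_arr.intros(6)[of "[k]"] in simp_all)

lemma loops_expr_arr: "cbr_arr (loops_expr ks) [] []"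
  by (induction ks) (auto intro: cbr_arr.intros(1) cbr_arr_TensorI[OF loop_expr_arr])

lemma arr_loops_expr: "arr (loops_expr ks) = loops ks"
proof (induction ks)
  case (Cons k ks)
  have "arr (Ev [k] \<cdot> Coev [k]) = ev [k] \<star> coev [k]"
    using arr_Compose[of "Coev [k]" "[]" "[k, k]" "Ev [k]" "[]"]
      cbr_arr.intros(5)[of "[k]"] cbr_arr.intros(6)[of "[k]"] by simp
  then show ?case
    using arr_Tensor[OF loop_expr_arr[of k] loops_expr_arr[of ks]] Cons by simp
qed simp

lemma colours_loops_expr [simp]: "colours (loops_expr ks) = set ks"
  by (induction ks) auto

theorem loops_eq_imp_set_eq: "loops ks = loops ls \<Longrightarrow> set ks = set ls"
  using arr_eq_iff[OF loops_expr_arr loops_expr_arr, of ks ls] colours_invariant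
  by (fastforce simp: arr_loops_expr)

section \<open>Pure tensors and traces\<close>

abbreviation vsum :: "'v rvs \<Rightarrow> 'v list \<Rightarrow> 'v" where
  "vsum V \<equiv> abelian_monoid.sumlist V"

lemma rvs_abelian_monoid:
  assumes "is_rvs V" shows "abelian_monoid V"
proof -
  interpret vectorspace real_field V by (rule assms)
  show ?thesis by (rule M.abelian_monoid_axioms)
qed

lemma vsum_simps [simp]:
  assumes "is_rvs V"
  shows "vsum V [] = \<zero>\<^bsub>V\<^esub>" "vsum V (x # xs) = x \<oplus>\<^bsub>V\<^esub> vsum V xs"
  using abelian_monoid.sumlist_Nil[OF rvs_abelian_monoid[OF assms]]
    abelian_monoid.sumlist_Cons[OF rvs_abelian_monoid[OF assms]] by simp_all

lemma vsum_closed: "is_rvs V \<Longrightarrow> set xs \<subseteq> carrier V \<Longrightarrow> vsum V xs \<in> carrier V"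
  by (rule abelian_monoid.sumlist_carrier[OF rvs_abelian_monoid])

lemma vsum_append:
  "is_rvs V \<Longrightarrow> set xs \<subseteq> carrier V \<Longrightarrow> set ys \<subseteq> carrier V \<Longrightarrow> vsum V (xs @ ys) = vsum V xs \<oplus>\<^bsub>V\<^esub> vsum V ys"
  by (rule abelian_monoid.sumlist_append[OF rvs_abelian_monoid])

lemma linear_map_zero: "linear_map real_field V W f \<Longrightarrow> f \<zero>\<^bsub>V\<^esub> = \<zero>\<^bsub>W\<^esub>"
  by (rule mod_hom.f0_is_0[of real_field]) (simp add: linear_map_def)

lemma linear_map_props:
  fixes V W :: "'v rvs"
  assumes "linear_map real_field V W f"
  shows linear_map_closed: "x \<in> carrier V \<Longrightarrow> f x \<in> carrier W"
    and linear_map_add: "x \<in> carrier V \<Longrightarrow> y \<in> carrier V \<Longrightarrow> f (x \<oplus>\<^bsub>V\<^esub> y) = f x \<oplus>\<^bsub>W\<^esub> f y"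
    and linear_map_smult: "x \<in> carrier V \<Longrightarrow> f (r \<odot>\<^bsub>V\<^esub> x) = r \<odot>\<^bsub>W\<^esub> f x"
  using assms unfolding linear_map_iff by blast+

lemma linear_map_vsum:
  fixes V W :: "'v rvs"
  assumes "linear_map real_field V W f" "set xs \<subseteq> carrier V"
  shows "f (vsum V xs) = vsum W (map f xs)"
proof -
  have "is_rvs V" "is_rvs W" using assms(1) by (simp_all add: linear_map_iff)
  then show ?thesis
    using assms(2)
    by (induction xs) (simp_all add: linear_map_zero[OF assms(1)] linear_map_add[OF assms(1)] vsum_closed)
qed

lemma ex1_implies_unique: "\<exists>!x. P x \<Longrightarrow> P x \<Longrightarrow> P y \<Longrightarrow> x = y"
  by blast

text \<open>The finite sums of pure tensors form a subspace, and by the universal property the pure tensors factor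
through a linear map \<open>h\<close> to this subspace. Regarded as an endomorphism of the tensor product, \<open>h\<close>
agrees with the identity on pure tensors, hence everywhere.\<close>

lemma tensor_pure_sum:
  assumes "is_tensor_product V W T \<tau>" "is_rvs V" "is_rvs W" "t \<in> carrier T"
  shows "\<exists>ab. set ab \<subseteq> carrier V \<times> carrier W \<and> t = vsum T (map (\<lambda>(a, b). \<tau> a b) ab)"
proof -
  define S where "S = {vsum T (map (\<lambda>(a, b). \<tau> a b) ab) | ab. set ab \<subseteq> carrier V \<times> carrier W}"
  have T: "is_rvs T" and bil: "bilinear_rvs V W T \<tau>"
    using tensor_bilinear[OF assms(1)] .
  interpret T: vectorspace real_field T by (rule T)
  have \<tau>: "\<tau> a b \<in> carrier T" if "a \<in> carrier V" "b \<in> carrier W" for a b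
    using bil that unfolding bilinear_rvs_def by (metis linear_map_closed)
  have sm: "r \<odot>\<^bsub>T\<^esub> \<tau> a b = \<tau> (r \<odot>\<^bsub>V\<^esub> a) b" if "a \<in> carrier V" "b \<in> carrier W" for r a b
    using bil that unfolding bilinear_rvs_def by (metis linear_map_smult)
  have car: "set (map (\<lambda>(a, b). \<tau> a b) ab) \<subseteq> carrier T" if "set ab \<subseteq> carrier V \<times> carrier W" for ab
    using that \<tau> by auto
  have sub: "subspace real_field S T"
  proof (intro subspace.intro submodule.intro)
    show "vectorspace real_field T" by (rule T)
    show "module real_field T" by (rule T.module_axioms)
    show "S \<subseteq> carrier T"
      unfolding S_def using vsum_closed[OF T car] by blast
    show "\<zero>\<^bsub>T\<^esub> \<in> S"
      unfolding S_def using vsum_simps(1)[OF T] by (intro CollectI exI[of _ "[]"]) simp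
  next
    fix v w assume "v \<in> S" "w \<in> S"
    then obtain as bs where "set as \<subseteq> carrier V \<times> carrier W" "set bs \<subseteq> carrier V \<times> carrier W"
      "v = vsum T (map (\<lambda>(a, b). \<tau> a b) as)" "w = vsum T (map (\<lambda>(a, b). \<tau> a b) bs)"
      unfolding S_def by auto
    then show "v \<oplus>\<^bsub>T\<^esub> w \<in> S"
      unfolding S_def using vsum_append[OF T car car, of as bs] by (intro CollectI exI[of _ "as @ bs"]) simp
  next
    fix c v assume "c \<in> carrier real_field" "v \<in> S"
    then obtain as where as: "set as \<subseteq> carrier V \<times> carrier W" "v = vsum T (map (\<lambda>(a, b). \<tau> a b) as)"
      unfolding S_def by auto
    have "c \<odot>\<^bsub>T\<^esub> vsum T (map (\<lambda>(a, b). \<tau> a b) as) = vsum T (map (\<lambda>(a, b). \<tau> a b) (map (\<lambda>(a, b). (c \<odot>\<^bsub>V\<^esub> a, b)) as))"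
      using as(1)
    proof (induction as)
      case (Cons p as)
      obtain a b where p: "p = (a, b)" by fastforce
      show ?case
        using Cons p T.smult_r_distr[of c "\<tau> a b" "vsum T (map (\<lambda>(a, b). \<tau> a b) as)"]
          vsum_closed[OF T car[of as]] \<tau> sm T by auto
    qed (use T in simp)
    moreover have "set (map (\<lambda>(a, b). (c \<odot>\<^bsub>V\<^esub> a, b)) as) \<subseteq> carrier V \<times> carrier W"
      using as(1) assms(2) by (auto simp: vectorspace_def intro!: module.smult_closed)
    ultimately show "c \<odot>\<^bsub>T\<^esub> v \<in> S"
      unfolding S_def as(2) by (intro CollectI exI[of _ "map (\<lambda>(a, b). (c \<odot>\<^bsub>V\<^esub> a, b)) as"]) simp
  qed
  let ?U = "T\<lparr>carrier := S\<rparr>"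
  have U: "is_rvs ?U" by (rule T.subspace_is_vs[OF sub])
  have ST: "S \<subseteq> carrier T" using sub by (simp add: subspace_def submodule_def)
  have \<tau>S: "\<tau> a b \<in> S" if "a \<in> carrier V" "b \<in> carrier W" for a b
    unfolding S_def using that \<tau> T by (intro CollectI exI[of _ "[(a, b)]"]) simp
  have "bilinear_rvs V W ?U \<tau>"
    using bil \<tau>S U unfolding bilinear_rvs_def linear_map_iff by auto
  then obtain h where h: "h \<in> lin_maps T ?U" "\<And>v w. v \<in> carrier V \<Longrightarrow> w \<in> carrier W \<Longrightarrow> App h (\<tau> v w) = \<tau> v w"
    using tensor_ex1[OF assms(1) U] by blast
  then have hl: "linear_map real_field T ?U (App h)" "App h \<in> extensional (carrier T)"
    by (auto simp: lin_maps_def)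
  have 1: "Lin T T (App h) \<in> lin_maps T T"
    using hl ST unfolding lin_maps_def linear_map_iff by auto
  have 2: "Lin T T (\<lambda>v\<in>carrier T. v) \<in> lin_maps T T"
    using T unfolding lin_maps_def linear_map_iff by auto
  have "Lin T T (App h) = Lin T T (\<lambda>v\<in>carrier T. v)"
    by (rule ex1_implies_unique[OF tensor_ex1[OF assms(1) T bil]]) (use 1 2 h(2) \<tau> in simp_all)
  then have "App h t = t" using assms(4) by simp
  moreover have "App h t \<in> S"
    using linear_map_closed[OF hl(1) assms(4)] by simp
  ultimately show ?thesis unfolding S_def by auto
qed

definition functional :: "'v rvs \<Rightarrow> ('v \<Rightarrow> real) \<Rightarrow> bool" where
  "functional V \<phi> \<longleftrightarrow>
    (\<forall>x\<in>carrier V. \<forall>y\<in>carrier V. \<phi> (x \<oplus>\<^bsub>V\<^esub> y) = \<phi> x + \<phi> y) \<and>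
    (\<forall>r. \<forall>x\<in>carrier V. \<phi> (r \<odot>\<^bsub>V\<^esub> x) = r * \<phi> x)"

lemma functional_zero:
  assumes "is_rvs V" "functional V \<phi>" shows "\<phi> \<zero>\<^bsub>V\<^esub> = 0"
proof -
  interpret vectorspace real_field V by (rule assms)
  have "\<phi> (\<zero>\<^bsub>V\<^esub> \<oplus>\<^bsub>V\<^esub> \<zero>\<^bsub>V\<^esub>) = \<phi> \<zero>\<^bsub>V\<^esub> + \<phi> \<zero>\<^bsub>V\<^esub>"
    using assms(2) M.zero_closed unfolding functional_def by blast
  then show ?thesis by simp
qed

lemma functional_lincomb:
  assumes "is_rvs V" "functional V \<phi>" "finite A" "A \<subseteq> carrier V"
  shows "\<phi> (module.lincomb V c A) = (\<Sum>e\<in>A. c e * \<phi> e)"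
proof -
  interpret vectorspace real_field V by (rule assms)
  show ?thesis
    using assms(3,4)
  proof (induction A)
    case empty
    then show ?case using functional_zero[OF assms(1,2)] by (simp add: lincomb_def)
  next
    case (insert x A)
    have "lincomb c (insert x A) = c x \<odot>\<^bsub>V\<^esub> x \<oplus>\<^bsub>V\<^esub> lincomb c A"
      using insert by (simp add: lincomb_insert2)
    then show ?case
      using insert assms(2) lincomb_closed[of A c] unfolding functional_def by simp
  qed
qed

text \<open>The identity is written as \<open>\<Sum> \<phi> \<otimes> a\<close>. This makes the vectors \<open>a\<close> a finite generating set, and
\<open>\<Sum> \<phi> a\<close> is the trace of the identity, which a basis evaluates to the dimension.\<close>

lemma trace_identity:
  assumes V: "is_rvs V"
    and ab: "\<And>a \<phi>. (a, \<phi>) \<in> set ab \<Longrightarrow> a \<in> carrier V \<and> functional V \<phi>"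
    and id: "\<And>v. v \<in> carrier V \<Longrightarrow> v = vsum V (map (\<lambda>(a, \<phi>). \<phi> v \<odot>\<^bsub>V\<^esub> a) ab)"
  shows "vectorspace.fin_dim real_field V"
    and "real (vectorspace.dim real_field V) = (\<Sum>(a, \<phi>)\<leftarrow>ab. \<phi> a)"
proof -
  interpret vectorspace real_field V by (rule V)
  let ?S = "fst ` set ab"
  have S: "finite ?S" "?S \<subseteq> carrier V" using ab by auto
  have span_sum: "vsum V (map (\<lambda>(a, \<phi>). \<phi> v \<odot>\<^bsub>V\<^esub> a) cd) \<in> span ?S" if "set cd \<subseteq> set ab" for cd v
    using that
  proof (induction cd)
    case Nil
    then show ?case using V span_zero by simp
  next
    case (Cons p cd)
    obtain a \<phi> where p: "p = (a, \<phi>)" by fastforce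
    have "a \<in> span ?S" using Cons.prems p S by (intro span_mem) force+
    then have "\<phi> v \<odot>\<^bsub>V\<^esub> a \<in> span ?S"
      using span_is_subspace[OF S(2)] by (auto simp: subspace_def intro: submodule.smult_closed)
    then show ?case
      using Cons p V span_add1[OF S(2)] by simp
  qed
  have "v \<in> span ?S" if "v \<in> carrier V" for v
    using span_sum[OF order_refl, of v] unfolding id[OF that, symmetric] .
  then have "carrier V \<subseteq> span ?S" by blast
  then have gen: "gen_set ?S" using span_is_subset2[OF S(2)] by blast
  then show fd: "fin_dim" unfolding fin_dim_def using S by blast
  \<comment> \<open>Expand the given vectors in a basis; reading off the coefficients of the basis vectors
    themselves gives the diagonal of the identity matrix.\<close>
  obtain \<beta> where \<beta>: "finite \<beta>" "basis \<beta>" using finite_basis_exists[OF fd] by blast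
  have \<beta>V: "\<beta> \<subseteq> carrier V" "lin_indpt \<beta>" "gen_set \<beta>" using \<beta>(2) by (auto simp: basis_def)
  have "\<exists>c. lincomb c \<beta> = a" if "a \<in> carrier V" for a
    using finite_in_span[OF \<beta>(1) \<beta>V(1)] that \<beta>V(3) by blast
  then obtain c where c: "\<And>a. a \<in> carrier V \<Longrightarrow> lincomb (c a) \<beta> = a" by metis
  have sum: "vsum V (map (\<lambda>(a, \<phi>). \<phi> v \<odot>\<^bsub>V\<^esub> a) cd) = lincomb (\<lambda>f. \<Sum>(a, \<phi>)\<leftarrow>cd. \<phi> v * c a f) \<beta>"
    if "set cd \<subseteq> set ab" for cd v
    using that
  proof (induction cd)
    case Nil
    show ?case using V \<beta>V(1) lmult_0 by (auto simp: lincomb_def intro!: M.finsum_all0[symmetric])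
  next
    case (Cons p cd)
    obtain a \<phi> where p: "p = (a, \<phi>)" by fastforce
    have a: "a \<in> carrier V" using Cons.prems p ab by auto
    have "\<phi> v \<odot>\<^bsub>V\<^esub> a = lincomb (\<lambda>f. \<phi> v * c a f) \<beta>"
      using lincomb_smult[OF \<beta>V(1), of "c a" "\<phi> v"] c[OF a] \<beta>(1) by simp
    then show ?case
      using Cons p V lincomb_sum[OF \<beta>(1) \<beta>V(1), of "\<lambda>f. \<phi> v * c a f" "\<lambda>f. \<Sum>(a, \<phi>)\<leftarrow>cd. \<phi> v * c a f"] by simp
  qed
  have delta: "(\<Sum>(a, \<phi>)\<leftarrow>ab. \<phi> e * c a e) = 1" if e: "e \<in> \<beta>" for e
  proof -
    let ?s = "\<lambda>f. \<Sum>(a, \<phi>)\<leftarrow>ab. \<phi> e * c a f"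
    let ?d = "\<lambda>f. if f = e then 1 else (0::real)"
    have eV: "e \<in> carrier V" using e \<beta>V(1) by blast
    have "lincomb ?s \<beta> = e" using HOL.trans[OF id[OF eV] sum[OF order_refl, of e]] by (rule HOL.sym)
    moreover have "lincomb ?d \<beta> = e"
    proof -
      have "lincomb ?d \<beta> = ?d e \<odot>\<^bsub>V\<^esub> e \<oplus>\<^bsub>V\<^esub> lincomb ?d (\<beta> - {e})"
        using lincomb_del2[OF \<beta>(1) \<beta>V(1) _ e, of ?d] by simp
      moreover have "lincomb ?d (\<beta> - {e}) = \<zero>\<^bsub>V\<^esub>"
        unfolding lincomb_def using \<beta>V(1) lmult_0 by (intro M.finsum_all0) auto
      ultimately show ?thesis using eV smult_one by simp
    qed
    moreover have "\<exists>!a. a \<in> \<beta> \<rightarrow>\<^sub>E carrier real_field \<and> lincomb a \<beta> = e"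
      using basis_criterion[OF \<beta>(1) \<beta>V(1)] \<beta>(2) eV by blast
    moreover have "lincomb (restrict a \<beta>) \<beta> = lincomb a \<beta>" for a
      using \<beta>V(1) by (intro lincomb_cong) auto
    ultimately have "restrict ?s \<beta> = restrict ?d \<beta>"
      by (metis (no_types, lifting) PiE_restrict UNIV_I restrict_PiE_iff class_ring_simps(1))
    from fun_cong[OF this, of e] show ?thesis using e by simp
  qed
  have "(\<Sum>(a, \<phi>)\<leftarrow>cd. \<phi> a) = (\<Sum>e\<in>\<beta>. \<Sum>(a, \<phi>)\<leftarrow>cd. \<phi> e * c a e)" if "set cd \<subseteq> set ab" for cd
    using that
  proof (induction cd)
    case (Cons p cd)
    obtain a \<phi> where p: "p = (a, \<phi>)" by fastforce
    have "\<phi> a = (\<Sum>e\<in>\<beta>. c a e * \<phi> e)"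
      using functional_lincomb[OF V _ \<beta>(1) \<beta>V(1), of \<phi> "c a"] ab[of a \<phi>] c[of a] Cons.prems p by auto
    then show ?case using Cons p by (simp add: sum.distrib mult.commute)
  qed simp
  then have "(\<Sum>(a, \<phi>)\<leftarrow>ab. \<phi> a) = real (card \<beta>)" using delta by simp
  then show "real dim = (\<Sum>(a, \<phi>)\<leftarrow>ab. \<phi> a)" using dim_basis[OF \<beta>] by simp
qed

section \<open>The functor on pure tensors\<close>

lemma cBr_sel [simp]:
  "Ob cBr = UNIV" "Mor cBr X Y = cbr_class ` {f. cbr_arr f X Y}" "Idm cBr X = cbr_class (Ident X)"
  "UnitO cBr = []" "TenO cBr X Y = X @ Y" "Brd cBr X Y = cbr_class (Braid X Y)"
  by (simp_all add: cBr_def)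

lemma Rep_arrow_mor: "Rep_arrow a \<in> Mor cBr (source a) (target a)"
  using Rep_arr[OF expr_of_typed[of a]] expr_of_typed[of a] by auto

lemma Rep_arrow_comp: "target f = source g \<Longrightarrow> Rep_arrow (g \<star> f) = Cmp cBr (Rep_arrow g) (Rep_arrow f)"
  using cBr_Cmp[OF expr_of_typed[of f], of "expr_of g" "target g"] expr_of_typed[of g]
    Rep_arr[OF expr_of_typed[of f]] Rep_arr[OF expr_of_typed[of g]]
    Rep_arr[OF cbr_arr.intros(2)[OF expr_of_typed[of f]], of "expr_of g" "target g"]
  by (simp add: comp_arrow_def)

lemma Rep_arrow_tensor: "Rep_arrow (f \<parallel> g) = TenM cBr (Rep_arrow f) (Rep_arrow g)"
  using cBr_TenM[OF expr_of_typed[of f] expr_of_typed[of g]]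
    Rep_arr[OF expr_of_typed[of f]] Rep_arr[OF expr_of_typed[of g]]
    Rep_arr[OF cbr_arr.intros(3)[OF expr_of_typed[of f] expr_of_typed[of g]]]
  by (simp add: tensor_arrow_def)

lemma Rep_arrow_generators:
  "Rep_arrow (ident X) = Idm cBr X" "Rep_arrow (braid X Y) = Brd cBr X Y"
  using Rep_arr[OF cbr_arr.intros(1)] Rep_arr[OF cbr_arr.intros(4)] by simp_all

lemma lin_maps_iff:
  "h \<in> lin_maps V W \<longleftrightarrow> Src h = V \<and> Tgt h = W \<and> linear_map real_field V W (App h) \<and> App h \<in> extensional (carrier V)"
  unfolding lin_maps_def by (cases h) auto

lemma Vect_sel [simp]:
  "Ob (Vect RR VT tn) = {V. is_rvs V}" "Mor (Vect RR VT tn) = lin_maps"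
  "Idm (Vect RR VT tn) V = Lin V V (\<lambda>v\<in>carrier V. v)"
  "Cmp (Vect RR VT tn) g f = Lin (Src f) (Tgt g) (compose (carrier (Src f)) (App g) (App f))"
  "UnitO (Vect RR VT tn) = RR" "TenO (Vect RR VT tn) = VT"
  by (simp_all add: Vect_def)

locale brauer_representation =
  strict_tensor_structure RR \<iota> VT tn + symmetric_strict_monoidal_functor cBr "Vect RR VT tn" YO YM
  for RR :: "'v rvs" and \<iota> :: "real \<Rightarrow> 'v" and VT and tn and YO and YM
begin

lemma YO_rvs [simp]: "is_rvs (YO X)"
  using obj[of X] by simp

lemma YO_Nil [simp]: "YO [] = RR"
  using unit by simp

lemma YO_append: "YO (X @ Y) = VT (YO X) (YO Y)"
  using tensor_obj[of X Y] by simp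

lemma YO_Cons: "YO (k # X) = VT (YO [k]) (YO X)"
  using YO_append[of "[k]" X] by simp

definition act :: "arrow \<Rightarrow> 'v lin" where
  "act a = YM (Rep_arrow a)"

lemma act_lin_maps: "act a \<in> lin_maps (YO (source a)) (YO (target a))"
  unfolding act_def using mor[of "source a" "target a" "Rep_arrow a"] Rep_arrow_mor[of a] by simp

lemma act_Src_Tgt [simp]: "Src (act a) = YO (source a)" "Tgt (act a) = YO (target a)"
  using act_lin_maps[of a] by (simp_all add: lin_maps_iff)

lemma act_linear: "linear_map real_field (YO (source a)) (YO (target a)) (App (act a))"
  using act_lin_maps[of a] by (simp add: lin_maps_iff)

lemma act_closed: "v \<in> carrier (YO (source a)) \<Longrightarrow> App (act a) v \<in> carrier (YO (target a))"
  by (rule linear_map_closed[OF act_linear])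

lemma act_comp_eq: "target f = source g \<Longrightarrow> act (g \<star> f) = Cmp (Vect RR VT tn) (act g) (act f)"
  unfolding act_def
  using comp[of "source f" "target f" "target g" "Rep_arrow f" "Rep_arrow g"]
    Rep_arrow_mor[of f] Rep_arrow_mor[of g]
  by (simp only: Rep_arrow_comp) simp

lemma act_tensor_eq: "act (f \<parallel> g) = TenM (Vect RR VT tn) (act f) (act g)"
  unfolding act_def
  using tensor_mor[of "source f" "target f" "source g" "target g" "Rep_arrow f" "Rep_arrow g"]
    Rep_arrow_mor[of f] Rep_arrow_mor[of g]
  by (simp only: Rep_arrow_tensor) simp

lemma act_comp:
  "target f = source g \<Longrightarrow> v \<in> carrier (YO (source f)) \<Longrightarrow> App (act (g \<star> f)) v = App (act g) (App (act f) v)"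
  by (simp add: act_comp_eq compose_def)

lemma act_ident: "v \<in> carrier (YO X) \<Longrightarrow> App (act (ident X)) v = v"
  unfolding act_def Rep_arrow_generators using ident[of X] by simp

lemma act_tensor:
  assumes "v \<in> carrier (YO (source f))" "w \<in> carrier (YO (source g))"
  shows "App (act (f \<parallel> g)) (tn (YO (source f)) (YO (source g)) v w)
    = tn (YO (target f)) (YO (target g)) (App (act f) v) (App (act g) w)"
  using theI'[OF TenM_ex1[OF act_lin_maps[of f] act_lin_maps[of g]]] assms
  by (simp add: act_tensor_eq Vect_def)

lemma act_braid:
  assumes "v \<in> carrier (YO X)" "w \<in> carrier (YO Y)"
  shows "App (act (braid X Y)) (tn (YO X) (YO Y) v w) = tn (YO Y) (YO X) w v"
  using theI'[OF Brd_ex1[OF YO_rvs[of X] YO_rvs[of Y]]] assms braid[of X Y]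
  unfolding act_def Rep_arrow_generators by (simp add: Vect_def)

lemma tn_bilinear: "is_rvs V \<Longrightarrow> is_rvs W \<Longrightarrow> bilinear_rvs V W (VT V W) (tn V W)"
  using tensor_bilinear(2) tensor by blast

lemma tn_linear:
  assumes "is_rvs V" "is_rvs W"
  shows tn_linear_left: "w \<in> carrier W \<Longrightarrow> linear_map real_field V (VT V W) (\<lambda>v. tn V W v w)"
    and tn_linear_right: "v \<in> carrier V \<Longrightarrow> linear_map real_field W (VT V W) (tn V W v)"
  using tn_bilinear[OF assms] unfolding bilinear_rvs_def by blast+

lemma tn_closed: "is_rvs V \<Longrightarrow> is_rvs W \<Longrightarrow> v \<in> carrier V \<Longrightarrow> w \<in> carrier W \<Longrightarrow> tn V W v w \<in> carrier (VT V W)"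
  by (rule linear_map_closed[OF tn_linear_right])

lemma iota_closed [simp]: "\<iota> r \<in> carrier RR"
  using unit_bij by (auto simp: bij_betw_def)

lemma iota_inject [simp]: "\<iota> r = \<iota> s \<longleftrightarrow> r = s"
  using unit_bij by (auto simp: bij_betw_def inj_on_def)

lemma tn_iota: "tn RR RR (\<iota> r) (\<iota> s) = \<iota> (r * s)"
  using unit_left[OF unit_rvs] by (simp add: unit_smult)

definition coord :: "'v \<Rightarrow> real" where
  "coord u = inv_into UNIV \<iota> u"

lemma iota_coord [simp]: "u \<in> carrier RR \<Longrightarrow> \<iota> (coord u) = u"
  unfolding coord_def using unit_bij by (auto simp: bij_betw_def intro: f_inv_into_f)

lemma coord_iota [simp]: "coord (\<iota> r) = r"
  using iota_inject iota_coord iota_closed by blast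

lemma coord_functional: "functional RR coord"
proof -
  have "coord (x \<oplus>\<^bsub>RR\<^esub> y) = coord x + coord y" if "x \<in> carrier RR" "y \<in> carrier RR" for x y
    using unit_add[of "coord x" "coord y"] that coord_iota[of "coord x + coord y"] by simp
  moreover have "coord (r \<odot>\<^bsub>RR\<^esub> x) = r * coord x" if "x \<in> carrier RR" for r x
    using unit_smult[of r "coord x"] that coord_iota[of "r * coord x"] by simp
  ultimately show ?thesis unfolding functional_def by blast
qed

definition form :: "nat \<Rightarrow> 'v \<Rightarrow> 'v \<Rightarrow> real" where
  "form k u w = coord (App (act (ev [k])) (tn (YO [k]) (YO [k]) u w))"

definition loop_value :: "nat \<Rightarrow> real" where
  "loop_value k = coord (App (act (ev [k] \<star> coev [k])) (\<iota> 1))"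

lemma functional_comp: "functional W \<phi> \<Longrightarrow> linear_map real_field V W f \<Longrightarrow> functional V (\<lambda>v. \<phi> (f v))"
  for V W :: "'v rvs"
  unfolding functional_def linear_map_iff Pi_iff by simp

lemma act_ev_linear: "linear_map real_field (VT (YO [k]) (YO [k])) RR (App (act (ev [k])))"
  using act_linear[of "ev [k]"] YO_Cons[of k "[k]"] by simp

lemma form_functional_left: "w \<in> carrier (YO [k]) \<Longrightarrow> functional (YO [k]) (\<lambda>u. form k u w)"
  unfolding form_def
  by (rule functional_comp[OF functional_comp[OF coord_functional act_ev_linear] tn_linear_left[OF YO_rvs YO_rvs]])

lemma form_functional_right: "u \<in> carrier (YO [k]) \<Longrightarrow> functional (YO [k]) (form k u)"
  unfolding form_def
  by (rule functional_comp[OF functional_comp[OF coord_functional act_ev_linear] tn_linear_right[OF YO_rvs YO_rvs]])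

lemma act_ev: "u \<in> carrier (YO [k]) \<Longrightarrow> w \<in> carrier (YO [k]) \<Longrightarrow>
    App (act (ev [k])) (tn (YO [k]) (YO [k]) u w) = \<iota> (form k u w)"
  unfolding form_def using linear_map_closed[OF act_ev_linear] tn_closed by simp

lemma form_sym:
  assumes "u \<in> carrier (YO [k])" "w \<in> carrier (YO [k])" shows "form k u w = form k w u"
proof -
  have "tn (YO [k]) (YO [k]) u w \<in> carrier (YO [k, k])"
    using tn_closed assms YO_Cons[of k "[k]"] by simp
  then have "\<iota> (form k u w) = App (act (ev [k] \<star> braid [k] [k])) (tn (YO [k]) (YO [k]) u w)"
    unfolding ev_braid using act_ev[OF assms] by simp
  also have "\<dots> = App (act (ev [k])) (App (act (braid [k] [k])) (tn (YO [k]) (YO [k]) u w))"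
    using \<open>tn (YO [k]) (YO [k]) u w \<in> _\<close> by (intro act_comp) simp_all
  also have "\<dots> = \<iota> (form k w u)"
    using assms by (simp add: act_braid act_ev)
  finally show ?thesis by simp
qed

definition admissible :: "(point \<Rightarrow> 'v) \<Rightarrow> bool" where
  "admissible v \<longleftrightarrow> (\<forall>x. v x \<in> carrier (YO [fst x]))"

lemma admissibleD: "admissible v \<Longrightarrow> v x \<in> carrier (YO [fst x])"
  unfolding admissible_def by blast

fun pure :: "(point \<Rightarrow> 'v) \<Rightarrow> point list \<Rightarrow> 'v" where
  "pure v [] = \<iota> 1"
| "pure v (x # xs) = tn (YO [fst x]) (YO (lab xs)) (v x) (pure v xs)"

lemma pure_closed: "admissible v \<Longrightarrow> pure v xs \<in> carrier (YO (lab xs))"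
proof (induction xs)
  case (Cons x xs)
  then show ?case
    using tn_closed[of "YO [fst x]" "YO (lab xs)"] YO_Cons[of "fst x" "lab xs"] by (simp add: admissibleD)
qed simp

lemma rvs_smult_one: "is_rvs V \<Longrightarrow> v \<in> carrier V \<Longrightarrow> 1 \<odot>\<^bsub>V\<^esub> v = v"
  for V :: "'v rvs"
proof -
  assume V: "is_rvs V" "v \<in> carrier V"
  interpret vectorspace real_field V by (rule V)
  show ?thesis using smult_one[OF V(2)] by simp
qed

lemma tn_unit: "is_rvs V \<Longrightarrow> v \<in> carrier V \<Longrightarrow> tn RR V (\<iota> 1) v = v"
  "is_rvs V \<Longrightarrow> v \<in> carrier V \<Longrightarrow> tn V RR v (\<iota> 1) = v"
  by (simp_all add: unit_left unit_right rvs_smult_one)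

lemma pure_append:
  "admissible v \<Longrightarrow> pure v (xs @ ys) = tn (YO (lab xs)) (YO (lab ys)) (pure v xs) (pure v ys)"
proof (induction xs)
  case Nil
  then show ?case using tn_unit(1) pure_closed by simp
next
  case (Cons x xs)
  have "pure v ((x # xs) @ ys) = tn (YO [fst x]) (VT (YO (lab xs)) (YO (lab ys))) (v x)
      (tn (YO (lab xs)) (YO (lab ys)) (pure v xs) (pure v ys))"
    using Cons by (simp add: YO_append)
  also have "\<dots> = tn (VT (YO [fst x]) (YO (lab xs))) (YO (lab ys))
      (tn (YO [fst x]) (YO (lab xs)) (v x) (pure v xs)) (pure v ys)"
    using Cons.prems pure_closed by (intro assoc[symmetric]) (simp_all add: admissibleD)
  also have "\<dots> = tn (YO (lab (x # xs))) (YO (lab ys)) (pure v (x # xs)) (pure v ys)"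
    using YO_Cons[of "fst x" "lab xs"] by simp
  finally show ?case .
qed

lemma act_perm: "perm f xs ys \<Longrightarrow> admissible v \<Longrightarrow> App (act f) (pure v xs) = pure v ys"
proof (induction rule: perm.induct)
  case (perm_ident X xs)
  then show ?case by (simp add: act_ident pure_closed)
next
  case (perm_comp f xs ys g zs)
  then show ?case by (simp add: act_comp pure_closed)
next
  case (perm_tensor f xs ys g us vs ps qs)
  then show ?case
    using act_tensor[of "pure v xs" f "pure v us" g] by (simp add: pure_append pure_closed)
next
  case (perm_braid X xs Y ys ps qs)
  then show ?case by (simp add: pure_append act_braid pure_closed)
qed

lemma act_evs:
  "well_coloured ps \<Longrightarrow> admissible v \<Longrightarrow>
    App (act (evs ps)) (pure v (flat ps)) = \<iota> (\<Prod>(x, y)\<leftarrow>ps. form (fst x) (v x) (v y))"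
proof (induction ps rule: flat.induct)
  case 1
  then show ?case using act_ident[of "\<iota> 1" "[]"] by simp
next
  case (2 x y ps)
  let ?V = "YO [fst x]"
  have y: "fst y = fst x" using 2(2) by simp
  have "v x \<in> carrier (YO [fst x])" "v y \<in> carrier (YO [fst y])"
    using admissibleD[OF 2(3)] by blast+
  note v = this(1) this(2)[unfolded y] y
  have "pure v [x, y] = tn ?V ?V (v x) (v y)"
    using v tn_unit(2)[of ?V "v y"] by simp
  moreover have "pure v (flat ((x, y) # ps)) = tn (YO (lab [x, y])) (YO (lab (flat ps))) (pure v [x, y]) (pure v (flat ps))"
    using pure_append[of v "[x, y]" "flat ps"] 2(3) by simp
  moreover have "App (act (ev [fst x] \<parallel> evs ps)) (tn (YO (lab [x, y])) (YO (lab (flat ps))) (pure v [x, y]) (pure v (flat ps)))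
     = tn RR RR (App (act (ev [fst x])) (pure v [x, y])) (App (act (evs ps)) (pure v (flat ps)))"
    using act_tensor[of "pure v [x, y]" "ev [fst x]" "pure v (flat ps)" "evs ps"] 2
      pure_closed[of v "[x, y]"] pure_closed[of v "flat ps"] v by simp
  ultimately show ?case
    using 2(1)[OF _ 2(3)] 2(2) v(1,2) by (simp add: act_ev tn_iota)
qed

lemma act_loops: "App (act (loops ks)) (\<iota> 1) = \<iota> (\<Prod>k\<leftarrow>ks. loop_value k)"
proof (induction ks)
  case Nil
  then show ?case using act_ident[of "\<iota> 1" "[]"] by simp
next
  case (Cons k ks)
  let ?l = "ev [k] \<star> coev [k]"
  have "App (act ?l) (\<iota> 1) = \<iota> (loop_value k)"
    unfolding loop_value_def using act_closed[of "\<iota> 1" ?l] by simp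
  moreover have "App (act (?l \<parallel> loops ks)) (tn RR RR (\<iota> 1) (\<iota> 1)) = tn RR RR (App (act ?l) (\<iota> 1)) (App (act (loops ks)) (\<iota> 1))"
    using act_tensor[of "\<iota> 1" ?l "\<iota> 1" "loops ks"] by simp
  ultimately show ?case using Cons by (simp add: tn_iota)
qed

text \<open>The permutation rearranges the tensor factors, each counit contracts two of them, and each loop
contributes a scalar.\<close>

lemma act_normal:
  assumes "well_coloured ps" "perm p xs (flat ps)" "admissible v"
  shows "App (act (loops ks \<parallel> (evs ps \<star> p))) (pure v xs)
    = \<iota> ((\<Prod>k\<leftarrow>ks. loop_value k) * (\<Prod>(x, y)\<leftarrow>ps. form (fst x) (v x) (v y)))"
proof -
  have "App (act (loops ks \<parallel> (evs ps \<star> p))) (tn RR (YO (lab xs)) (\<iota> 1) (pure v xs))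
     = tn RR RR (App (act (loops ks)) (\<iota> 1)) (App (act (evs ps \<star> p)) (pure v xs))"
    using act_tensor[of "\<iota> 1" "loops ks" "pure v xs" "evs ps \<star> p"] assms by (simp add: pure_closed)
  then show ?thesis
    using assms by (simp add: act_loops act_comp act_perm act_evs pure_closed tn_iota tn_unit(1))
qed

end

section \<open>Loop values and the symmetric forms\<close>

context brauer_representation
begin

lemma coev_pure_sum:
  obtains ab where "set ab \<subseteq> carrier (YO [k]) \<times> carrier (YO [k])"
    "App (act (coev [k])) (\<iota> 1) = vsum (VT (YO [k]) (YO [k])) (map (\<lambda>(a, b). tn (YO [k]) (YO [k]) a b) ab)"
proof -
  have "App (act (coev [k])) (\<iota> 1) \<in> carrier (VT (YO [k]) (YO [k]))"
    using act_closed[of "\<iota> 1" "coev [k]"] YO_Cons[of k "[k]"] by simp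
  from tensor_pure_sum[OF tensor[OF YO_rvs YO_rvs] YO_rvs YO_rvs this] show ?thesis
    using that by blast
qed

text \<open>The zigzag relation, evaluated at \<open>v\<close>: the unit produces \<open>\<Sum> a \<otimes> b \<otimes> v\<close>, and the counit
contracts \<open>b\<close> with \<open>v\<close>.\<close>

lemma dual_expansion:
  assumes ab: "set ab \<subseteq> carrier (YO [k]) \<times> carrier (YO [k])"
    and t: "App (act (coev [k])) (\<iota> 1) = vsum (VT (YO [k]) (YO [k])) (map (\<lambda>(a, b). tn (YO [k]) (YO [k]) a b) ab)"
    and v: "v \<in> carrier (YO [k])"
  shows "v = vsum (YO [k]) (map (\<lambda>(a, b). form k b v \<odot>\<^bsub>YO [k]\<^esub> a) ab)"
proof -
  let ?V = "YO [k]"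
  let ?W = "VT ?V ?V"
  have W: "YO [k, k] = ?W" using YO_Cons[of k "[k]"] by simp
  have W3: "YO [k, k, k] = VT ?W ?V" using YO_append[of "[k, k]" "[k]"] W by simp
  have Wr: "is_rvs ?W" using YO_rvs[of "[k, k]"] W by simp
  have car: "set (map (\<lambda>(a, b). tn ?V ?V a b) ab) \<subseteq> carrier ?W"
    using ab tn_closed by auto
  have "v = App (act ((ident [k] \<parallel> ev [k]) \<star> (coev [k] \<parallel> ident [k]))) (tn RR ?V (\<iota> 1) v)"
    using right_zigzag[of "[k]"] v act_ident[of v "[k]"] by (simp add: tn_unit(1))
  also have "\<dots> = App (act (ident [k] \<parallel> ev [k])) (App (act (coev [k] \<parallel> ident [k])) (tn RR ?V (\<iota> 1) v))"
    using v tn_unit(1) by (intro act_comp) simp_all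
  also have "App (act (coev [k] \<parallel> ident [k])) (tn RR ?V (\<iota> 1) v) = tn ?W ?V (App (act (coev [k])) (\<iota> 1)) v"
    using act_tensor[of "\<iota> 1" "coev [k]" v "ident [k]"] v W act_ident[of v "[k]"] by simp
  also have "\<dots> = vsum (VT ?W ?V) (map (\<lambda>x. tn ?W ?V x v) (map (\<lambda>(a, b). tn ?V ?V a b) ab))"
    unfolding t by (rule linear_map_vsum[OF tn_linear_left[OF Wr YO_rvs v] car])
  also have "App (act (ident [k] \<parallel> ev [k])) \<dots>
     = vsum ?V (map (App (act (ident [k] \<parallel> ev [k]))) (map (\<lambda>x. tn ?W ?V x v) (map (\<lambda>(a, b). tn ?V ?V a b) ab)))"
  proof (rule linear_map_vsum)
    show "linear_map real_field (VT ?W ?V) ?V (App (act (ident [k] \<parallel> ev [k])))"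
      using act_linear[of "ident [k] \<parallel> ev [k]"] W3 by simp
    show "set (map (\<lambda>x. tn ?W ?V x v) (map (\<lambda>(a, b). tn ?V ?V a b) ab)) \<subseteq> carrier (VT ?W ?V)"
      using car tn_closed[OF Wr YO_rvs _ v] by auto
  qed
  also have "map (App (act (ident [k] \<parallel> ev [k]))) (map (\<lambda>x. tn ?W ?V x v) (map (\<lambda>(a, b). tn ?V ?V a b) ab))
     = map (\<lambda>(a, b). form k b v \<odot>\<^bsub>?V\<^esub> a) ab"
    unfolding map_map
  proof (rule map_cong[OF HOL.refl], clarify)
    fix a b assume "(a, b) \<in> set ab"
    then have a: "a \<in> carrier ?V" and b: "b \<in> carrier ?V" using ab by auto
    have bv: "tn ?V ?V b v \<in> carrier (YO [k, k])" using tn_closed b v W by simp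
    have "App (act (ident [k] \<parallel> ev [k])) (tn ?V ?W a (tn ?V ?V b v)) = tn ?V RR a (\<iota> (form k b v))"
      using act_tensor[of a "ident [k]" "tn ?V ?V b v" "ev [k]"] a b v bv W act_ident[of a "[k]"]
      by (simp add: act_ev)
    then show "(App (act (ident [k] \<parallel> ev [k])) \<circ> ((\<lambda>x. tn ?W ?V x v) \<circ> (\<lambda>(a, b). tn ?V ?V a b))) (a, b) = form k b v \<odot>\<^bsub>?V\<^esub> a"
      using assoc[of ?V ?V ?V a b v] a b v by (simp add: unit_right)
  qed
  finally show ?thesis .
qed

lemma functional_vsum:
  assumes "is_rvs V" "functional V \<phi>" "set xs \<subseteq> carrier V"
  shows "\<phi> (vsum V xs) = (\<Sum>x\<leftarrow>xs. \<phi> x)"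
  using assms(3)
proof (induction xs)
  case Nil
  then show ?case using functional_zero[OF assms(1,2)] assms(1) by simp
next
  case (Cons x xs)
  then show ?case
    using assms(1,2) vsum_closed[OF assms(1), of xs] by (simp add: functional_def)
qed

text \<open>The expansion of the vectors writes the identity as a sum of functionals times vectors. Its trace
\<open>\<Sum> B(b, a)\<close> is the value of the loop, because the form is symmetric.\<close>

theorem fin_dim_object: "vectorspace.fin_dim real_field (YO [k])"
  and loop_value_dim: "loop_value k = real (vectorspace.dim real_field (YO [k]))"
proof -
  let ?V = "YO [k]"
  obtain ab where ab: "set ab \<subseteq> carrier ?V \<times> carrier ?V"
    and t: "App (act (coev [k])) (\<iota> 1) = vsum (VT ?V ?V) (map (\<lambda>(a, b). tn ?V ?V a b) ab)"
    using coev_pure_sum by blast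
  let ?ab = "map (\<lambda>(a, b). (a, form k b)) ab"
  have fab: "a \<in> carrier ?V \<and> functional ?V \<phi>" if "(a, \<phi>) \<in> set ?ab" for a \<phi>
    using that ab form_functional_right by auto
  have comp: "(\<lambda>(a, \<phi>). f a \<phi>) \<circ> (\<lambda>(a, b). (a, form k b)) = (\<lambda>(a, b). f a (form k b))" for f :: "'v \<Rightarrow> ('v \<Rightarrow> real) \<Rightarrow> 'w"
    by auto
  have id: "v = vsum ?V (map (\<lambda>(a, \<phi>). \<phi> v \<odot>\<^bsub>?V\<^esub> a) ?ab)" if "v \<in> carrier ?V" for v
    unfolding map_map comp by (rule dual_expansion[OF ab t that])
  show "vectorspace.fin_dim real_field ?V"
    by (rule trace_identity(1)[OF YO_rvs fab id])
  have "real (vectorspace.dim real_field ?V) = (\<Sum>(a, \<phi>)\<leftarrow>?ab. \<phi> a)"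
    by (rule trace_identity(2)[OF YO_rvs fab id])
  also have "\<dots> = (\<Sum>(a, b)\<leftarrow>ab. form k b a)"
    unfolding map_map comp ..
  also have "\<dots> = (\<Sum>(a, b)\<leftarrow>ab. form k a b)"
    using ab form_sym by (intro arg_cong[of _ _ sum_list] map_cong) auto
  also have "\<dots> = loop_value k"
  proof -
    have W: "is_rvs (VT ?V ?V)" using tensor_bilinear(1)[OF tensor] by simp
    have car: "set (map (\<lambda>(a, b). tn ?V ?V a b) ab) \<subseteq> carrier (VT ?V ?V)"
      using ab tn_closed by auto
    have "loop_value k = coord (App (act (ev [k])) (App (act (coev [k])) (\<iota> 1)))"
      unfolding loop_value_def by (subst act_comp) simp_all
    also have "\<dots> = (\<Sum>x\<leftarrow>map (\<lambda>(a, b). tn ?V ?V a b) ab. coord (App (act (ev [k])) x))"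
      unfolding t by (rule functional_vsum[OF W functional_comp[OF coord_functional act_ev_linear] car])
    also have "\<dots> = (\<Sum>(a, b)\<leftarrow>ab. form k a b)"
      unfolding map_map by (intro arg_cong[of _ _ sum_list] map_cong) (auto simp: form_def)
    finally show ?thesis by simp
  qed
  finally show "loop_value k = real (vectorspace.dim real_field ?V)" by simp
qed

text \<open>If all \<open>B(b, v)\<close> vanish, then so does the expansion of \<open>v\<close>.\<close>

lemma form_nondegenerate:
  assumes v: "v \<in> carrier (YO [k])" "v \<noteq> \<zero>\<^bsub>YO [k]\<^esub>"
  shows "\<exists>w\<in>carrier (YO [k]). form k w v \<noteq> 0"
proof (rule ccontr)
  assume "\<not> ?thesis"
  then have z: "form k w v = 0" if "w \<in> carrier (YO [k])" for w using that by blast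
  interpret V: vectorspace real_field "YO [k]" by (rule YO_rvs)
  obtain ab where ab: "set ab \<subseteq> carrier (YO [k]) \<times> carrier (YO [k])"
    and t: "App (act (coev [k])) (\<iota> 1) = vsum (VT (YO [k]) (YO [k])) (map (\<lambda>(a, b). tn (YO [k]) (YO [k]) a b) ab)"
    using coev_pure_sum by blast
  have "set (map (\<lambda>(a, b). form k b v \<odot>\<^bsub>YO [k]\<^esub> a) ab) \<subseteq> {\<zero>\<^bsub>YO [k]\<^esub>}"
    using ab z V.lmult_0 by auto
  then have "vsum (YO [k]) (map (\<lambda>(a, b). form k b v \<odot>\<^bsub>YO [k]\<^esub> a) ab) = \<zero>\<^bsub>YO [k]\<^esub>"
    by (rule abelian_monoid.sumlist_neutral[OF rvs_abelian_monoid[OF YO_rvs]])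
  then show False using dual_expansion[OF ab t v(1)] v(2) by simp
qed

lemma form_linear:
  assumes "u \<in> carrier (YO [k])" "v \<in> carrier (YO [k])" "w \<in> carrier (YO [k])"
  shows "form k u (v \<oplus>\<^bsub>YO [k]\<^esub> w) = form k u v + form k u w"
    and "form k (v \<oplus>\<^bsub>YO [k]\<^esub> w) u = form k v u + form k w u"
    and "form k u (r \<odot>\<^bsub>YO [k]\<^esub> w) = r * form k u w"
    and "form k (r \<odot>\<^bsub>YO [k]\<^esub> w) u = r * form k w u"
  using form_functional_right[OF assms(1)] form_functional_left[OF assms(1)] assms(2,3)
  unfolding functional_def by blast+

text \<open>Polarization: if \<open>B(e, e)\<close> vanished for \<open>u\<close>, \<open>w\<close> and their sum, then so would \<open>B(u, w)\<close>.\<close>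

lemma anisotropic_vector:
  assumes "S \<subseteq> carrier (YO [k])" "\<And>u w. u \<in> S \<Longrightarrow> w \<in> S \<Longrightarrow> u \<oplus>\<^bsub>YO [k]\<^esub> w \<in> S"
    and "u \<in> S" "w \<in> S" "form k u w \<noteq> 0"
  shows "\<exists>e\<in>S. form k e e \<noteq> 0"
proof (rule ccontr)
  assume "\<not> ?thesis"
  then have z: "form k e e = 0" if "e \<in> S" for e using that by blast
  have c: "u \<in> carrier (YO [k])" "w \<in> carrier (YO [k])" using assms by auto
  have uw: "u \<oplus>\<^bsub>YO [k]\<^esub> w \<in> S" using assms by blast
  then have uwc: "u \<oplus>\<^bsub>YO [k]\<^esub> w \<in> carrier (YO [k])" using assms(1) by blast
  have "form k (u \<oplus>\<^bsub>YO [k]\<^esub> w) (u \<oplus>\<^bsub>YO [k]\<^esub> w) = form k u u + form k u w + (form k w u + form k w w)"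
    by (simp add: form_linear(2)[OF uwc c] form_linear(1)[OF c(1) c] form_linear(1)[OF c(2) c])
  then show False
    using z[OF uw] z[OF assms(3)] z[OF assms(4)] form_sym[OF c] assms(5) by simp
qed

text \<open>Nondegeneracy and polarization give the first vector. Its orthogonal complement is nonzero, as the
dimension is at least two, and the form is nondegenerate on it, so polarization applies again.\<close>

lemma orthogonal_anisotropic_pair:
  assumes dim: "vectorspace.dim real_field (YO [k]) \<ge> 2"
  shows "\<exists>e1 e2. e1 \<in> carrier (YO [k]) \<and> e2 \<in> carrier (YO [k]) \<and>
    form k e1 e1 \<noteq> 0 \<and> form k e2 e2 \<noteq> 0 \<and> form k e1 e2 = 0"
proof -
  let ?V = "YO [k]"
  interpret V: vectorspace real_field ?V by (rule YO_rvs)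
  have outside: "\<exists>v\<in>carrier ?V. v \<notin> V.span {x}" if x: "x \<in> carrier ?V" for x
  proof (rule ccontr)
    assume "\<not> ?thesis"
    then have "V.gen_set {x}" using V.span_is_subset2[of "{x}"] x by auto
    from V.dim_le1I[OF this x] show False using dim by simp
  qed
  obtain v where v: "v \<in> carrier ?V" "v \<noteq> \<zero>\<^bsub>?V\<^esub>"
    using outside[OF V.M.zero_closed] V.span_zero by metis
  obtain w where "w \<in> carrier ?V" "form k w v \<noteq> 0"
    using form_nondegenerate[OF v] by blast
  then obtain e1 where e1: "e1 \<in> carrier ?V" "form k e1 e1 \<noteq> 0"
    using anisotropic_vector[of "carrier ?V" k w v] v by auto
  \<comment> \<open>The projection to the orthogonal complement of the first vector.\<close>
  define pr where "pr u = u \<oplus>\<^bsub>?V\<^esub> (- (form k e1 u / form k e1 e1)) \<odot>\<^bsub>?V\<^esub> e1" for u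
  have sc: "r \<odot>\<^bsub>?V\<^esub> e1 \<in> carrier ?V" for r using e1 by simp
  have pr: "pr u \<in> carrier ?V" "form k e1 (pr u) = 0" if "u \<in> carrier ?V" for u
    using that e1 sc form_linear(1)[OF e1(1) that sc] form_linear(3)[OF e1(1,1,1)] by (auto simp: pr_def)
  obtain x where x: "x \<in> carrier ?V" "x \<notin> V.span {e1}" using outside[OF e1(1)] by blast
  have "pr x \<noteq> \<zero>\<^bsub>?V\<^esub>"
  proof
    assume z: "pr x = \<zero>\<^bsub>?V\<^esub>"
    let ?r = "form k e1 x / form k e1 e1"
    have "pr x \<oplus>\<^bsub>?V\<^esub> ?r \<odot>\<^bsub>?V\<^esub> e1 = x \<oplus>\<^bsub>?V\<^esub> ((- ?r) \<odot>\<^bsub>?V\<^esub> e1 \<oplus>\<^bsub>?V\<^esub> ?r \<odot>\<^bsub>?V\<^esub> e1)"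
      unfolding pr_def using V.M.a_assoc[OF x(1) sc sc] by simp
    also have "(- ?r) \<odot>\<^bsub>?V\<^esub> e1 \<oplus>\<^bsub>?V\<^esub> ?r \<odot>\<^bsub>?V\<^esub> e1 = \<zero>\<^bsub>?V\<^esub>"
      using V.smult_l_distr[of "- ?r" ?r e1] V.lmult_0[OF e1(1)] e1(1) by simp
    finally have "x = ?r \<odot>\<^bsub>?V\<^esub> e1" using z x sc[of ?r] by simp
    moreover have "?r \<odot>\<^bsub>?V\<^esub> e1 \<in> V.span {e1}"
      using V.span_is_subspace[of "{e1}"] V.span_mem[of "{e1}" e1] e1(1)
      by (auto simp: subspace_def intro: submodule.smult_closed)
    ultimately show False using x(2) by simp
  qed
  then obtain w where w: "w \<in> carrier ?V" "form k w (pr x) \<noteq> 0"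
    using form_nondegenerate pr x by blast
  have "form k (pr w) (pr x) = form k w (pr x)"
    using form_linear(2)[OF pr(1)[OF x(1)] w(1) sc] form_linear(4)[OF pr(1)[OF x(1)] e1(1,1)] pr(2)[OF x(1)]
    by (simp add: pr_def[of w])
  moreover have "u \<oplus>\<^bsub>?V\<^esub> w \<in> {u \<in> carrier ?V. form k e1 u = 0}"
    if "u \<in> {u \<in> carrier ?V. form k e1 u = 0}" "w \<in> {u \<in> carrier ?V. form k e1 u = 0}" for u w
    using that form_linear(1)[OF e1(1)] by simp
  ultimately obtain e2 where "e2 \<in> {u \<in> carrier ?V. form k e1 u = 0}" "form k e2 e2 \<noteq> 0"
    using anisotropic_vector[of "{u \<in> carrier ?V. form k e1 u = 0}" k "pr w" "pr x"] pr w x by auto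
  then show ?thesis using e1 by auto
qed

end

section \<open>Faithfulness and multiplicative independence\<close>

lemma flat_pairs_disjoint:
  "distinct (flat ps) \<Longrightarrow> (x, y) \<in> set ps \<Longrightarrow> (a, b) \<in> set ps \<Longrightarrow> a \<in> {x, y} \<or> b \<in> {x, y} \<Longrightarrow>
    a = x \<and> b = y"
proof (induction ps rule: flat.induct)
  case (2 u w ps)
  have "p \<in> set (flat ps) \<and> q \<in> set (flat ps)" if "(p, q) \<in> set ps" for p q
    using that by (induction ps rule: flat.induct) auto
  then show ?case using 2 by auto
qed simp

lemma mem_flat: "x \<in> set (flat ps) \<longleftrightarrow> (\<exists>y. (x, y) \<in> set ps \<or> (y, x) \<in> set ps)"
  by (induction ps rule: flat.induct) auto

lemma mem_matching: "e \<in> matching ps \<longleftrightarrow> (\<exists>x y. (x, y) \<in> set ps \<and> e = {x, y})"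
  by (auto simp: matching_def)

lemma prod_list_count:
  fixes d :: "nat \<Rightarrow> real"
  assumes "finite A" "set ks \<subseteq> A"
  shows "(\<Prod>k\<leftarrow>ks. d k) = (\<Prod>k\<in>A. d k ^ count (mset ks) k)"
  using assms(2)
proof (induction ks)
  case (Cons a ks)
  have "(\<Prod>k\<in>A. d k ^ count (mset (a # ks)) k) = (\<Prod>k\<in>A. (if k = a then d k else 1) * d k ^ count (mset ks) k)"
    by (rule prod.cong) auto
  also have "\<dots> = d a * (\<Prod>k\<in>A. d k ^ count (mset ks) k)"
    using Cons.prems assms(1) by (simp add: prod.distrib)
  finally show ?case using Cons by simp
qed simp

lemma list_with_counts:
  "finite A \<Longrightarrow> \<exists>ks. \<forall>k. count (mset ks) k = (if k \<in> A then f k else 0)"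
proof (induction A rule: finite_induct)
  case empty
  then show ?case by (intro exI[of _ "[]"]) simp
next
  case (insert a A)
  then obtain ks where "\<forall>k. count (mset ks) k = (if k \<in> A then f k else 0)" by blast
  then show ?case
    using insert.hyps by (intro exI[of _ "replicate (f a) a @ ks"]) (auto simp: count_replicate_mset)
qed

text \<open>For positive \<open>d\<close>, this is linear independence over the integers of the logarithms of the \<open>d k\<close>.\<close>

definition independent :: "(nat \<Rightarrow> nat) \<Rightarrow> bool" where
  "independent d \<longleftrightarrow> (\<forall>l :: nat \<Rightarrow> int. finite {k. l k \<noteq> 0} \<longrightarrow>
     (\<Prod>k | l k \<noteq> 0. real (d k) powi l k) = 1 \<longrightarrow> (\<forall>k. l k = 0))"

text \<open>Writing the exponents as differences of natural numbers clears the denominators.\<close>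

lemma prod_powi_diff:
  fixes d :: "nat \<Rightarrow> nat"
  assumes pos: "\<And>k. d k > 0" and fin: "finite A" and sub: "{k. l k \<noteq> 0} \<subseteq> A"
    and l: "\<And>k. k \<in> A \<Longrightarrow> l k = int (m k) - int (n k)"
  shows "(\<Prod>k | l k \<noteq> 0. real (d k) powi l k) * (\<Prod>k\<in>A. real (d k) ^ n k) = (\<Prod>k\<in>A. real (d k) ^ m k)"
proof -
  have "(\<Prod>k | l k \<noteq> 0. real (d k) powi l k) = (\<Prod>k\<in>A. real (d k) powi l k)"
    using fin sub by (intro prod.mono_neutral_left) auto
  also have "\<dots> * (\<Prod>k\<in>A. real (d k) ^ n k) = (\<Prod>k\<in>A. real (d k) powi l k * real (d k) ^ n k)"
    by (simp add: prod.distrib)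
  also have "\<dots> = (\<Prod>k\<in>A. real (d k) ^ m k)"
  proof (rule prod.cong[OF HOL.refl])
    fix k assume "k \<in> A"
    have "real (d k) \<noteq> 0" using pos[of k] by simp
    then have "real (d k) powi (l k + int (n k)) = real (d k) powi l k * real (d k) powi int (n k)"
      by (intro power_int_add) simp
    then show "real (d k) powi l k * real (d k) ^ n k = real (d k) ^ m k"
      using l[OF \<open>k \<in> A\<close>] by simp
  qed
  finally show ?thesis .
qed

text \<open>If \<open>d k = 1\<close>, the exponent \<open>1\<close> at \<open>k\<close> and \<open>0\<close> elsewhere is a nontrivial relation.\<close>

lemma independent_ge_2:
  assumes "independent d" "d k > 0" shows "d k \<ge> 2"
proof (rule ccontr)
  assume "\<not> ?thesis"
  then have "d k = 1" using assms(2) by simp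
  let ?l = "\<lambda>j. if j = k then 1 else (0::int)"
  have supp: "{j. ?l j \<noteq> 0} = {k}" by auto
  have "?l k = 0"
  proof (rule assms(1)[unfolded independent_def, rule_format, of ?l])
    show "finite {j. ?l j \<noteq> 0}" unfolding supp by simp
    show "(\<Prod>j | ?l j \<noteq> 0. real (d j) powi ?l j) = 1" unfolding supp using \<open>d k = 1\<close> by simp
  qed
  then show False by simp
qed

lemma independent_mset_eq:
  assumes ind: "independent d" and pos: "\<And>k. d k > 0"
    and eq: "(\<Prod>k\<leftarrow>ks. real (d k)) = (\<Prod>k\<leftarrow>ls. real (d k))"
  shows "mset ks = mset ls"
proof -
  let ?A = "set ks \<union> set ls"
  let ?l = "\<lambda>k. int (count (mset ks) k) - int (count (mset ls) k)"
  have sub: "{k. ?l k \<noteq> 0} \<subseteq> ?A"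
  proof
    fix k assume "k \<in> {k. ?l k \<noteq> 0}"
    then have "count (mset ks) k \<noteq> count (mset ls) k" by simp
    then show "k \<in> ?A"
      using count_mset_0_iff[of ks k] count_mset_0_iff[of ls k] by (metis UnCI)
  qed
  have "(\<Prod>k | ?l k \<noteq> 0. real (d k) powi ?l k) * (\<Prod>k\<leftarrow>ls. real (d k)) = (\<Prod>k\<leftarrow>ks. real (d k))"
    using prod_powi_diff[OF pos _ sub, of "count (mset ks)" "count (mset ls)"]
      prod_list_count[of ?A ks "\<lambda>k. real (d k)"] prod_list_count[of ?A ls "\<lambda>k. real (d k)"] by simp
  moreover have "(\<Prod>k\<leftarrow>ls. real (d k)) \<noteq> 0"
    by (simp add: prod_list_zero_iff image_iff pos[THEN gr_implies_not0])
  ultimately have "(\<Prod>k | ?l k \<noteq> 0. real (d k) powi ?l k) = 1"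
    unfolding eq by simp
  then have "?l k = 0" for k
    using finite_subset[OF sub] by (intro ind[unfolded independent_def, rule_format, of ?l]) simp_all
  then show ?thesis by (intro multiset_eqI) simp
qed

context brauer_representation
begin

abbreviation d :: "nat \<Rightarrow> nat" where
  "d k \<equiv> vectorspace.dim real_field (YO [k])"

text \<open>A linear map on the real line is determined by its value at \<open>1\<close>.\<close>

lemma act_loops_eq:
  assumes "(\<Prod>k\<leftarrow>ks. real (d k)) = (\<Prod>k\<leftarrow>ls. real (d k))"
  shows "act (loops ks) = act (loops ls)"
proof -
  have l: "linear_map real_field RR RR (App (act (loops ms)))" "App (act (loops ms)) \<in> extensional (carrier RR)" for ms
    using act_lin_maps[of "loops ms"] by (simp_all add: lin_maps_iff)
  have "App (act (loops ms)) (\<iota> r) = \<iota> (r * (\<Prod>k\<leftarrow>ms. real (d k)))" for ms r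
    using linear_map_smult[OF l(1)[of ms], of "\<iota> 1" r] act_loops[of ms] unit_smult[of r 1]
    by (simp add: loop_value_dim unit_smult)
  then have "App (act (loops ks)) (\<iota> r) = App (act (loops ls)) (\<iota> r)" for r
    using assms by simp
  then have "App (act (loops ks)) u = App (act (loops ls)) u" if "u \<in> carrier RR" for u
    using iota_coord[OF that] by metis
  then have "App (act (loops ks)) = App (act (loops ls))"
    by (intro extensionalityI[OF l(2) l(2)])
  then show ?thesis
    using act_Src_Tgt[of "loops ks"] act_Src_Tgt[of "loops ls"] by (intro lin.expand) simp
qed

lemma faithful_iff: "faithful cBr YM \<longleftrightarrow>
    (\<forall>f g. source f = source g \<longrightarrow> target f = target g \<longrightarrow> act f = act g \<longrightarrow> f = g)"
proof
  assume F: "faithful cBr YM"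
  show "\<forall>f g. source f = source g \<longrightarrow> target f = target g \<longrightarrow> act f = act g \<longrightarrow> f = g"
  proof (intro allI impI)
    fix f g assume st: "source f = source g" "target f = target g" and "act f = act g"
    moreover have "inj_on YM (Mor cBr (source f) (target f))"
      using F by (simp add: faithful_def)
    ultimately have "Rep_arrow f = Rep_arrow g"
      using Rep_arrow_mor[of f] Rep_arrow_mor[of g] unfolding act_def by (metis inj_onD)
    then show "f = g" by (simp add: Rep_arrow_inject)
  qed
next
  assume A: "\<forall>f g. source f = source g \<longrightarrow> target f = target g \<longrightarrow> act f = act g \<longrightarrow> f = g"
  show "faithful cBr YM"
    unfolding faithful_def
  proof (intro ballI inj_onI)
    fix X Y F G assume "F \<in> Mor cBr X Y" "G \<in> Mor cBr X Y" and eq: "YM F = YM G"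
    then obtain f g where fg: "cbr_arr f X Y" "F = cbr_class f" "cbr_arr g X Y" "G = cbr_class g"
      by auto
    then have "arr f = arr g"
      using A[rule_format, of "arr f" "arr g"] eq by (simp add: act_def Rep_arr source_target_arr)
    then show "F = G" using fg Rep_arr by metis
  qed
qed

text \<open>The loops for the positive and for the negative exponents have the same value, so by faithfulness they
have the same colours.\<close>

lemma faithful_imp_independent:
  assumes F: "faithful cBr YM" and pos: "\<And>k. d k > 0"
  shows "independent d"
  unfolding independent_def
proof (intro allI impI)
  fix l :: "nat \<Rightarrow> int" and k
  assume fin: "finite {k. l k \<noteq> 0}" and one: "(\<Prod>k | l k \<noteq> 0. real (d k) powi l k) = 1"
  let ?A = "{k. l k \<noteq> 0}"
  \<comment> \<open>The truncation of negative integers by \<^const>\<open>nat\<close> extracts the two parts of \<open>l\<close>.\<close>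
  obtain ks where ks: "\<And>k. count (mset ks) k = (if k \<in> ?A then nat (l k) else 0)"
    using list_with_counts[OF fin, of "\<lambda>k. nat (l k)"] by blast
  obtain ls where ls: "\<And>k. count (mset ls) k = (if k \<in> ?A then nat (- l k) else 0)"
    using list_with_counts[OF fin, of "\<lambda>k. nat (- l k)"] by blast
  have mem: "k \<in> set ks \<longleftrightarrow> l k > 0" "k \<in> set ls \<longleftrightarrow> l k < 0" for k
    using ks[of k] ls[of k] count_mset_0_iff[of ks k] count_mset_0_iff[of ls k] by (auto split: if_splits)
  then have sub: "set ks \<subseteq> ?A" "set ls \<subseteq> ?A" by auto
  have "(\<Prod>k\<leftarrow>ls. real (d k)) = (\<Prod>k\<leftarrow>ks. real (d k))"
    using prod_powi_diff[of d ?A l "count (mset ks)" "count (mset ls)", OF pos fin order_refl] one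
      prod_list_count[OF fin sub(1), of "\<lambda>k. real (d k)"] prod_list_count[OF fin sub(2), of "\<lambda>k. real (d k)"]
    by (simp add: ks ls)
  then have "act (loops ls) = act (loops ks)" by (rule act_loops_eq)
  then have "loops ls = loops ks"
    using F unfolding faithful_iff by simp
  then have "set ls = set ks" by (rule loops_eq_imp_set_eq)
  then show "l k = 0" using mem[of k] by (metis less_asym linorder_neqE_linordered_idom)
qed

text \<open>For a pair \<open>{x, y}\<close> that is matched by \<open>ps\<close> but not by \<open>qs\<close>, put \<open>e\<^sub>2\<close> at \<open>x\<close> and \<open>y\<close> and \<open>e\<^sub>1\<close> at all
other points. Every pair of \<open>ps\<close> carries two equal anisotropic vectors, whereas \<open>qs\<close> matches \<open>x\<close> with
a point that carries \<open>e\<^sub>1\<close>, which is orthogonal to \<open>e\<^sub>2\<close>.\<close>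

lemma matching_subset_of_values:
  assumes dim: "\<And>k. d k \<ge> 2"
    and ps: "well_coloured ps" "distinct (flat ps)"
    and qs: "well_coloured qs" "distinct (flat qs)" "set (flat qs) = set (flat ps)"
    and vals: "\<And>v. admissible v \<Longrightarrow> (\<Prod>(x, y)\<leftarrow>ps. form (fst x) (v x) (v y)) \<noteq> 0 \<Longrightarrow>
      (\<Prod>(x, y)\<leftarrow>qs. form (fst x) (v x) (v y)) \<noteq> 0"
  shows "matching ps \<subseteq> matching qs"
proof
  fix e assume "e \<in> matching ps"
  then obtain x y where xy: "(x, y) \<in> set ps" "e = {x, y}" by (auto simp: mem_matching)
  obtain e1 e2 where E: "\<And>k. e1 k \<in> carrier (YO [k]) \<and> e2 k \<in> carrier (YO [k]) \<and>
    form k (e1 k) (e1 k) \<noteq> 0 \<and> form k (e2 k) (e2 k) \<noteq> 0 \<and> form k (e1 k) (e2 k) = 0"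
    using orthogonal_anisotropic_pair[OF dim] by metis
  define v where "v z = (if z \<in> {x, y} then e2 (fst z) else e1 (fst z))" for z :: point
  have v: "admissible v" unfolding admissible_def v_def using E by simp
  have col: "fst a = fst b" if "(a, b) \<in> set ps \<or> (a, b) \<in> set qs" for a b
    using that ps(1) qs(1) by (auto simp: well_coloured_def)
  have "form (fst a) (v a) (v b) \<noteq> 0" if ab: "(a, b) \<in> set ps" for a b
  proof -
    have c: "fst b = fst a" using col[of a b] ab by simp
    consider "a = x" "b = y" | "a \<notin> {x, y}" "b \<notin> {x, y}"
      using flat_pairs_disjoint[OF ps(2) xy(1) ab] by blast
    then have "v a = e2 (fst a) \<and> v b = e2 (fst a) \<or> v a = e1 (fst a) \<and> v b = e1 (fst a)"
      by cases (use c in \<open>simp_all add: v_def\<close>)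
    then show ?thesis using E[of "fst a"] by auto
  qed
  then have "(\<Prod>(x, y)\<leftarrow>ps. form (fst x) (v x) (v y)) \<noteq> 0"
    by (auto simp: prod_list_zero_iff)
  then have nz: "form (fst a) (v a) (v b) \<noteq> 0" if "(a, b) \<in> set qs" for a b
    using vals[OF v] that by (force simp: prod_list_zero_iff)
  have "x \<in> set (flat qs)" using xy qs(3) mem_flat by metis
  then obtain w where w: "(x, w) \<in> set qs \<or> (w, x) \<in> set qs" using mem_flat by metis
  have "w \<in> {x, y}"
  proof (rule ccontr)
    assume "w \<notin> {x, y}"
    then have vw: "v x = e2 (fst x)" "v w = e1 (fst w)" by (simp_all add: v_def)
    have "fst w = fst x" using w col by metis
    then have "form (fst x) (v w) (v x) = 0" "form (fst x) (v x) (v w) = 0"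
      using vw E[of "fst x"] form_sym by metis+
    then show False using w nz \<open>fst w = fst x\<close> by metis
  qed
  moreover have "w \<noteq> x"
  proof
    assume "w = x"
    then have "(x, x) \<in> set qs" using w by simp
    with qs(2) show False by (induction qs rule: flat.induct) auto
  qed
  ultimately have "(x, y) \<in> set qs \<or> (y, x) \<in> set qs" using w by auto
  then show "e \<in> matching qs"
    unfolding mem_matching xy(2) by (metis insert_commute)
qed

text \<open>Comparing values on pure tensors yields first the matching, then the product of the loop values, and
by independence the loops.\<close>

lemma effect_eq:
  assumes ind: "independent d" and pos: "\<And>k. d k > 0"
    and fg: "source f = source g" "target f = []" "target g = []" "act f = act g"
  shows "f = g"
proof -
  have dim: "d k \<ge> 2" for k using independent_ge_2[OF ind pos] .
  define xs where "xs = zip (source f) [0..<length (source f)]"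
  have xs: "lab xs = source f" "distinct xs"
    unfolding xs_def by (simp_all add: distinct_zipI2)
  obtain ks ps p where f: "well_coloured ps" "perm p xs (flat ps)" "f = loops ks \<parallel> (evs ps \<star> p)"
    using effect_normal[OF fg(2) xs] unfolding normal_effect_def by blast
  obtain ls qs q where g: "well_coloured qs" "perm q xs (flat qs)" "g = loops ls \<parallel> (evs qs \<star> q)"
    using effect_normal[of g xs] xs fg unfolding normal_effect_def by auto
  let ?k = "\<Prod>k\<leftarrow>ks. real (d k)" and ?l = "\<Prod>k\<leftarrow>ls. real (d k)"
  let ?P = "\<lambda>v ps. \<Prod>(x, y)\<leftarrow>ps. form (fst x) (v x) (v y)"
  have nz: "?k \<noteq> 0" "?l \<noteq> 0"
    by (simp_all add: prod_list_zero_iff image_iff pos[THEN gr_implies_not0])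
  have vals: "?k * ?P v ps = ?l * ?P v qs" if "admissible v" for v
    using act_normal[OF f(1,2) that, of ks] act_normal[OF g(1,2) that, of ls] f(3) g(3) fg(4)
    by (simp add: loop_value_dim)
  have dist: "distinct (flat ps)" "distinct (flat qs)"
    using perm_mset[OF f(2)] perm_mset[OF g(2)] xs(2) by (metis mset_eq_imp_distinct_iff)+
  have seteq: "set (flat ps) = set (flat qs)"
    using perm_mset[OF f(2)] perm_mset[OF g(2)] by (metis mset_eq_setD)
  have nonzero: "y \<noteq> 0" if "a * x = b * y" "a \<noteq> 0" "x \<noteq> 0" for a b x y :: real
    using that by auto
  have "matching ps = matching qs"
  proof
    show "matching ps \<subseteq> matching qs"
    proof (rule matching_subset_of_values[OF dim f(1) dist(1) g(1) dist(2) seteq[symmetric]])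
      fix v assume "admissible v" "?P v ps \<noteq> 0"
      then show "?P v qs \<noteq> 0" by (intro nonzero[OF vals nz(1)])
    qed
    show "matching qs \<subseteq> matching ps"
    proof (rule matching_subset_of_values[OF dim g(1) dist(2) f(1) dist(1) seteq])
      fix v assume "admissible v" "?P v qs \<noteq> 0"
      then show "?P v ps \<noteq> 0" by (intro nonzero[OF vals[symmetric] nz(2)])
    qed
  qed
  then have eq: "evs ps \<star> p = evs qs \<star> q"
    using evs_perm_eq[OF f(1) g(1) f(2) g(2) xs(2)] by simp
  \<comment> \<open>With the same anisotropic vector of its colour at every endpoint, the common product of the
    forms does not vanish and can be cancelled.\<close>
  obtain e1 where E: "\<And>k. e1 k \<in> carrier (YO [k]) \<and> form k (e1 k) (e1 k) \<noteq> 0"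
    using orthogonal_anisotropic_pair[OF dim] by metis
  define v where "v z = e1 (fst z)" for z :: point
  have v: "admissible v" unfolding admissible_def v_def using E by simp
  have "?P v ps = ?P v qs"
    using act_normal[OF f(1,2) v, of "[]"] act_normal[OF g(1,2) v, of "[]"] eq by simp
  moreover have "?P v ps \<noteq> 0"
    using E f(1) by (force simp: prod_list_zero_iff v_def well_coloured_def)
  ultimately have "?k = ?l" using vals[OF v] by simp
  then have "mset ks = mset ls" by (rule independent_mset_eq[OF ind pos])
  then show ?thesis using f(3) g(3) eq loops_mset by metis
qed

lemma independent_imp_faithful:
  assumes "independent d" "\<And>k. d k > 0"
  shows "faithful cBr YM"
  unfolding faithful_iff
proof (intro allI impI)
  fix f g assume fg: "source f = source g" "target f = target g" "act f = act g"
  have "act (bend f) = act (bend g)"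
    unfolding bend_def using fg by (simp add: act_comp_eq act_tensor_eq)
  then have "bend f = bend g"
    using effect_eq[OF assms, of "bend f" "bend g"] fg by simp
  show "f = g"
    using bend_inverse[of f] unfolding \<open>bend f = bend g\<close> fg(1,2) bend_inverse[of g] by (rule HOL.sym)
qed

end

theorem theorem1p2:
  fixes RR :: "'v rvs"
    and \<iota> :: "real \<Rightarrow> 'v"
    and VT :: "'v rvs \<Rightarrow> 'v rvs \<Rightarrow> 'v rvs"
    and tn :: "'v rvs \<Rightarrow> 'v rvs \<Rightarrow> 'v \<Rightarrow> 'v \<Rightarrow> 'v"
    and YO :: "cbr_obj \<Rightarrow> 'v rvs"
    and YM :: "cbr_expr set \<Rightarrow> 'v lin"
  assumes "strict_tensor_structure RR \<iota> VT tn"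
    and "symmetric_strict_monoidal_functor cBr (Vect RR VT tn) YO YM"
  defines "d \<equiv> \<lambda>k. vectorspace.dim real_field (YO [k])"
  shows "(\<forall>k. vectorspace.fin_dim real_field (YO [k])) \<and>
         ((\<forall>k. d k > 0) \<longrightarrow>
           (faithful cBr YM \<longleftrightarrow>
             (\<forall>l :: nat \<Rightarrow> int. finite {k. l k \<noteq> 0} \<longrightarrow>
               (\<Prod>k | l k \<noteq> 0. real (d k) powi l k) = 1 \<longrightarrow> (\<forall>k. l k = 0))))"
proof -
  interpret brauer_representation RR \<iota> VT tn YO YM
    by (intro brauer_representation.intro assms(1,2))
  show ?thesis
    using fin_dim_object faithful_imp_independent independent_imp_faithful
    unfolding d_def independent_def by blast
qed

end
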